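(* Let $(\Gamma,\Lambda)$ be a Hecke pair, let $\mathcal{G}=\Gamma/\!\!/\Lambda$ be its Schlichting completion with structure map $\alpha\colon\Gamma\to\mathcal{G}$, let $\phi\colon\Gamma\to G$ be a TDLC completion of $(\Gamma,\Lambda)$, and let $\check\phi\colon G\to\mathcal{G}$ be the unique continuous map with $\check\phi\circ\phi=\alpha$. For every $n\in\mathbb{N}$ and every commutative ring $R$, the isomorphism $$\check\phi^*\colon\operatorname{Hom}_{\mathrm{top}}(\mathcal{G},\mathbb{R})\to\operatorname{Hom}_{\mathrm{top}}(G,\mathbb{R}),\qquad\psi\mapsto\psi\circ\check\phi,$$ restricts to bijections $\Sigma^n_{\mathrm{top}}(\mathcal{G})\cong\Sigma^n_{\mathrm{top}}(G)$ and $\Sigma^n_{\mathrm{top}}(\mathcal{G};R)\cong\Sigma^n_{\mathrm{top}}(G;R)$. As a consequence, the $n$-th homotopical and homological $\Sigma$-sets of any two TDLC completions of $(\Gamma,\Lambda)$ are in canonical bijection (through these identifications with the $\Sigma$-sets of $\mathcal{G}$).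
   Context: Conventions: $\mathbb{N}$ includes $0$; rings have a unit. Two subgroups of a group are commensurate if their intersection has finite index in both; a subgroup is commensurated if it is commensurate to all its conjugates. A Hecke pair $(\Gamma,\Lambda)$ consists of a Hausdorff topological group $\Gamma$ and an open commensurated subgroup $\Lambda$. A TDLC completion of $(\Gamma,\Lambda)$ is a totally disconnected locally compact (Hausdorff) group $G$ with a continuous homomorphism $\phi\colon\Gamma\to G$ with dense image such that $\Lambda=\phi^{-1}(L)$ for some compact open subgroup $L\subseteq G$. The Schlichting completion $\Gamma/\!\!/\Lambda$ is the closure of $\alpha(\Gamma)$ in $\operatorname{Sym}(\Gamma/\Lambda)$ with the topology of pointwise convergence ($\Gamma/\Lambda$ discrete), where $\alpha\colon\Gamma\to\operatorname{Sym}(\Gamma/\Lambda)$ is left multiplication on left cosets; it is a TDLC completion. By a known theorem of Reid and Wesolek, for every TDLC completion $\phi\colon\Gamma\to G$ there is a unique continuous map $\check\phi\colon G\to\Gamma/\!\!/\Lambda$ with $\check\phi\circ\phi=\alpha$, and $\check\phi$ is a quotient homomorphism with compact kernel. For a set $X$, $\operatorname{E}X$ is the simplicial set whose $k$-simplices are the tuples $(x_0,\dots,x_k)\in X^{k+1}$, the $i$-th face (degeneracy) map deleting (doubling) the $i$-th entry. For a topological space $X$, $\mathcal{C}(X)$ is the poset of compact subspaces ordered by inclusion. A filtration of a connected simplicial set $Y$ over a directed poset $A$ (a monotone family of simplicial subsets $(Y_\alpha)_{\alpha\in A}$ with union $Y$) is essentially $m$-connected if for some (equivalently every) vertex $y$,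 for all $0\le k\le m$ and every $\alpha$ with $y\in Y_\alpha$ there is $\beta\ge\alpha$ such that $\pi_k(|Y_\alpha|,y)\to\pi_k(|Y_\beta|,y)$ is trivial; it is essentially $m$-acyclic over $R$ if for all $0\le k\le m$ and every $\alpha$ there is $\beta\ge\alpha$ such that $\tilde{\operatorname{H}}_k(Y_\alpha;R)\to\tilde{\operatorname{H}}_k(Y_\beta;R)$ is zero. Both are vacuous for $m=-1$. For a locally compact Hausdorff group $G$ and a character (continuous homomorphism) $\chi\colon G\to\mathbb{R}$, put $G_\chi=\chi^{-1}([0,+\infty))$ and $G_\chi\cdot\operatorname{E}C=\bigcup_{g\in G_\chi}g\cdot\operatorname{E}C\subseteq\operatorname{E}G$ (left multiplication). $\operatorname{Hom}_{\mathrm{top}}(G,\mathbb{R})$ is the vector space of characters. $\Sigma^n_{\mathrm{top}}(G)$ (resp. $\Sigma^n_{\mathrm{top}}(G;R)$) is the set of characters $\chi$ for which the filtration $(G_\chi\cdot\operatorname{E}C)_{C\in\mathcal{C}(G)}$ of $\operatorname{E}G$ is essentially $(n-1)$-connected (resp. essentially $(n-1)$-acyclic over $R$). *)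

theory Defs
  imports
    "HOL-Analysis.Analysis"
    "HOL-Algebra.Ring"
    "HOL-Algebra.Bij"
    "HOL-Algebra.Left_Coset"
    "HOL-Homology.Homology"
begin

section \<open>Topological groups and characters\<close>

record 'a top_group = "'a monoid" +
  opens :: "'a topology"

locale topological_group = group G for G :: "'a top_group" (structure) +
  assumes topspace_opens: "topspace (opens G) = carrier G"
    and continuous_mult:
      "continuous_map (prod_topology (opens G) (opens G)) (opens G) (\<lambda>(x, y). x \<otimes> y)"
    and continuous_inv: "continuous_map (opens G) (opens G) (\<lambda>x. inv x)"

definition totally_disconnected_space :: "'a topology \<Rightarrow> bool" where
  "totally_disconnected_space X \<longleftrightarrow> (\<forall>x\<in>topspace X. connected_component_of_set X x = {x})"

locale tdlc_group = topological_group +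
  assumes Hausdorff: "Hausdorff_space (opens G)"
    and locally_compact: "locally_compact_space (opens G)"
    and totally_disconnected: "totally_disconnected_space (opens G)"

text \<open>Characters are extensional, so that equality of characters is equality of HOL functions.\<close>

definition characters :: "'a top_group \<Rightarrow> ('a \<Rightarrow> real) set" where
  "characters G = {\<xi> \<in> extensional (carrier G). continuous_map (opens G) euclideanreal \<xi> \<and>
     (\<forall>x\<in>carrier G. \<forall>y\<in>carrier G. \<xi> (x \<otimes>\<^bsub>G\<^esub> y) = \<xi> x + \<xi> y)}"

definition char_add :: "'a top_group \<Rightarrow> ('a \<Rightarrow> real) \<Rightarrow> ('a \<Rightarrow> real) \<Rightarrow> 'a \<Rightarrow> real" where
  "char_add G \<xi> \<psi> = (\<lambda>g\<in>carrier G. \<xi> g + \<psi> g)"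

definition char_scale :: "'a top_group \<Rightarrow> real \<Rightarrow> ('a \<Rightarrow> real) \<Rightarrow> 'a \<Rightarrow> real" where
  "char_scale G a \<xi> = (\<lambda>g\<in>carrier G. a * \<xi> g)"

definition char_space_iso ::
    "'a top_group \<Rightarrow> 'b top_group \<Rightarrow> (('a \<Rightarrow> real) \<Rightarrow> ('b \<Rightarrow> real)) \<Rightarrow> bool" where
  "char_space_iso G H p \<longleftrightarrow>
     bij_betw p (characters G) (characters H) \<and>
     (\<forall>\<psi>\<in>characters G. \<forall>\<psi>'\<in>characters G. p (char_add G \<psi> \<psi>') = char_add H (p \<psi>) (p \<psi>')) \<and>
     (\<forall>a. \<forall>\<psi>\<in>characters G. p (char_scale G a \<psi>) = char_scale H a (p \<psi>))"

definition char_pullback :: "'b top_group \<Rightarrow> ('b \<Rightarrow> 'a) \<Rightarrow> ('a \<Rightarrow> real) \<Rightarrow> 'b \<Rightarrow> real" where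
  "char_pullback G f \<psi> = compose (carrier G) \<psi> f"


section \<open>Hecke pairs and their TDLC completions\<close>

definition finite_index :: "('a, 'm) monoid_scheme \<Rightarrow> 'a set \<Rightarrow> 'a set \<Rightarrow> bool" where
  "finite_index G K H \<longleftrightarrow> finite (rcosets\<^bsub>G\<lparr>carrier := H\<rparr>\<^esub> K)"

definition commensurate :: "('a, 'm) monoid_scheme \<Rightarrow> 'a set \<Rightarrow> 'a set \<Rightarrow> bool" where
  "commensurate G H K \<longleftrightarrow> finite_index G (H \<inter> K) H \<and> finite_index G (H \<inter> K) K"

definition commensurated :: "('a, 'm) monoid_scheme \<Rightarrow> 'a set \<Rightarrow> bool" where
  "commensurated G H \<longleftrightarrow> subgroup H G \<and>
     (\<forall>g\<in>carrier G. commensurate G H ((g <#\<^bsub>G\<^esub> H) #>\<^bsub>G\<^esub> inv\<^bsub>G\<^esub> g))"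

definition hecke_pair :: "'a top_group \<Rightarrow> 'a set \<Rightarrow> bool" where
  "hecke_pair \<Gamma> \<Lambda> \<longleftrightarrow> topological_group \<Gamma> \<and> Hausdorff_space (opens \<Gamma>) \<and>
     openin (opens \<Gamma>) \<Lambda> \<and> commensurated \<Gamma> \<Lambda>"

definition tdlc_completion ::
    "'a top_group \<Rightarrow> 'a set \<Rightarrow> 'b top_group \<Rightarrow> ('a \<Rightarrow> 'b) \<Rightarrow> bool" where
  "tdlc_completion \<Gamma> \<Lambda> G \<phi> \<longleftrightarrow> tdlc_group G \<and>
     \<phi> \<in> hom \<Gamma> G \<and> continuous_map (opens \<Gamma>) (opens G) \<phi> \<and>
     Abstract_Topology.closure_of (opens G) (\<phi> ` carrier \<Gamma>) = topspace (opens G) \<and>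
     (\<exists>L. subgroup L G \<and> compactin (opens G) L \<and> openin (opens G) L \<and>
          \<Lambda> = {\<gamma> \<in> carrier \<Gamma>. \<phi> \<gamma> \<in> L})"

definition sym_topology :: "'c set \<Rightarrow> ('c \<Rightarrow> 'c) topology" where
  "sym_topology S = subtopology (product_topology (\<lambda>_. discrete_topology S) S) (Bij S)"

definition schlichting_map :: "'a top_group \<Rightarrow> 'a set \<Rightarrow> 'a \<Rightarrow> 'a set \<Rightarrow> 'a set" where
  "schlichting_map \<Gamma> \<Lambda> \<gamma> = (\<lambda>C\<in>lcosets\<^bsub>\<Gamma>\<^esub> \<Lambda>. \<gamma> <#\<^bsub>\<Gamma>\<^esub> C)"

definition schlichting :: "'a top_group \<Rightarrow> 'a set \<Rightarrow> ('a set \<Rightarrow> 'a set) top_group" where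
  "schlichting \<Gamma> \<Lambda> =
     (let S = lcosets\<^bsub>\<Gamma>\<^esub> \<Lambda>;
          C = Abstract_Topology.closure_of (sym_topology S) (schlichting_map \<Gamma> \<Lambda> ` carrier \<Gamma>)
      in \<lparr>carrier = C, mult = mult (BijGroup S), one = one (BijGroup S),
          opens = subtopology (sym_topology S) C\<rparr>)"

text \<open>For a TDLC completion of a Hecke pair, such a map exists (Reid and Wesolek) and is unique,
  by density of the image of \<open>\<phi>\<close>; extensionality pins down the HOL function off the carrier.\<close>

definition completion_map ::
    "'a top_group \<Rightarrow> 'a set \<Rightarrow> 'b top_group \<Rightarrow> ('a \<Rightarrow> 'b) \<Rightarrow> 'b \<Rightarrow> 'a set \<Rightarrow> 'a set" where
  "completion_map \<Gamma> \<Lambda> G \<phi> =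
     (THE f. f \<in> extensional (carrier G) \<and>
             continuous_map (opens G) (opens (schlichting \<Gamma> \<Lambda>)) f \<and>
             (\<forall>\<gamma>\<in>carrier \<Gamma>. f (\<phi> \<gamma>) = schlichting_map \<Gamma> \<Lambda> \<gamma>))"


section \<open>Simplicial sets\<close>

text \<open>\<open>face_map Y k i\<close> is the \<open>i\<close>-th face of \<open>k\<close>-simplices and \<open>degen_map Y k i\<close> the \<open>i\<close>-th
  degeneracy of \<open>k\<close>-simplices; only their values on \<open>simplices Y k\<close> for \<open>i \<le> k\<close> matter.\<close>

record 'a sset =
  simplices :: "nat \<Rightarrow> 'a set"
  face_map :: "nat \<Rightarrow> nat \<Rightarrow> 'a \<Rightarrow> 'a"
  degen_map :: "nat \<Rightarrow> nat \<Rightarrow> 'a \<Rightarrow> 'a"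

locale simplicial_set =
  fixes Y :: "'a sset"
  assumes face_closed:
      "\<lbrakk>y \<in> simplices Y (Suc k); i \<le> Suc k\<rbrakk> \<Longrightarrow> face_map Y (Suc k) i y \<in> simplices Y k"
    and degen_closed:
      "\<lbrakk>y \<in> simplices Y k; i \<le> k\<rbrakk> \<Longrightarrow> degen_map Y k i y \<in> simplices Y (Suc k)"
    and face_face:
      "\<lbrakk>y \<in> simplices Y (Suc (Suc k)); i < j; j \<le> Suc (Suc k)\<rbrakk> \<Longrightarrow>
       face_map Y (Suc k) i (face_map Y (Suc (Suc k)) j y) =
       face_map Y (Suc k) (j - 1) (face_map Y (Suc (Suc k)) i y)"
    and degen_degen:
      "\<lbrakk>y \<in> simplices Y k; i \<le> j; j \<le> k\<rbrakk> \<Longrightarrow>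
       degen_map Y (Suc k) i (degen_map Y k j y) =
       degen_map Y (Suc k) (Suc j) (degen_map Y k i y)"
    and face_degen_less:
      "\<lbrakk>y \<in> simplices Y k; i < j; j \<le> k\<rbrakk> \<Longrightarrow>
       face_map Y (Suc k) i (degen_map Y k j y) =
       degen_map Y (k - 1) (j - 1) (face_map Y k i y)"
    and face_degen_eq:
      "\<lbrakk>y \<in> simplices Y k; i = j \<or> i = Suc j; j \<le> k\<rbrakk> \<Longrightarrow>
       face_map Y (Suc k) i (degen_map Y k j y) = y"
    and face_degen_greater:
      "\<lbrakk>y \<in> simplices Y k; Suc j < i; i \<le> Suc k\<rbrakk> \<Longrightarrow>
       face_map Y (Suc k) i (degen_map Y k j y) =
       degen_map Y (k - 1) j (face_map Y k (i - 1) y)"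

text \<open>\<open>(\<lambda>k. S k)\<close> is the family of simplices of a simplicial subset, whose structure maps are
  those of the ambient simplicial set.\<close>

definition simplicial_subset :: "(nat \<Rightarrow> 'a set) \<Rightarrow> 'a sset \<Rightarrow> bool" where
  "simplicial_subset S Y \<longleftrightarrow>
     (\<forall>k. S k \<subseteq> simplices Y k) \<and>
     (\<forall>k. \<forall>y\<in>S (Suc k). \<forall>i\<le>Suc k. face_map Y (Suc k) i y \<in> S k) \<and>
     (\<forall>k. \<forall>y\<in>S k. \<forall>i\<le>k. degen_map Y k i y \<in> S (Suc k))"

abbreviation restrict_sset :: "'a sset \<Rightarrow> (nat \<Rightarrow> 'a set) \<Rightarrow> 'a sset" where
  "restrict_sset Y S \<equiv> Y\<lparr>simplices := S\<rparr>"

definition connected_sset :: "'a sset \<Rightarrow> bool" where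
  "connected_sset Y \<longleftrightarrow> simplices Y 0 \<noteq> {} \<and>
     (\<forall>x\<in>simplices Y 0. \<forall>y\<in>simplices Y 0.
        equivclp (\<lambda>u v. \<exists>e\<in>simplices Y 1. u = face_map Y 1 1 e \<and> v = face_map Y 1 0 e) x y)"

definition E_sset :: "'x set \<Rightarrow> 'x list sset" where
  "E_sset X = \<lparr>simplices = (\<lambda>k. {xs. length xs = Suc k \<and> set xs \<subseteq> X}),
     face_map = (\<lambda>k i xs. take i xs @ drop (Suc i) xs),
     degen_map = (\<lambda>k i xs. take (Suc i) xs @ drop i xs)\<rparr>"


subsection \<open>Geometric realization\<close>

definition quotient_topology :: "'a topology \<Rightarrow> ('a \<Rightarrow> 'b) \<Rightarrow> 'b topology" where
  "quotient_topology X q =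
     topology (\<lambda>U. U \<subseteq> q ` topspace X \<and> openin X {x \<in> topspace X. q x \<in> U})"

lemma openin_quotient_topology:
  "openin (quotient_topology X q) U \<longleftrightarrow>
     U \<subseteq> q ` topspace X \<and> openin X {x \<in> topspace X. q x \<in> U}"
proof -
  let ?L = "\<lambda>U. U \<subseteq> q ` topspace X \<and> openin X {x \<in> topspace X. q x \<in> U}"
  have "istopology ?L"
    unfolding istopology_def
  proof (intro conjI allI impI)
    fix S T assume ST: "?L S" "?L T"
    then show "S \<inter> T \<subseteq> q ` topspace X" by blast
    have eq: "{x \<in> topspace X. q x \<in> S \<inter> T} =
        {x \<in> topspace X. q x \<in> S} \<inter> {x \<in> topspace X. q x \<in> T}" by auto
    show "openin X {x \<in> topspace X. q x \<in> S \<inter> T}"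
      unfolding eq by (intro openin_Int conjunct2[OF ST(1)] conjunct2[OF ST(2)])
  next
    fix \<K> assume \<K>: "\<forall>K\<in>\<K>. ?L K"
    then show "\<Union>\<K> \<subseteq> q ` topspace X" by blast
    have eq: "{x \<in> topspace X. q x \<in> \<Union>\<K>} = \<Union> ((\<lambda>K. {x \<in> topspace X. q x \<in> K}) ` \<K>)"
      by auto
    show "openin X {x \<in> topspace X. q x \<in> \<Union>\<K>}"
      unfolding eq using \<K> by (intro openin_Union) blast
  qed
  then show ?thesis
    by (simp add: quotient_topology_def)
qed

lemma topspace_quotient_topology [simp]: "topspace (quotient_topology X q) = q ` topspace X"
proof -
  have eq: "{x \<in> topspace X. q x \<in> q ` topspace X} = topspace X" by auto
  have "openin (quotient_topology X q) (q ` topspace X)"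
    unfolding openin_quotient_topology eq by simp
  then have "q ` topspace X \<subseteq> topspace (quotient_topology X q)"
    by (rule openin_subset)
  moreover have "topspace (quotient_topology X q) \<subseteq> q ` topspace X"
    using openin_topspace[of "quotient_topology X q"] unfolding openin_quotient_topology
    by (rule conjunct1)
  ultimately show ?thesis
    by (rule subset_antisym[rotated])
qed

lemma quotient_map_quotient_topology: "quotient_map X (quotient_topology X q) q"
  by (auto simp: quotient_map_def openin_quotient_topology)

text \<open>A point of \<open>\<Coprod>\<^sub>k Y\<^sub>k \<times> \<Delta>\<^sup>k\<close> is represented as \<open>((k, y), t)\<close>.\<close>

type_synonym 'a splx_point = "(nat \<times> 'a) \<times> (nat \<Rightarrow> real)"

definition simplex_coproduct :: "'a sset \<Rightarrow> 'a splx_point topology" where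
  "simplex_coproduct Y =
     sum_topology (\<lambda>(k, y). subtopology (powertop_real UNIV) (standard_simplex k))
       {(k, y). y \<in> simplices Y k}"

definition simplicial_collapse :: "nat \<Rightarrow> (nat \<Rightarrow> real) \<Rightarrow> nat \<Rightarrow> real" where
  "simplicial_collapse i t =
     (\<lambda>j. if j < i then t j else if j = i then t i + t (Suc i) else t (Suc j))"

text \<open>\<open>simplical_face i\<close> (library spelling) is the \<open>i\<close>-th coface map of standard simplices and
  \<open>simplicial_collapse i\<close> the \<open>i\<close>-th codegeneracy.\<close>

inductive glue :: "'a sset \<Rightarrow> 'a splx_point \<Rightarrow> 'a splx_point \<Rightarrow> bool" for Y where
  glue_face: "\<lbrakk>y \<in> simplices Y (Suc k); i \<le> Suc k; t \<in> standard_simplex k\<rbrakk> \<Longrightarrow>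
    glue Y ((k, face_map Y (Suc k) i y), t) ((Suc k, y), simplical_face i t)"
| glue_degen: "\<lbrakk>y \<in> simplices Y k; i \<le> k; t \<in> standard_simplex (Suc k)\<rbrakk> \<Longrightarrow>
    glue Y ((Suc k, degen_map Y k i y), t) ((k, y), simplicial_collapse i t)"

definition glue_class :: "'a sset \<Rightarrow> 'a splx_point \<Rightarrow> 'a splx_point set" where
  "glue_class Y p = {q. equivclp (glue Y) p q}"

definition realization :: "'a sset \<Rightarrow> 'a splx_point set topology" where
  "realization Y = quotient_topology (simplex_coproduct Y) (glue_class Y)"

definition realization_vertex :: "'a sset \<Rightarrow> 'a \<Rightarrow> 'a splx_point set" where
  "realization_vertex Y y = glue_class Y ((0, y), (\<lambda>j. if j = 0 then 1 else 0))"

text \<open>The map \<open>|Z| \<rightarrow> |Y|\<close> induced by the inclusion of a simplicial subset \<open>Z\<close> of \<open>Y\<close>, sending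
  \<open>[p]\<^sub>Z\<close> to \<open>[p]\<^sub>Y\<close>. It depends only on the target \<open>Y\<close>.\<close>

definition realization_incl :: "'a sset \<Rightarrow> 'a splx_point set \<Rightarrow> 'a splx_point set" where
  "realization_incl Y c = (\<Union>p\<in>c. glue_class Y p)"


subsection \<open>Homotopy groups\<close>

text \<open>\<open>\<pi>\<^sub>k(X, x)\<close> consists of the classes of maps \<open>(I\<^sup>k, \<partial>I\<^sup>k) \<rightarrow> (X, x)\<close> up to homotopy relative to
  \<open>\<partial>I\<^sup>k\<close>. Only its underlying pointed set is needed: the neutral element (for \<open>k = 0\<close>, the base
  point) is the class of the constant map. Since \<open>\<partial>I\<^sup>0\<close> is empty, \<open>\<pi>\<^sub>0\<close> is the set of path
  components.\<close>

definition cube :: "nat \<Rightarrow> (nat \<Rightarrow> real) topology" where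
  "cube k = product_topology (\<lambda>_. top_of_set {0..1}) {..<k}"

definition cube_boundary :: "nat \<Rightarrow> (nat \<Rightarrow> real) set" where
  "cube_boundary k = {t \<in> topspace (cube k). \<exists>i<k. t i = 0 \<or> t i = 1}"

definition homotopy_class ::
    "nat \<Rightarrow> 'b topology \<Rightarrow> 'b \<Rightarrow> ((nat \<Rightarrow> real) \<Rightarrow> 'b) \<Rightarrow> ((nat \<Rightarrow> real) \<Rightarrow> 'b) set" where
  "homotopy_class k X x f =
     {g. homotopic_with (\<lambda>h. \<forall>t\<in>cube_boundary k. h t = x) (cube k) X f g}"

definition homotopy_group ::
    "nat \<Rightarrow> 'b topology \<Rightarrow> 'b \<Rightarrow> ((nat \<Rightarrow> real) \<Rightarrow> 'b) set set" where
  "homotopy_group k X x =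
     homotopy_class k X x ` {f. continuous_map (cube k) X f \<and> (\<forall>t\<in>cube_boundary k. f t = x)}"

definition homotopy_one :: "nat \<Rightarrow> 'b topology \<Rightarrow> 'b \<Rightarrow> ((nat \<Rightarrow> real) \<Rightarrow> 'b) set" where
  "homotopy_one k X x = homotopy_class k X x (\<lambda>_. x)"

text \<open>The map \<open>\<pi>\<^sub>k(X, x) \<rightarrow> \<pi>\<^sub>k(X', f x)\<close> induced by \<open>f\<close>, where \<open>X'\<close> and \<open>x' = f x\<close> are passed
  explicitly; the classes of \<open>f \<circ> g\<close> for \<open>g\<close> in a given class all agree.\<close>

definition homotopy_induced ::
    "nat \<Rightarrow> 'c topology \<Rightarrow> 'c \<Rightarrow> ('b \<Rightarrow> 'c) \<Rightarrow> ((nat \<Rightarrow> real) \<Rightarrow> 'b) set \<Rightarrow> ((nat \<Rightarrow> real) \<Rightarrow> 'c) set" where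
  "homotopy_induced k X' x' f c = (\<Union>g\<in>c. homotopy_class k X' x' (f \<circ> g))"

definition homotopy_incl_trivial :: "nat \<Rightarrow> 'a sset \<Rightarrow> 'a sset \<Rightarrow> 'a \<Rightarrow> bool" where
  "homotopy_incl_trivial k Z Y y \<longleftrightarrow>
     (\<forall>c\<in>homotopy_group k (realization Z) (realization_vertex Z y).
        homotopy_induced k (realization Y) (realization_vertex Y y) (realization_incl Y) c =
        homotopy_one k (realization Y) (realization_vertex Y y))"


subsection \<open>Reduced homology\<close>

text \<open>\<open>k\<close>-chains with coefficients in \<open>R\<close> are finitely supported functions \<open>Y\<^sub>k \<rightarrow> R\<close>, extended by
  zero. Homology is that of the chain complex \<open>R[Y\<^sub>k]\<close> with boundary the alternating sum of the
  faces, augmented by \<open>R[Y\<^sub>0] \<rightarrow> R\<close>.\<close>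

definition chain_mon :: "('r, 'm) ring_scheme \<Rightarrow> 'a sset \<Rightarrow> nat \<Rightarrow> ('a \<Rightarrow> 'r) monoid" where
  "chain_mon R Y k =
     \<lparr>carrier = {c. (\<forall>y. c y \<in> carrier R) \<and> finite {y. c y \<noteq> \<zero>\<^bsub>R\<^esub>} \<and>
                    {y. c y \<noteq> \<zero>\<^bsub>R\<^esub>} \<subseteq> simplices Y k},
      mult = (\<lambda>c d y. c y \<oplus>\<^bsub>R\<^esub> d y),
      one = (\<lambda>_. \<zero>\<^bsub>R\<^esub>)\<rparr>"

definition bdry :: "('r, 'm) ring_scheme \<Rightarrow> 'a sset \<Rightarrow> nat \<Rightarrow> ('a \<Rightarrow> 'r) \<Rightarrow> 'a \<Rightarrow> 'r" where
  "bdry R Y k c z =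
     (\<Oplus>\<^bsub>R\<^esub>y\<in>{y. c y \<noteq> \<zero>\<^bsub>R\<^esub>}. \<Oplus>\<^bsub>R\<^esub>i\<in>{..k}.
        if face_map Y k i y = z then (\<ominus>\<^bsub>R\<^esub> \<one>\<^bsub>R\<^esub>) [^]\<^bsub>R\<^esub> i \<otimes>\<^bsub>R\<^esub> c y else \<zero>\<^bsub>R\<^esub>)"

definition augmentation :: "('r, 'm) ring_scheme \<Rightarrow> ('a \<Rightarrow> 'r) \<Rightarrow> 'r" where
  "augmentation R c = (\<Oplus>\<^bsub>R\<^esub>y\<in>{y. c y \<noteq> \<zero>\<^bsub>R\<^esub>}. c y)"

definition reduced_cycles :: "('r, 'm) ring_scheme \<Rightarrow> 'a sset \<Rightarrow> nat \<Rightarrow> ('a \<Rightarrow> 'r) set" where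
  "reduced_cycles R Y k =
     {c \<in> carrier (chain_mon R Y k).
        if k = 0 then augmentation R c = \<zero>\<^bsub>R\<^esub> else bdry R Y k c = (\<lambda>_. \<zero>\<^bsub>R\<^esub>)}"

definition boundaries :: "('r, 'm) ring_scheme \<Rightarrow> 'a sset \<Rightarrow> nat \<Rightarrow> ('a \<Rightarrow> 'r) set" where
  "boundaries R Y k = bdry R Y (Suc k) ` carrier (chain_mon R Y (Suc k))"

definition reduced_homology :: "('r, 'm) ring_scheme \<Rightarrow> nat \<Rightarrow> 'a sset \<Rightarrow> ('a \<Rightarrow> 'r) set monoid" where
  "reduced_homology R k Y =
     (chain_mon R Y k)\<lparr>carrier := reduced_cycles R Y k\<rparr> Mod boundaries R Y k"

text \<open>The map induced by the inclusion of a simplicial subset of \<open>Y\<close>: it sends the coset of a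
  cycle \<open>z\<close> to the coset of \<open>z\<close> modulo the boundaries of \<open>Y\<close>.\<close>

definition homology_incl ::
    "('r, 'm) ring_scheme \<Rightarrow> nat \<Rightarrow> 'a sset \<Rightarrow> ('a \<Rightarrow> 'r) set \<Rightarrow> ('a \<Rightarrow> 'r) set" where
  "homology_incl R k Y c = boundaries R Y k <#>\<^bsub>chain_mon R Y k\<^esub> c"

definition homology_incl_trivial ::
    "('r, 'm) ring_scheme \<Rightarrow> nat \<Rightarrow> 'a sset \<Rightarrow> 'a sset \<Rightarrow> bool" where
  "homology_incl_trivial R k Z Y \<longleftrightarrow>
     trivial_homomorphism (reduced_homology R k Z) (reduced_homology R k Y) (homology_incl R k Y)"


section \<open>Filtrations and essential connectivity\<close>

definition filtration :: "'a sset \<Rightarrow> 'i::order set \<Rightarrow> ('i \<Rightarrow> nat \<Rightarrow> 'a set) \<Rightarrow> bool" where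
  "filtration Y A F \<longleftrightarrow> simplicial_set Y \<and> connected_sset Y \<and>
     A \<noteq> {} \<and> (\<forall>\<alpha>\<in>A. \<forall>\<beta>\<in>A. \<exists>\<gamma>\<in>A. \<alpha> \<le> \<gamma> \<and> \<beta> \<le> \<gamma>) \<and>
     (\<forall>\<alpha>\<in>A. simplicial_subset (F \<alpha>) Y) \<and>
     (\<forall>\<alpha>\<in>A. \<forall>\<beta>\<in>A. \<alpha> \<le> \<beta> \<longrightarrow> (\<forall>k. F \<alpha> k \<subseteq> F \<beta> k)) \<and>
     (\<forall>k. (\<Union>\<alpha>\<in>A. F \<alpha> k) = simplices Y k)"

text \<open>The connectivity bound is an integer because \<open>-1\<close> is allowed.\<close>

definition essentially_connected ::
    "int \<Rightarrow> 'a sset \<Rightarrow> 'i::order set \<Rightarrow> ('i \<Rightarrow> nat \<Rightarrow> 'a set) \<Rightarrow> bool" where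
  "essentially_connected m Y A F \<longleftrightarrow>
     (\<exists>y\<in>simplices Y 0. \<forall>k. int k \<le> m \<longrightarrow>
        (\<forall>\<alpha>\<in>A. y \<in> F \<alpha> 0 \<longrightarrow>
           (\<exists>\<beta>\<in>A. \<alpha> \<le> \<beta> \<and>
              homotopy_incl_trivial k (restrict_sset Y (F \<alpha>)) (restrict_sset Y (F \<beta>)) y)))"

definition essentially_acyclic ::
    "('r, 'm) ring_scheme \<Rightarrow> int \<Rightarrow> 'a sset \<Rightarrow> 'i::order set \<Rightarrow> ('i \<Rightarrow> nat \<Rightarrow> 'a set) \<Rightarrow> bool" where
  "essentially_acyclic R m Y A F \<longleftrightarrow>
     (\<forall>k. int k \<le> m \<longrightarrow>
        (\<forall>\<alpha>\<in>A. \<exists>\<beta>\<in>A. \<alpha> \<le> \<beta> \<and>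
           homology_incl_trivial R k (restrict_sset Y (F \<alpha>)) (restrict_sset Y (F \<beta>))))"


section \<open>Sigma-sets\<close>

definition compact_subsets :: "'a topology \<Rightarrow> 'a set set" where
  "compact_subsets X = {C. compactin X C}"

definition char_filtration ::
    "'a top_group \<Rightarrow> ('a \<Rightarrow> real) \<Rightarrow> 'a set \<Rightarrow> nat \<Rightarrow> 'a list set" where
  "char_filtration G \<xi> C k =
     (\<Union>g\<in>{g \<in> carrier G. 0 \<le> \<xi> g}. map (\<lambda>x. g \<otimes>\<^bsub>G\<^esub> x) ` simplices (E_sset C) k)"

definition Sigma_top :: "nat \<Rightarrow> 'a top_group \<Rightarrow> ('a \<Rightarrow> real) set" where
  "Sigma_top n G =
     {\<xi> \<in> characters G. essentially_connected (int n - 1) (E_sset (carrier G))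
        (compact_subsets (opens G)) (char_filtration G \<xi>)}"

definition Sigma_top_hom ::
    "nat \<Rightarrow> 'a top_group \<Rightarrow> ('r, 'm) ring_scheme \<Rightarrow> ('a \<Rightarrow> real) set" where
  "Sigma_top_hom n G R =
     {\<xi> \<in> characters G. essentially_acyclic R (int n - 1) (E_sset (carrier G))
        (compact_subsets (opens G)) (char_filtration G \<xi>)}"

lemma simplicial_set_E_sset: "simplicial_set (E_sset X)"
proof
  fix y k i assume "y \<in> simplices (E_sset X) (Suc k)" "i \<le> Suc k"
  then show "face_map (E_sset X) (Suc k) i y \<in> simplices (E_sset X) k"
    by (auto simp: E_sset_def dest: in_set_takeD in_set_dropD)
next
  fix y k i assume "y \<in> simplices (E_sset X) k" "i \<le> k"
  then show "degen_map (E_sset X) k i y \<in> simplices (E_sset X) (Suc k)"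
    by (auto simp: E_sset_def dest: in_set_takeD in_set_dropD)
next
  define del dup :: "nat \<Rightarrow> 'a list \<Rightarrow> 'a list"
    where "del = (\<lambda>i xs. take i xs @ drop (Suc i) xs)"
      and "dup = (\<lambda>i xs. take (Suc i) xs @ drop i xs)"
  have maps: "face_map (E_sset X) k = del" "degen_map (E_sset X) k = dup" for k
    by (simp_all add: E_sset_def del_def dup_def)
  have length: "length (del i xs) = length xs - 1" "length (dup i xs) = Suc (length xs)"
    if "i < length xs" for i xs
    using that by (auto simp: del_def dup_def)
  have nth_del: "del i xs ! m = (if m < i then xs ! m else xs ! Suc m)"
    if "i < length xs" "m < length xs - 1" for i m xs
    using that by (auto simp: del_def nth_append min_def)
  have nth_dup: "dup i xs ! m = (if m \<le> i then xs ! m else xs ! (m - 1))"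
    if "i < length xs" "m < Suc (length xs)" for i m xs
    using that by (auto simp: dup_def nth_append min_def intro!: arg_cong[where f="(!) xs"])
  {
    fix y k i j assume "y \<in> simplices (E_sset X) (Suc (Suc k))" "i < j" "j \<le> Suc (Suc k)"
    then have "length y = Suc (Suc (Suc k))" "i < j" "j \<le> Suc (Suc k)"
      by (auto simp: E_sset_def)
    then show "face_map (E_sset X) (Suc k) i (face_map (E_sset X) (Suc (Suc k)) j y) =
         face_map (E_sset X) (Suc k) (j - 1) (face_map (E_sset X) (Suc (Suc k)) i y)"
      unfolding maps
      by (intro nth_equalityI) (auto simp: length nth_del nth_dup)
  next
    fix y k i j assume "y \<in> simplices (E_sset X) k" "i \<le> j" "j \<le> k"
    then have "length y = Suc k" "i \<le> j" "j \<le> k"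
      by (auto simp: E_sset_def)
    then show "degen_map (E_sset X) (Suc k) i (degen_map (E_sset X) k j y) =
         degen_map (E_sset X) (Suc k) (Suc j) (degen_map (E_sset X) k i y)"
      unfolding maps
      by (intro nth_equalityI) (auto simp: length nth_del nth_dup)
  next
    fix y k i j assume "y \<in> simplices (E_sset X) k" "i < j" "j \<le> k"
    then have "length y = Suc k" "i < j" "j \<le> k"
      by (auto simp: E_sset_def)
    then show "face_map (E_sset X) (Suc k) i (degen_map (E_sset X) k j y) =
         degen_map (E_sset X) (k - 1) (j - 1) (face_map (E_sset X) k i y)"
      unfolding maps
      by (intro nth_equalityI) (auto simp: length nth_del nth_dup)
  next
    fix y k i j assume "y \<in> simplices (E_sset X) k" "i = j \<or> i = Suc j" "j \<le> k"
    then have "length y = Suc k" "i = j \<or> i = Suc j" "j \<le> k"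
      by (auto simp: E_sset_def)
    then show "face_map (E_sset X) (Suc k) i (degen_map (E_sset X) k j y) = y"
      unfolding maps
      by (intro nth_equalityI) (auto simp: length nth_del nth_dup)
  next
    fix y k i j assume "y \<in> simplices (E_sset X) k" "Suc j < i" "i \<le> Suc k"
    then have "length y = Suc k" "Suc j < i" "i \<le> Suc k"
      by (auto simp: E_sset_def)
    then show "face_map (E_sset X) (Suc k) i (degen_map (E_sset X) k j y) =
         degen_map (E_sset X) (k - 1) j (face_map (E_sset X) k (i - 1) y)"
      unfolding maps
      by (intro nth_equalityI) (auto simp: length nth_del nth_dup)
  }
qed

lemma connected_E_sset:
  assumes "X \<noteq> {}"
  shows "connected_sset (E_sset X)"
  unfolding connected_sset_def
proof (intro conjI ballI)
  obtain x where "x \<in> X" using assms by blast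
  then have "[x] \<in> simplices (E_sset X) 0" by (simp add: E_sset_def)
  then show "simplices (E_sset X) 0 \<noteq> {}" by blast
next
  fix x y assume "x \<in> simplices (E_sset X) 0" "y \<in> simplices (E_sset X) 0"
  then obtain a b where ab: "x = [a]" "y = [b]" "a \<in> X" "b \<in> X"
    by (auto simp: E_sset_def length_Suc_conv)
  have "[a, b] \<in> simplices (E_sset X) 1 \<and> x = face_map (E_sset X) 1 1 [a, b] \<and>
      y = face_map (E_sset X) 1 0 [a, b]"
    using ab by (simp add: E_sset_def)
  then show "equivclp (\<lambda>u v. \<exists>e\<in>simplices (E_sset X) 1.
      u = face_map (E_sset X) 1 1 e \<and> v = face_map (E_sset X) 1 0 e) x y"
    by (intro r_into_equivclp) blast
qed

lemma (in topological_group) filtration_char_filtration: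
  assumes \<xi>: "\<xi> \<in> characters G"
  shows "filtration (E_sset (carrier G)) (compact_subsets (opens G)) (char_filtration G \<xi>)"
proof -
  have subset: "char_filtration G \<xi> C k \<subseteq> simplices (E_sset (carrier G)) k"
    if "C \<in> compact_subsets (opens G)" for C k
  proof -
    have "C \<subseteq> carrier G"
      using that compactin_subset_topspace unfolding compact_subsets_def topspace_opens[symmetric]
      by blast
    then show ?thesis
      unfolding char_filtration_def E_sset_def by (auto simp: subset_iff)
  qed
  show ?thesis
    unfolding filtration_def
  proof (intro conjI ballI allI impI)
    show "simplicial_set (E_sset (carrier G))"
      by (rule simplicial_set_E_sset)
    show "connected_sset (E_sset (carrier G))"
      by (rule connected_E_sset) blast
    show "compact_subsets (opens G) \<noteq> {}"
      by (auto simp: compact_subsets_def intro: finite_imp_compactin)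
  next
    fix A B assume "A \<in> compact_subsets (opens G)" "B \<in> compact_subsets (opens G)"
    then have "A \<union> B \<in> compact_subsets (opens G)"
      by (simp add: compact_subsets_def compactin_Un)
    then show "\<exists>C\<in>compact_subsets (opens G). A \<subseteq> C \<and> B \<subseteq> C"
      by blast
  next
    fix C assume C: "C \<in> compact_subsets (opens G)"
    interpret EC: simplicial_set "E_sset C" by (rule simplicial_set_E_sset)
    have face: "face_map (E_sset X) k i (map f xs) = map f (face_map (E_sset X') k i xs)"
      and degen: "degen_map (E_sset X) k i (map f xs) = map f (degen_map (E_sset X') k i xs)"
      for X :: "'a set" and X' :: "'a set" and k i f xs
      by (simp_all add: E_sset_def take_map drop_map)
    show "simplicial_subset (char_filtration G \<xi> C) (E_sset (carrier G))"
      unfolding simplicial_subset_def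
    proof (intro conjI allI ballI impI)
      fix k show "char_filtration G \<xi> C k \<subseteq> simplices (E_sset (carrier G)) k"
        using C by (rule subset)
    next
      fix k y i assume "y \<in> char_filtration G \<xi> C (Suc k)" "i \<le> Suc k"
      then obtain g xs where "g \<in> {g \<in> carrier G. 0 \<le> \<xi> g}" and y: "y = map ((\<otimes>) g) xs"
        and "xs \<in> simplices (E_sset C) (Suc k)" "i \<le> Suc k"
        unfolding char_filtration_def by blast
      moreover from this have "face_map (E_sset C) (Suc k) i xs \<in> simplices (E_sset C) (k)"
        by (intro EC.face_closed)
      ultimately show "face_map (E_sset (carrier G)) (Suc k) i y \<in> char_filtration G \<xi> C k"
        unfolding char_filtration_def y face[where X'=C] by blast
    next
      fix k y i assume "y \<in> char_filtration G \<xi> C k" "i \<le> k"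
      then obtain g xs where "g \<in> {g \<in> carrier G. 0 \<le> \<xi> g}" and y: "y = map ((\<otimes>) g) xs"
        and "xs \<in> simplices (E_sset C) (k)" "i \<le> k"
        unfolding char_filtration_def by blast
      moreover from this have "degen_map (E_sset C) (k) i xs \<in> simplices (E_sset C) (Suc k)"
        by (intro EC.degen_closed)
      ultimately show "degen_map (E_sset (carrier G)) k i y \<in> char_filtration G \<xi> C (Suc k)"
        unfolding char_filtration_def y degen[where X'=C] by blast
    qed
  next
    fix A B :: "'a set" and k assume "A \<subseteq> B"
    then have "simplices (E_sset A) k \<subseteq> simplices (E_sset B) k"
      by (auto simp: E_sset_def)
    then show "char_filtration G \<xi> A k \<subseteq> char_filtration G \<xi> B k"
      unfolding char_filtration_def by blast
  next
    fix k
    show "(\<Union>C\<in>compact_subsets (opens G). char_filtration G \<xi> C k) = simplices (E_sset (carrier G)) k"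
    proof
      show "(\<Union>C\<in>compact_subsets (opens G). char_filtration G \<xi> C k) \<subseteq> simplices (E_sset (carrier G)) k"
        using subset by blast
      show "simplices (E_sset (carrier G)) k \<subseteq> (\<Union>C\<in>compact_subsets (opens G). char_filtration G \<xi> C k)"
      proof
        fix xs assume xs: "xs \<in> simplices (E_sset (carrier G)) k"
        then have sub: "set xs \<subseteq> carrier G" and len: "length xs = Suc k"
          by (auto simp: E_sset_def)
        have "\<xi> (\<one> \<otimes> \<one>) = \<xi> \<one> + \<xi> \<one>"
          using \<xi> unfolding characters_def by blast
        then have one: "\<one> \<in> {g \<in> carrier G. 0 \<le> \<xi> g}" by simp
        have "map (\<lambda>x. \<one> \<otimes> x) xs = xs"
          using sub by (intro map_idI) auto
        moreover have "xs \<in> simplices (E_sset (set xs)) k"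
          using len by (simp add: E_sset_def)
        ultimately have "xs \<in> map (\<lambda>x. \<one> \<otimes> x) ` simplices (E_sset (set xs)) k"
          by (metis image_eqI)
        with one have "xs \<in> char_filtration G \<xi> (set xs) k"
          unfolding char_filtration_def by (rule UN_I)
        moreover have "set xs \<in> compact_subsets (opens G)"
          using sub topspace_opens by (simp add: compact_subsets_def finite_imp_compactin)
        ultimately show "xs \<in> (\<Union>C\<in>compact_subsets (opens G). char_filtration G \<xi> C k)"
          by (rule UN_I[rotated])
      qed
    qed
  qed
qed

end

theory Submission
  imports Defs
begin

text \<open>The map \<open>f : G \<rightarrow> \<G>\<close> is given by the action of \<open>G\<close> on \<open>G/L = \<Gamma>/\<Lambda>\<close>; it is a surjective quotient
  homomorphism under which preimages of compact sets are compact. A character of \<open>G\<close> vanishes on the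
  compact kernel of \<open>f\<close>, hence factors through \<open>\<G>\<close>.

  For the \<open>\<Sigma>\<close>-sets, choose a set-theoretic section \<open>s\<close> of \<open>f\<close>. Although \<open>s\<close> is not a homomorphism, it maps
  a translate \<open>hD\<close> into \<open>s(h)f\<^sup>-\<^sup>1(D)\<close>, so \<open>f\<close> and \<open>s\<close> induce maps between members of the two
  filtrations in both directions. Both \<open>f \<circ> s\<close> and \<open>s \<circ> f\<close> are contiguous to the
  identity: a tuple of \<open>G\<^sub>\<chi> \<cdot> EC\<close> together with its image under \<open>s \<circ> f\<close> lies in a single translate of
  \<open>f\<^sup>-\<^sup>1(f(C))\<close>. Contiguous maps are homotopic, by the straight-line homotopy on realizations and by the
  prism operator on chains; the choice of \<open>s\<close> makes the base point fixed.\<close>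

section \<open>Simplicial sets of lists and their realizations\<close>

text \<open>A merely set-theoretic section is usable because membership of a tuple in a filtration
  member depends only on its set of entries: they must lie in one translate \<open>gC\<close> by an
  element with nonnegative character value. Each member of either filtration is therefore
  \<open>list_sset K\<close> for a family K of vertex sets closed under subsets, and being
  simplicial or contiguous becomes a condition on vertex maps alone. No equivariance of the section
  is asked for, as a translate only has to land in some admissible translate. The sign condition
  passes through f and s because characters of G are constant on the fibres of f.

  A realization has no ambient linear space, so the straight-line homotopy runs in the simplex of
  dimension 2k+1 spanned by the two images of a k-simplex. On chains, the prism identity is proved
  over the integers and then carried to arbitrary coefficients.

  That f is a quotient map rests on properness: the elements of G moving one given point of G/L to
  another form a compact open set, so f pulls compact sets back to compact sets, and proper maps
  into locally compact Hausdorff spaces are closed.\<close>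

definition list_sset :: "'x set set \<Rightarrow> 'x list sset" where
  "list_sset K = (E_sset UNIV)\<lparr>simplices := \<lambda>k. {xs. length xs = Suc k \<and> set xs \<in> K}\<rparr>"

text \<open>Closure under subsets is what makes \<open>list_sset K\<close> stable under faces;
  degeneracies leave the vertex set unchanged.\<close>

definition downset :: "'x set set \<Rightarrow> bool" where
  "downset K \<longleftrightarrow> (\<forall>A\<in>K. \<forall>B. B \<subseteq> A \<longrightarrow> B \<in> K)"

lemma downsetD: "downset K \<Longrightarrow> A \<in> K \<Longrightarrow> B \<subseteq> A \<Longrightarrow> B \<in> K"
  by (auto simp: downset_def)

lemma simplices_list_sset [simp]:
  "simplices (list_sset K) k = {xs. length xs = Suc k \<and> set xs \<in> K}"
  by (simp add: list_sset_def)

lemma face_list_sset [simp]: "face_map (list_sset K) k i xs = take i xs @ drop (Suc i) xs"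
  by (simp add: list_sset_def E_sset_def)

lemma degen_list_sset [simp]: "degen_map (list_sset K) k i xs = take (Suc i) xs @ drop i xs"
  by (simp add: list_sset_def E_sset_def)

text \<open>A point of \<open>\<Coprod>\<^sub>k Y\<^sub>k \<times> \<Delta>\<^sup>k\<close> is also described by the list of its vertices paired with their
  barycentric coordinates. In this description the face relations delete an entry of weight zero,
  and the degeneracy relations merge two equal neighbours, adding up their weights.\<close>

definition to_point :: "('x \<times> real) list \<Rightarrow> 'x list splx_point" where
  "to_point ps = ((length ps - 1, map fst ps), \<lambda>j. if j < length ps then snd (ps ! j) else 0)"

definition of_point :: "'x list splx_point \<Rightarrow> ('x \<times> real) list" where
  "of_point p = zip (snd (fst p)) (map (snd p) [0..<Suc (fst (fst p))])"

text \<open>These lists correspond to the points of \<open>simplex_coproduct (list_sset K)\<close>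
  under \<open>to_point\<close> and \<open>of_point\<close>. Total weight 1 already excludes the
  empty list and bounds every single weight by 1.\<close>

definition weighted_lists :: "'x set set \<Rightarrow> ('x \<times> real) list set" where
  "weighted_lists K = {ps. fst ` set ps \<in> K \<and> (\<forall>p\<in>set ps. 0 \<le> snd p) \<and> sum_list (map snd ps) = 1}"

definition bary :: "'x set set \<Rightarrow> ('x \<times> real) list \<Rightarrow> 'x list splx_point set" where
  "bary K ps = glue_class (list_sset K) (to_point ps)"

section \<open>Points of the coproduct of simplices as weighted lists\<close>

lemma topspace_simplex_coproduct:
  "topspace (simplex_coproduct Y) = {((k, y), t). y \<in> simplices Y k \<and> t \<in> standard_simplex k}"
  unfolding simplex_coproduct_def by (auto simp: topspace_sum_topology)

lemma of_point_to_point: "ps \<noteq> [] \<Longrightarrow> of_point (to_point ps) = ps"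
  by (rule nth_equalityI) (auto simp: of_point_def to_point_def simp del: upt_Suc)

lemma weighted_lists_nonempty: "ps \<in> weighted_lists K \<Longrightarrow> ps \<noteq> []"
  by (auto simp: weighted_lists_def)

lemma to_point_of_point:
  assumes "p \<in> topspace (simplex_coproduct (list_sset K))"
  shows "to_point (of_point p) = p"
proof -
  obtain k xs t where p: "p = ((k, xs), t)" by (metis prod.collapse)
  with assms have len: "length xs = Suc k" and t: "\<And>j. j > k \<Longrightarrow> t j = 0"
    by (auto simp: topspace_simplex_coproduct standard_simplex_def)
  have "(\<lambda>j. if j < Suc k then snd (zip xs (map t [0..<Suc k]) ! j) else 0) = t"
    using len t by (auto simp: fun_eq_iff simp del: upt_Suc)
  with len show ?thesis by (simp add: p to_point_def of_point_def del: upt_Suc)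
qed

lemma of_point_weighted_lists:
  assumes "p \<in> topspace (simplex_coproduct (list_sset K))"
  shows "of_point p \<in> weighted_lists K"
proof -
  obtain k xs t where p: "p = ((k, xs), t)" by (metis prod.collapse)
  with assms have len: "length xs = Suc k" and K: "set xs \<in> K" and t: "t \<in> standard_simplex k"
    by (auto simp: topspace_simplex_coproduct)
  have fst: "map fst (of_point p) = xs" and snd: "map snd (of_point p) = map t [0..<Suc k]"
    using len by (simp_all add: p of_point_def del: upt_Suc)
  have "sum_list (map t [0..<Suc k]) = (\<Sum>i\<le>k. t i)"
    by (metis atLeast0LessThan lessThan_Suc_atMost set_upt sum_list_distinct_conv_sum_set distinct_upt)
  moreover have "0 \<le> snd q" if "q \<in> set (of_point p)" for q
  proof -
    from that have "snd q \<in> set (map snd (of_point p))" by simp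
    then show ?thesis using t unfolding snd by (auto simp: standard_simplex_def)
  qed
  moreover have "fst ` set (of_point p) = set xs"
    by (metis fst set_map)
  ultimately show ?thesis
    using t K unfolding weighted_lists_def by (simp add: snd standard_simplex_def del: upt_Suc)
qed

lemma to_point_topspace:
  assumes ps: "ps \<in> weighted_lists K"
  shows "to_point ps \<in> topspace (simplex_coproduct (list_sset K))"
proof -
  have ne: "ps \<noteq> []" using ps by (rule weighted_lists_nonempty)
  define t where "t = snd (to_point ps)"
  have t_eq: "t = (\<lambda>j. if j < length ps then snd (ps ! j) else 0)"
    by (simp add: t_def to_point_def)
  have nonneg: "0 \<le> t j" for j
    using ps by (auto simp: t_eq weighted_lists_def)
  have "{..length ps - 1} = {..<length ps}"
    using ne by (cases ps) (auto simp: lessThan_Suc_atMost)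
  then have "(\<Sum>i\<le>length ps - 1. t i) = (\<Sum>i<length ps. snd (ps ! i))"
    by (simp add: t_eq)
  also have "\<dots> = 1"
    using ps unfolding weighted_lists_def by (auto simp: sum_list_sum_nth atLeast0LessThan)
  finally have sum: "(\<Sum>i\<le>length ps - 1. t i) = 1" .
  have "t j \<le> 1" for j
  proof (cases "j \<le> length ps - 1")
    case True
    then have "t j \<le> (\<Sum>i\<le>length ps - 1. t i)"
      using nonneg by (intro member_le_sum) auto
    then show ?thesis using sum by simp
  next
    case False
    then have "\<not> j < length ps" by linarith
    then show ?thesis by (simp add: t_eq)
  qed
  moreover have "t j = 0" if "j > length ps - 1" for j
    using that by (simp add: t_eq)
  ultimately have "t \<in> standard_simplex (length ps - 1)"
    using nonneg sum by (auto simp: standard_simplex_def)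
  then show ?thesis
    using ps ne by (simp add: topspace_simplex_coproduct to_point_def t_eq weighted_lists_def)
qed

lemma topspace_realization: "topspace (realization (list_sset K)) = bary K ` weighted_lists K"
proof -
  have "topspace (simplex_coproduct (list_sset K)) = to_point ` weighted_lists K"
  proof
    show "topspace (simplex_coproduct (list_sset K)) \<subseteq> to_point ` weighted_lists K"
    proof
      fix p :: "'a list splx_point" assume p: "p \<in> topspace (simplex_coproduct (list_sset K))"
      show "p \<in> to_point ` weighted_lists K"
        using to_point_of_point[OF p] of_point_weighted_lists[OF p] by (rule image_eqI[OF sym])
    qed
  qed (blast intro: to_point_topspace)
  then show ?thesis
    by (simp add: realization_def bary_def image_image)
qed

section \<open>The gluing relations as moves on weighted lists, and maps out of the
  realization\<close>

lemma glue_class_eqI: "equivclp (glue Y) p q \<Longrightarrow> glue_class Y p = glue_class Y q"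
proof -
  assume pq: "equivclp (glue Y) p q"
  have "equivclp (glue Y) p r \<longleftrightarrow> equivclp (glue Y) q r" for r
  proof
    assume "equivclp (glue Y) p r"
    with equivclp_sym[OF pq] show "equivclp (glue Y) q r" by (rule equivclp_trans)
  next
    assume "equivclp (glue Y) q r"
    with pq show "equivclp (glue Y) p r" by (rule equivclp_trans)
  qed
  then show ?thesis by (auto simp: glue_class_def)
qed

lemma weighted_lists_append_zero:
  assumes "downset K" "ps @ (x, 0) # qs \<in> weighted_lists K"
  shows "ps @ qs \<in> weighted_lists K"
  using assms unfolding weighted_lists_def
  by (auto elim!: downsetD)

lemma weighted_lists_merge:
  assumes "ps @ (x, a) # (x, b) # qs \<in> weighted_lists K"
  shows "ps @ (x, a + b) # qs \<in> weighted_lists K"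
  using assms unfolding weighted_lists_def by auto

text \<open>This is \<open>glue_face\<close> at index \<open>length ps\<close>:
  \<open>simplical_face\<close> inserts the coordinate 0 at exactly that position.\<close>

lemma bary_zero:
  assumes K: "downset K" and w: "ps @ (x, 0) # qs \<in> weighted_lists K"
  shows "bary K (ps @ (x, 0) # qs) = bary K (ps @ qs)"
proof -
  have w': "ps @ qs \<in> weighted_lists K" using assms by (rule weighted_lists_append_zero)
  then have ne: "ps @ qs \<noteq> []" by (rule weighted_lists_nonempty)
  define k where "k = length (ps @ qs) - 1"
  let ?y = "map fst (ps @ (x, 0) # qs)" and ?t = "snd (to_point (ps @ qs))"
  have len: "length (ps @ qs) = Suc k" using ne by (cases "ps @ qs") (auto simp: k_def)
  have t: "?t \<in> standard_simplex k"
    using to_point_topspace[OF w'] len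
    by (simp add: topspace_simplex_coproduct to_point_def)
  have y: "?y \<in> simplices (list_sset K) (Suc k)"
    using w len by (auto simp: weighted_lists_def image_Un)
  have "length ps \<le> Suc k" using len by simp
  from glue_face[OF y this t]
  have "glue (list_sset K) ((k, map fst (ps @ qs)), ?t) ((Suc k, ?y), simplical_face (length ps) ?t)"
    by simp
  moreover have "((k, map fst (ps @ qs)), ?t) = to_point (ps @ qs)"
    using len by (simp add: to_point_def)
  moreover have "((Suc k, ?y), simplical_face (length ps) ?t) = to_point (ps @ (x, 0) # qs)"
    using len by (auto simp: to_point_def simplical_face_def fun_eq_iff nth_append)
  ultimately show ?thesis
    unfolding bary_def by (metis glue_class_eqI r_into_equivclp)
qed

text \<open>This is \<open>glue_degen\<close> at index \<open>length ps\<close>: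
  \<open>simplicial_collapse\<close> adds the coordinates of the doubled vertex.\<close>

lemma bary_merge:
  assumes w: "ps @ (x, a) # (x, b) # qs \<in> weighted_lists K"
  shows "bary K (ps @ (x, a) # (x, b) # qs) = bary K (ps @ (x, a + b) # qs)"
proof -
  let ?l = "ps @ (x, a) # (x, b) # qs" and ?r = "ps @ (x, a + b) # qs"
  have w': "?r \<in> weighted_lists K" using assms by (rule weighted_lists_merge)
  define k where "k = length ?r - 1"
  let ?y = "map fst ?r" and ?t = "snd (to_point ?l)"
  have len: "length ?r = Suc k" by (simp add: k_def)
  have t: "?t \<in> standard_simplex (Suc k)"
    using to_point_topspace[OF w] len
    by (simp add: topspace_simplex_coproduct to_point_def)
  have y: "?y \<in> simplices (list_sset K) k"
    using w' len by (auto simp: weighted_lists_def image_Un)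
  have "length ps \<le> k" using len by simp
  from glue_degen[OF y this t]
  have "glue (list_sset K) ((Suc k, map fst ?l), ?t) ((k, ?y), simplicial_collapse (length ps) ?t)"
    by simp
  moreover have "((Suc k, map fst ?l), ?t) = to_point ?l"
    using len by (simp add: to_point_def)
  moreover have "((k, ?y), simplicial_collapse (length ps) ?t) = to_point ?r"
    using len by (auto simp: to_point_def simplicial_collapse_def fun_eq_iff nth_append)
  ultimately show ?thesis
    unfolding bary_def by (metis glue_class_eqI r_into_equivclp)
qed

text \<open>Under \<open>of_point\<close> the two constructors of \<open>glue\<close> are exactly
  deletion of a weightless entry and merging of equal neighbours. The conclusion also records that
  both ends are points of the coproduct, so that a chain of gluing steps never leaves it.\<close>

lemma glue_invariant:
  assumes zero: "\<And>ps x qs. ps @ (x, 0) # qs \<in> weighted_lists K \<Longrightarrow> F (ps @ (x, 0) # qs) = F (ps @ qs)"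
    and merge: "\<And>ps x a b qs. ps @ (x, a) # (x, b) # qs \<in> weighted_lists K \<Longrightarrow>
      F (ps @ (x, a) # (x, b) # qs) = F (ps @ (x, a + b) # qs)"
    and K: "downset K" and glue: "glue (list_sset K) p q"
  shows "p \<in> topspace (simplex_coproduct (list_sset K)) \<and>
    q \<in> topspace (simplex_coproduct (list_sset K)) \<and> F (of_point p) = F (of_point q)"
  using glue
proof cases
  case (glue_face y k i t)
  have len: "length y = Suc (Suc k)" and yK: "set y \<in> K" using glue_face by auto
  have sub: "set (take i y @ drop (Suc i) y) \<subseteq> set y"
    by (auto dest: in_set_takeD in_set_dropD)
  have p: "p \<in> topspace (simplex_coproduct (list_sset K))"
    using glue_face len downsetD[OF K yK sub] by (auto simp: topspace_simplex_coproduct)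
  have q: "q \<in> topspace (simplex_coproduct (list_sset K))"
    using glue_face simplical_face_in_standard_simplex[of "Suc k" i t]
    by (auto simp: topspace_simplex_coproduct)
  let ?ps = "zip (take i y) (map t [0..<i])"
  let ?qs = "zip (drop (Suc i) y) (map t [i..<Suc k])"
  have "of_point p = ?ps @ ?qs"
    using glue_face len
    by (intro nth_equalityI) (auto simp: of_point_def nth_append min_def simp del: upt_Suc)
  moreover have q_eq: "of_point q = ?ps @ (y ! i, 0) # ?qs"
    using glue_face len
    by (intro nth_equalityI)
      (auto simp: of_point_def nth_append nth_Cons' min_def simplical_face_def simp del: upt_Suc)
  moreover have "of_point q \<in> weighted_lists K" using q by (rule of_point_weighted_lists)
  ultimately show ?thesis using p q zero by simp
next
  case (glue_degen y k i t)
  have len: "length y = Suc k" and yK: "set y \<in> K" using glue_degen by auto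
  have sub: "set (take (Suc i) y @ drop i y) \<subseteq> set y"
    by (auto dest: in_set_takeD in_set_dropD)
  have p: "p \<in> topspace (simplex_coproduct (list_sset K))"
    using glue_degen len downsetD[OF K yK sub] by (auto simp: topspace_simplex_coproduct)
  let ?ps = "zip (take i y) (map t [0..<i])"
  let ?qs = "zip (drop (Suc i) y) (map t [Suc (Suc i)..<Suc (Suc k)])"
  have p_eq: "of_point p = ?ps @ (y ! i, t i) # (y ! i, t (Suc i)) # ?qs"
    using glue_degen len
    by (intro nth_equalityI)
      (auto simp: of_point_def nth_append nth_Cons' min_def not_less Suc_diff_Suc numeral_2_eq_2
        intro!: arg_cong[where f=t] arg_cong[where f="(!) y"] simp del: upt_Suc)
  moreover have q_eq: "of_point q = ?ps @ (y ! i, t i + t (Suc i)) # ?qs"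
    using glue_degen len
    by (intro nth_equalityI)
      (auto simp: of_point_def nth_append nth_Cons' min_def simplicial_collapse_def simp del: upt_Suc)
  moreover have p_in: "of_point p \<in> weighted_lists K" using p by (rule of_point_weighted_lists)
  \<comment> \<open>Rather than bounding the collapsed coordinates, pass to the list, where merging
    preserves \<open>weighted_lists\<close>, and come back. The way back is exact because the
    collapsed coordinates vanish beyond index k.\<close>
  moreover have "q \<in> topspace (simplex_coproduct (list_sset K))"
  proof -
    have "of_point q \<in> weighted_lists K"
      using p_in unfolding p_eq q_eq by (rule weighted_lists_merge)
    then have "to_point (of_point q) \<in> topspace (simplex_coproduct (list_sset K))"
      by (rule to_point_topspace)
    moreover have "to_point (of_point q) = q"
    proof -
      have "t j = 0" if "j > Suc k" for j using that glue_degen(5) by (auto simp: standard_simplex_def)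
      then have "simplicial_collapse i t j = 0" if "\<not> j < Suc k" for j
        using that glue_degen(4) by (auto simp: simplicial_collapse_def)
      then show ?thesis using len glue_degen(2)
        by (auto simp: to_point_def of_point_def fun_eq_iff simp del: upt_Suc)
    qed
    ultimately show ?thesis by simp
  qed
  ultimately show ?thesis using p merge by simp
qed

lemma equivclp_glue_invariant:
  assumes zero: "\<And>ps x qs. ps @ (x, 0) # qs \<in> weighted_lists K \<Longrightarrow> F (ps @ (x, 0) # qs) = F (ps @ qs)"
    and merge: "\<And>ps x a b qs. ps @ (x, a) # (x, b) # qs \<in> weighted_lists K \<Longrightarrow>
      F (ps @ (x, a) # (x, b) # qs) = F (ps @ (x, a + b) # qs)"
    and K: "downset K" and p: "p \<in> topspace (simplex_coproduct (list_sset K))"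
    and pq: "equivclp (glue (list_sset K)) p q"
  shows "q \<in> topspace (simplex_coproduct (list_sset K)) \<and> F (of_point p) = F (of_point q)"
  using pq
proof (induction rule: equivclp_induct)
  case base
  show ?case using p by simp
next
  case (step y z)
  have inv: "p \<in> topspace (simplex_coproduct (list_sset K)) \<and>
    q \<in> topspace (simplex_coproduct (list_sset K)) \<and> F (of_point p) = F (of_point q)"
    if "glue (list_sset K) p q" for p q
    using zero merge K that by (rule glue_invariant)
  from step show ?case using inv[of y z] inv[of z y] by auto
qed

lemma bary_eq_glue_class:
  assumes "p \<in> topspace (simplex_coproduct (list_sset K))"
  shows "glue_class (list_sset K) p = bary K (of_point p)"
  using assms by (simp add: bary_def to_point_of_point)

text \<open>Functions on the realization are written as unions over all representatives of a class.
  As F is constant on the class, which contains \<open>to_point ps\<close>, the union collapses to a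
  single value.\<close>

lemma Union_glue_class:
  assumes zero: "\<And>ps x qs. ps @ (x, 0) # qs \<in> weighted_lists K \<Longrightarrow> F (ps @ (x, 0) # qs) = F (ps @ qs)"
    and merge: "\<And>ps x a b qs. ps @ (x, a) # (x, b) # qs \<in> weighted_lists K \<Longrightarrow>
      F (ps @ (x, a) # (x, b) # qs) = F (ps @ (x, a + b) # qs)"
    and K: "downset K" and ps: "ps \<in> weighted_lists K"
  shows "(\<Union>p\<in>bary K ps. F (of_point p)) = F ps"
proof -
  have p: "to_point ps \<in> topspace (simplex_coproduct (list_sset K))"
    using ps by (rule to_point_topspace)
  have "F (of_point q) = F ps" if "q \<in> bary K ps" for q
  proof -
    have "equivclp (glue (list_sset K)) (to_point ps) q"
      using that by (simp add: bary_def glue_class_def)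
    from equivclp_glue_invariant[of K F, OF zero merge K p this]
    show ?thesis by (simp add: of_point_to_point weighted_lists_nonempty[OF ps])
  qed
  moreover have "to_point ps \<in> bary K ps"
    by (simp add: bary_def glue_class_def)
  ultimately show ?thesis by auto
qed

text \<open>\<open>realization_incl\<close> is a union of this kind; representatives of a class over
  K are still points over L, so each can be read through \<open>of_point\<close>.\<close>

lemma realization_incl_bary:
  assumes K: "downset K" and L: "downset L" and KL: "K \<subseteq> L" and ps: "ps \<in> weighted_lists K"
  shows "realization_incl (list_sset L) (bary K ps) = bary L ps"
proof -
  have sub: "weighted_lists K \<subseteq> weighted_lists L"
    using KL by (auto simp: weighted_lists_def)
  have p: "to_point ps \<in> topspace (simplex_coproduct (list_sset K))"
    using ps by (rule to_point_topspace)
  have zero: "bary L (ps @ (x, 0) # qs) = bary L (ps @ qs)"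
    if "ps @ (x, 0) # qs \<in> weighted_lists K" for ps x qs
    using that sub by (intro bary_zero[OF L]) blast
  have merge: "bary L (ps @ (x, a) # (x, b) # qs) = bary L (ps @ (x, a + b) # qs)"
    if "ps @ (x, a) # (x, b) # qs \<in> weighted_lists K" for ps x a b qs
    using that sub by (intro bary_merge) blast
  have "glue_class (list_sset L) q = bary L (of_point q)" if "q \<in> bary K ps" for q
  proof (rule bary_eq_glue_class)
    have "equivclp (glue (list_sset K)) (to_point ps) q"
      using that by (simp add: bary_def glue_class_def)
    from equivclp_glue_invariant[of K "bary L", OF zero merge K p this]
    show "q \<in> topspace (simplex_coproduct (list_sset L))"
      using KL by (auto simp: topspace_simplex_coproduct)
  qed
  then have "realization_incl (list_sset L) (bary K ps) = (\<Union>p\<in>bary K ps. bary L (of_point p))"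
    by (simp add: realization_incl_def)
  also have "\<dots> = bary L ps"
    using zero merge K ps by (rule Union_glue_class)
  finally show ?thesis .
qed

subsection \<open>The straight-line homotopy\<close>

text \<open>The point at time u on the segment from the a-image to the b-image, inside the simplex
  spanned by both. Placing the halves one after the other, rather than interleaving them, keeps
  neighbours of \<open>ps\<close> adjacent in each half, so that they can still be merged.\<close>

definition join_list :: "('x \<Rightarrow> 'y) \<Rightarrow> ('x \<Rightarrow> 'y) \<Rightarrow> real \<Rightarrow> ('x \<times> real) list \<Rightarrow> ('y \<times> real) list" where
  "join_list a b u ps =
     map (\<lambda>p. (a (fst p), (1 - u) * snd p)) ps @ map (\<lambda>p. (b (fst p), u * snd p)) ps"

text \<open>At time 0 this is the map of realizations induced by a; in that role it is also used
  with b = a.\<close>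

definition join_map ::
    "'y set set \<Rightarrow> ('x \<Rightarrow> 'y) \<Rightarrow> ('x \<Rightarrow> 'y) \<Rightarrow> real \<Rightarrow> 'x list splx_point set \<Rightarrow> 'y list splx_point set" where
  "join_map L a b u c = (\<Union>p\<in>c. bary L (join_list a b u (of_point p)))"

text \<open>Contiguity of simplicial maps in the classical sense. The case a = b says that a is
  simplicial from K to L.\<close>

definition contiguous :: "'x set set \<Rightarrow> 'y set set \<Rightarrow> ('x \<Rightarrow> 'y) \<Rightarrow> ('x \<Rightarrow> 'y) \<Rightarrow> bool" where
  "contiguous K L a b \<longleftrightarrow> (\<forall>A\<in>K. a ` A \<union> b ` A \<in> L)"

lemma join_list_weighted_lists:
  assumes ab: "contiguous K L a b" and u: "0 \<le> u" "u \<le> 1" and ps: "ps \<in> weighted_lists K"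
  shows "join_list a b u ps \<in> weighted_lists L"
proof -
  have sum: "sum_list (map (\<lambda>p. c * snd p) ps) = c * sum_list (map snd ps)" for c :: real
    by (induction ps) (simp_all add: algebra_simps)
  have "fst ` set (join_list a b u ps) = a ` (fst ` set ps) \<union> b ` (fst ` set ps)"
    by (simp add: join_list_def image_Un image_image)
  moreover have "fst ` set ps \<in> K" using ps by (simp add: weighted_lists_def)
  ultimately have "fst ` set (join_list a b u ps) \<in> L"
    using ab by (simp add: contiguous_def)
  moreover have "sum_list (map snd (join_list a b u ps)) = 1"
    using ps by (simp add: join_list_def o_def sum weighted_lists_def)
  moreover have "\<forall>p\<in>set (join_list a b u ps). 0 \<le> snd p"
    using ps u by (auto simp: join_list_def weighted_lists_def)
  ultimately show ?thesis by (simp add: weighted_lists_def)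
qed

text \<open>The weightless entry leaves one such entry in each half; they are removed one after the
  other.\<close>

lemma bary_join_list_zero:
  assumes L: "downset L" and w: "join_list a b u (ps @ (x, 0) # qs) \<in> weighted_lists L"
  shows "bary L (join_list a b u (ps @ (x, 0) # qs)) = bary L (join_list a b u (ps @ qs))"
proof -
  let ?a = "map (\<lambda>p. (a (fst p), (1 - u) * snd p))" and ?b = "map (\<lambda>p. (b (fst p), u * snd p))"
  have eq: "join_list a b u (ps @ (x, 0) # qs) =
      ?a ps @ (a x, 0) # (?a qs @ ?b ps @ (b x, 0) # ?b qs)"
    by (simp add: join_list_def)
  have w': "(?a ps @ ?a qs @ ?b ps) @ (b x, 0) # ?b qs \<in> weighted_lists L"
    using weighted_lists_append_zero[OF L w[unfolded eq]] by simp
  show ?thesis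
    using bary_zero[OF L w[unfolded eq]] bary_zero[OF L w'] unfolding eq
    by (simp add: join_list_def)
qed

lemma bary_join_list_merge:
  assumes w: "join_list a b u (ps @ (x, r) # (x, s) # qs) \<in> weighted_lists L"
  shows "bary L (join_list a b u (ps @ (x, r) # (x, s) # qs)) =
    bary L (join_list a b u (ps @ (x, r + s) # qs))"
proof -
  let ?a = "map (\<lambda>p. (a (fst p), (1 - u) * snd p))" and ?b = "map (\<lambda>p. (b (fst p), u * snd p))"
  have eq: "join_list a b u (ps @ (x, r) # (x, s) # qs) =
      ?a ps @ (a x, (1 - u) * r) # (a x, (1 - u) * s) #
        (?a qs @ ?b ps @ (b x, u * r) # (b x, u * s) # ?b qs)"
    by (simp add: join_list_def)
  have w': "(?a ps @ (a x, (1 - u) * r + (1 - u) * s) # ?a qs @ ?b ps) @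
      (b x, u * r) # (b x, u * s) # ?b qs \<in> weighted_lists L"
    using weighted_lists_merge[OF w[unfolded eq]] by simp
  show ?thesis
    using bary_merge[OF w[unfolded eq]] bary_merge[OF w'] unfolding eq
    by (simp add: join_list_def distrib_left)
qed

lemma join_map_bary:
  assumes "downset K" "downset L" and ab: "contiguous K L a b" and u: "0 \<le> u" "u \<le> 1"
    and "ps \<in> weighted_lists K"
  shows "join_map L a b u (bary K ps) = bary L (join_list a b u ps)"
  unfolding join_map_def
proof (rule Union_glue_class[where F = "\<lambda>ps. bary L (join_list a b u ps)"])
  show "bary L (join_list a b u (ps @ (x, 0) # qs)) = bary L (join_list a b u (ps @ qs))"
    if "ps @ (x, 0) # qs \<in> weighted_lists K" for ps x qs
    using assms(2) join_list_weighted_lists[OF ab u that] by (rule bary_join_list_zero)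
  show "bary L (join_list a b u (ps @ (x, r) # (x, s) # qs)) =
      bary L (join_list a b u (ps @ (x, r + s) # qs))"
    if "ps @ (x, r) # (x, s) # qs \<in> weighted_lists K" for ps x r s qs
    using join_list_weighted_lists[OF ab u that] by (rule bary_join_list_merge)
qed (use assms in auto)

lemma bary_zeros:
  assumes L: "downset L"
  shows "ps @ zs @ qs \<in> weighted_lists L \<Longrightarrow> \<forall>p\<in>set zs. snd p = 0 \<Longrightarrow>
    bary L (ps @ zs @ qs) = bary L (ps @ qs)"
proof (induction zs)
  case (Cons z zs)
  obtain x where z: "z = (x, 0)" using Cons.prems(2) by (cases z) auto
  have w: "ps @ (x, 0) # (zs @ qs) \<in> weighted_lists L" using Cons.prems(1) by (simp add: z)
  show ?case
    using bary_zero[OF L w] Cons.IH weighted_lists_append_zero[OF L w] Cons.prems(2)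
    by (simp add: z)
qed simp

text \<open>At time 0 the whole second half has weight zero and drops out by
  \<open>bary_zeros\<close>.\<close>

lemma join_map_bary_0:
  assumes "downset K" and L: "downset L" and ab: "contiguous K L a b" and ps: "ps \<in> weighted_lists K"
  shows "join_map L a b 0 (bary K ps) = bary L (map (apfst a) ps)"
proof -
  have "join_list a b 0 ps = map (apfst a) ps @ map (\<lambda>p. (b (fst p), 0)) ps @ []"
    by (simp add: join_list_def apfst_def map_prod_def case_prod_beta)
  then show ?thesis
    using bary_zeros[OF L, of "map (apfst a) ps" "map (\<lambda>p. (b (fst p), 0)) ps" "[]"]
      join_list_weighted_lists[OF ab _ _ ps, of 0] join_map_bary[OF assms(1-3) _ _ ps, of 0]
    by simp
qed

lemma join_map_bary_1:
  assumes "downset K" and L: "downset L" and ab: "contiguous K L a b" and ps: "ps \<in> weighted_lists K"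
  shows "join_map L a b 1 (bary K ps) = bary L (map (apfst b) ps)"
proof -
  have "join_list a b 1 ps = [] @ map (\<lambda>p. (a (fst p), 0)) ps @ map (apfst b) ps"
    by (simp add: join_list_def apfst_def map_prod_def case_prod_beta)
  then show ?thesis
    using bary_zeros[OF L, of "[]" "map (\<lambda>p. (a (fst p), 0)) ps" "map (apfst b) ps"]
      join_list_weighted_lists[OF ab _ _ ps, of 1] join_map_bary[OF assms(1-3) _ _ ps, of 1]
    by simp
qed

text \<open>Each summand is open in the sum, so a rectangular neighbourhood found in
  \<open>prod_topology Z (X i)\<close> is carried by the injection to one in the whole
  product.\<close>

lemma continuous_map_prod_sum_topology:
  assumes f: "\<And>i. i \<in> I \<Longrightarrow> continuous_map (prod_topology Z (X i)) Y (\<lambda>(u, t). f (u, (i, t)))"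
  shows "continuous_map (prod_topology Z (sum_topology X I)) Y f"
  unfolding continuous_map_def
proof (intro conjI allI impI)
  show "f \<in> topspace (prod_topology Z (sum_topology X I)) \<rightarrow> topspace Y"
  proof
    fix z assume "z \<in> topspace (prod_topology Z (sum_topology X I))"
    then obtain u i t where z: "z = (u, (i, t))" "u \<in> topspace Z" "i \<in> I" "t \<in> topspace (X i)"
      by auto
    then show "f z \<in> topspace Y"
      using continuous_map_image_subset_topspace[OF f[OF z(3)]] by auto
  qed
  fix W assume W: "openin Y W"
  show "openin (prod_topology Z (sum_topology X I))
      {z \<in> topspace (prod_topology Z (sum_topology X I)). f z \<in> W}"
    unfolding openin_prod_topology_alt
  proof (intro allI impI)
    fix u p assume "(u, p) \<in> {z \<in> topspace (prod_topology Z (sum_topology X I)). f z \<in> W}"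
    then obtain i t where p: "p = (i, t)" and ut: "u \<in> topspace Z" "i \<in> I" "t \<in> topspace (X i)"
      and fW: "f (u, (i, t)) \<in> W" by auto
    have "openin (prod_topology Z (X i))
        {z \<in> topspace (prod_topology Z (X i)). (\<lambda>(u, t). f (u, (i, t))) z \<in> W}"
      using f[OF ut(2)] W by (simp add: continuous_map_def)
    note open_i = this[unfolded openin_prod_topology_alt, rule_format]
    have "(u, t) \<in> {z \<in> topspace (prod_topology Z (X i)). (\<lambda>(u, t). f (u, (i, t))) z \<in> W}"
      using ut fW by simp
    from open_i[OF this] obtain U V where UV: "openin Z U" "openin (X i) V" "u \<in> U" "t \<in> V"
      and sub: "U \<times> V \<subseteq> {z \<in> topspace (prod_topology Z (X i)). (\<lambda>(u, t). f (u, (i, t))) z \<in> W}"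
      by (elim exE conjE) (rule that)
    have "openin (sum_topology X I) (Pair i ` V)"
      using open_map_component_injection[OF ut(2), of X] UV(2) by (simp add: open_map_def)
    moreover have "U \<times> Pair i ` V \<subseteq> {z \<in> topspace (prod_topology Z (sum_topology X I)). f z \<in> W}"
    proof
      fix z assume "z \<in> U \<times> Pair i ` V"
      then obtain u' t' where z: "z = (u', (i, t'))" "u' \<in> U" "t' \<in> V" by auto
      then have "(u', t') \<in> U \<times> V" by simp
      from subsetD[OF sub this]
      show "z \<in> {z \<in> topspace (prod_topology Z (sum_topology X I)). f z \<in> W}"
        using ut(2) by (simp add: z(1))
    qed
    ultimately show "\<exists>U V. openin Z U \<and> openin (sum_topology X I) V \<and> u \<in> U \<and> p \<in> V \<and>
        U \<times> V \<subseteq> {z \<in> topspace (prod_topology Z (sum_topology X I)). f z \<in> W}"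
      using UV p by blast
  qed
qed

lemma quotient_map_glue_class: "quotient_map (simplex_coproduct Y) (realization Y) (glue_class Y)"
  unfolding realization_def by (rule quotient_map_quotient_topology)

text \<open>Continuity is tested before gluing, where on each simplex the homotopy is polynomial in
  the time and the coordinates.\<close>

lemma continuous_map_join_map:
  assumes K: "downset K" and L: "downset L" and ab: "contiguous K L a b"
  shows "continuous_map (prod_topology (top_of_set {0..1}) (realization (list_sset K)))
    (realization (list_sset L)) (\<lambda>(u, c). join_map L a b u c)"
proof (rule continuous_compose_quotient_map)
  \<comment> \<open>The product of the identity of the interval with a quotient map is a quotient
    map because the interval is locally compact Hausdorff.\<close>
  show "quotient_map (prod_topology (top_of_set {0..1::real}) (simplex_coproduct (list_sset K)))
      (prod_topology (top_of_set {0..1}) (realization (list_sset K)))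
      (\<lambda>(u, p). (u, glue_class (list_sset K) p))"
    by (rule quotient_map_prod_right[OF _ _ quotient_map_glue_class])
      (auto intro: compact_imp_locally_compact_space Hausdorff_space_subtopology
        simp: compact_space_subtopology)
  define T where "T k = subtopology (powertop_real UNIV) (standard_simplex k)" for k
  \<comment> \<open>The joined simplex has 2(k+1) vertices, hence dimension
    \<open>Suc (2 * k)\<close>, and its second block of coordinates starts at index
    \<open>Suc k\<close>. Past the last index the formula yields 0, since t vanishes beyond
    k.\<close>
  define J where "J = (\<lambda>z::real \<times> 'a list splx_point.
    (\<lambda>(u, ((k, xs), t)). ((Suc (2 * k), map a xs @ map b xs),
      \<lambda>j. if j \<le> k then (1 - u) * t j else u * t (j - Suc k))) z)"
  have J_eq: "to_point (join_list a b u (of_point p)) = J (u, p)"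
    if "p \<in> topspace (simplex_coproduct (list_sset K))" for u p
  proof -
    obtain k xs t where p: "p = ((k, xs), t)" by (metis prod.collapse)
    with that have len: "length xs = Suc k" and t: "\<And>j. j > k \<Longrightarrow> t j = 0"
      by (auto simp: topspace_simplex_coproduct standard_simplex_def)
    have maps: "map (\<lambda>p. a (fst p)) (zip xs ts) = map a xs"
      "map (\<lambda>p. b (fst p)) (zip xs ts) = map b xs" if "length ts = Suc k" for ts :: "real list"
      using len that by (auto intro: nth_equalityI)
    show ?thesis
      using len t
      by (auto simp: p J_def to_point_def join_list_def of_point_def nth_append fun_eq_iff o_def maps
          simp del: upt_Suc)
  qed
  have J_top: "J (u, p) \<in> topspace (simplex_coproduct (list_sset L))"
    if "p \<in> topspace (simplex_coproduct (list_sset K))" "u \<in> {0..1}" for u p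
    using that unfolding J_eq[OF that(1), symmetric]
    by (intro to_point_topspace join_list_weighted_lists[OF ab] of_point_weighted_lists) auto
  have cont_J: "continuous_map (prod_topology (top_of_set {0..1}) (simplex_coproduct (list_sset K)))
      (simplex_coproduct (list_sset L)) J"
    unfolding simplex_coproduct_def[of "list_sset K"]
  proof (rule continuous_map_prod_sum_topology)
    fix i assume "i \<in> {(k, y). y \<in> simplices (list_sset K) k}"
    then obtain k xs where i: "i = (k, xs)" and xs: "length xs = Suc k" "set xs \<in> K" by auto
    define g where "g = (\<lambda>(u::real, t). \<lambda>j. if j \<le> k then (1 - u) * t j else u * t (j - Suc k))"
    let ?Z = "prod_topology (top_of_set {0..1::real}) (T k)"
    have fst: "continuous_map ?Z euclideanreal fst"
      using continuous_map_fst[of "top_of_set {0..1::real}" "T k"]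
      by (simp add: continuous_map_in_subtopology)
    have snd: "continuous_map ?Z euclideanreal (\<lambda>z. snd z j)" for j
      using continuous_map_snd[of "top_of_set {0..1::real}" "T k"]
      by (auto simp: T_def continuous_map_in_subtopology continuous_map_componentwise_UNIV)
    have g: "continuous_map ?Z (powertop_real UNIV) g"
      unfolding continuous_map_componentwise_UNIV
    proof
      fix j
      have "(\<lambda>z. g z j) = (\<lambda>z. if j \<le> k then (1 - fst z) * snd z j else fst z * snd z (j - Suc k))"
        by (auto simp: g_def fun_eq_iff)
      moreover have "continuous_map ?Z euclideanreal (\<lambda>z. (1 - fst z) * snd z j)"
        by (intro continuous_intros fst snd)
      moreover have "continuous_map ?Z euclideanreal (\<lambda>z. fst z * snd z (j - Suc k))"
        by (intro continuous_intros fst snd)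
      ultimately show "continuous_map ?Z euclideanreal (\<lambda>z. g z j)"
        by (cases "j \<le> k") simp_all
    qed
    have Jg: "J (u, (i, t)) = ((Suc (2 * k), map a xs @ map b xs), g (u, t))" for u t
      by (simp add: J_def i g_def)
    have top: "J (u, (i, t)) \<in> topspace (simplex_coproduct (list_sset L))"
      if "(u, t) \<in> topspace ?Z" for u t
      using that xs by (intro J_top) (auto simp: T_def i topspace_simplex_coproduct)
    have "continuous_map ?Z (T (Suc (2 * k))) g"
      unfolding T_def[of "Suc _"] continuous_map_in_subtopology
      using g top unfolding Jg by (auto simp: topspace_simplex_coproduct)
    moreover have "continuous_map (T (Suc (2 * k))) (simplex_coproduct (list_sset L))
        (Pair (Suc (2 * k), map a xs @ map b xs))"
    proof -
      have "a ` set xs \<union> b ` set xs \<in> L" using ab xs(2) by (simp add: contiguous_def)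
      then have "(Suc (2 * k), map a xs @ map b xs) \<in> {(k, y). y \<in> simplices (list_sset L) k}"
        using xs by simp
      from continuous_map_component_injection[OF this,
          of "\<lambda>(k, y). subtopology (powertop_real UNIV) (standard_simplex k)"]
      show ?thesis
        unfolding simplex_coproduct_def T_def by simp
    qed
    ultimately have "continuous_map ?Z (simplex_coproduct (list_sset L))
        (Pair (Suc (2 * k), map a xs @ map b xs) \<circ> g)"
      by (rule continuous_map_compose)
    moreover have "Pair (Suc (2 * k), map a xs @ map b xs) \<circ> g = (\<lambda>(u, t). J (u, (i, t)))"
      by (auto simp: Jg fun_eq_iff)
    ultimately show "continuous_map
        (prod_topology (top_of_set {0..1}) ((\<lambda>(k, y). subtopology (powertop_real UNIV) (standard_simplex k)) i))
        (simplex_coproduct (list_sset L)) (\<lambda>(u, t). J (u, (i, t)))"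
      by (simp add: i T_def)
  qed
  have "continuous_map (prod_topology (top_of_set {0..1}) (simplex_coproduct (list_sset K)))
      (realization (list_sset L)) (glue_class (list_sset L) \<circ> J)"
    using cont_J quotient_imp_continuous_map[OF quotient_map_glue_class]
    by (rule continuous_map_compose)
  then show "continuous_map (prod_topology (top_of_set {0..1}) (simplex_coproduct (list_sset K)))
     (realization (list_sset L))
     ((\<lambda>(u, c). join_map L a b u c) \<circ> (\<lambda>(u, p). (u, glue_class (list_sset K) p)))"
  proof (rule continuous_map_eq)
    fix z assume "z \<in> topspace (prod_topology (top_of_set {0..1::real}) (simplex_coproduct (list_sset K)))"
    then obtain u p where z: "z = (u, p)" "0 \<le> u" "u \<le> 1"
      "p \<in> topspace (simplex_coproduct (list_sset K))" by auto
    have "glue_class (list_sset L) (J z) = bary L (join_list a b u (of_point p))"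
      using z by (simp add: bary_def J_eq)
    also have "\<dots> = join_map L a b u (glue_class (list_sset K) p)"
      using join_map_bary[OF K L ab z(2,3) of_point_weighted_lists[OF z(4)]] bary_eq_glue_class[OF z(4)]
      by simp
    finally show "(glue_class (list_sset L) \<circ> J) z =
        ((\<lambda>(u, c). join_map L a b u c) \<circ> (\<lambda>(u, p). (u, glue_class (list_sset K) p))) z"
      by (simp add: z)
  qed
qed

subsection \<open>Triviality on homotopy groups\<close>

text \<open>Composition with the inclusion respects homotopies relative to the boundary, so the
  union in \<open>homotopy_induced\<close> runs over a constant family. Equality with the neutral
  class then amounts to a homotopy, because the constant map lies in its own class.\<close>

lemma homotopy_incl_trivial_iff:
  assumes cont: "continuous_map (realization Z) (realization Y) (realization_incl Y)"
    and z: "realization_vertex Z v \<in> topspace (realization Z)"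
    and zy: "realization_incl Y (realization_vertex Z v) = realization_vertex Y v"
  shows "homotopy_incl_trivial k Z Y v \<longleftrightarrow>
    (\<forall>f. continuous_map (cube k) (realization Z) f \<longrightarrow>
       (\<forall>t\<in>cube_boundary k. f t = realization_vertex Z v) \<longrightarrow>
       homotopic_with (\<lambda>h. \<forall>t\<in>cube_boundary k. h t = realization_vertex Y v) (cube k) (realization Y)
         (realization_incl Y \<circ> f) (\<lambda>_. realization_vertex Y v))"
proof -
  let ?H = "homotopic_with (\<lambda>h. \<forall>t\<in>cube_boundary k. h t = realization_vertex Y v) (cube k) (realization Y)"
  let ?C = "homotopy_class k (realization Y) (realization_vertex Y v)"
  have class_eq: "?C f = ?C g" if "?H f g" for f g
    unfolding homotopy_class_def
  proof (intro Collect_cong iffI)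
    fix h assume "?H f h"
    with homotopic_with_symD[OF that] show "?H g h" by (rule homotopic_with_trans)
  next
    fix h assume "?H g h"
    with that show "?H f h" by (rule homotopic_with_trans)
  qed
  have y: "realization_vertex Y v \<in> topspace (realization Y)"
    using continuous_map_image_subset_topspace[OF cont] z zy by blast
  have "homotopy_induced k (realization Y) (realization_vertex Y v) (realization_incl Y)
      (homotopy_class k (realization Z) (realization_vertex Z v) f) =
      homotopy_one k (realization Y) (realization_vertex Y v) \<longleftrightarrow>
      ?H (realization_incl Y \<circ> f) (\<lambda>_. realization_vertex Y v)"
    if f: "continuous_map (cube k) (realization Z) f" "\<forall>t\<in>cube_boundary k. f t = realization_vertex Z v" for f
  proof -
    have const: "?C (realization_incl Y \<circ> g) = ?C (realization_incl Y \<circ> f)"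
      if "g \<in> homotopy_class k (realization Z) (realization_vertex Z v) f" for g
    proof -
      have "homotopic_with (\<lambda>h. \<forall>t\<in>cube_boundary k. h t = realization_vertex Z v) (cube k) (realization Z) f g"
        using that by (simp add: homotopy_class_def)
      then have "?H (realization_incl Y \<circ> f) (realization_incl Y \<circ> g)"
        using cont by (rule homotopic_with_compose_continuous_map_left) (simp add: zy)
      then show ?thesis by (rule class_eq[symmetric])
    qed
    have "f \<in> homotopy_class k (realization Z) (realization_vertex Z v) f"
      using f by (simp add: homotopy_class_def)
    then have "homotopy_induced k (realization Y) (realization_vertex Y v) (realization_incl Y)
      (homotopy_class k (realization Z) (realization_vertex Z v) f) = ?C (realization_incl Y \<circ> f)"
      unfolding homotopy_induced_def by (rule UN_constant_eq) (intro ballI const)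
    moreover have "?C (realization_incl Y \<circ> f) = ?C (\<lambda>_. realization_vertex Y v) \<longleftrightarrow>
        ?H (realization_incl Y \<circ> f) (\<lambda>_. realization_vertex Y v)"
    proof
      assume "?C (realization_incl Y \<circ> f) = ?C (\<lambda>_. realization_vertex Y v)"
      moreover have "(\<lambda>_. realization_vertex Y v) \<in> ?C (\<lambda>_. realization_vertex Y v)"
        using y by (simp add: homotopy_class_def)
      ultimately have "(\<lambda>_. realization_vertex Y v) \<in> ?C (realization_incl Y \<circ> f)"
        by simp
      then show "?H (realization_incl Y \<circ> f) (\<lambda>_. realization_vertex Y v)"
        by (simp add: homotopy_class_def)
    qed (rule class_eq)
    ultimately show ?thesis by (simp add: homotopy_one_def)
  qed
  note this [simp]
  show ?thesis
    unfolding homotopy_incl_trivial_def homotopy_group_def by auto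
qed

lemma realization_vertex_list_sset: "realization_vertex (list_sset K) [v] = bary K [(v, 1)]"
proof -
  have "to_point [(v, 1)] = ((0, [v]), \<lambda>j. if j = 0 then 1 else 0)"
    by (auto simp: to_point_def fun_eq_iff)
  then show ?thesis by (simp add: realization_vertex_def bary_def)
qed

lemma apfst_weighted_lists:
  assumes a: "contiguous K L a a" and ps: "ps \<in> weighted_lists K"
  shows "map (apfst a) ps \<in> weighted_lists L"
proof -
  have "fst ` set ps \<in> K" using ps by (simp add: weighted_lists_def)
  with a have "a ` fst ` set ps \<in> L" by (simp add: contiguous_def)
  moreover have "fst ` set (map (apfst a) ps) = a ` fst ` set ps" by (simp add: image_image)
  ultimately show ?thesis using ps by (simp add: weighted_lists_def o_def)
qed

lemma continuous_map_join_map_const: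
  assumes "downset K" "downset L" "contiguous K L a b" and u: "u \<in> {0..1}"
  shows "continuous_map (realization (list_sset K)) (realization (list_sset L)) (join_map L a b u)"
proof -
  have "continuous_map (realization (list_sset K))
      (prod_topology (top_of_set {0..1}) (realization (list_sset K))) (\<lambda>c. (u, c))"
    using u by (simp add: continuous_map_paired)
  from continuous_map_compose[OF this continuous_map_join_map[OF assms(1-3)]]
  show ?thesis by (simp add: o_def)
qed

text \<open>The inclusion is the straight-line map of the identity with itself at time 0.\<close>

lemma continuous_map_realization_incl:
  assumes K: "downset K" and L: "downset L" and KL: "K \<subseteq> L"
  shows "continuous_map (realization (list_sset K)) (realization (list_sset L)) (realization_incl (list_sset L))"
proof -
  have id: "contiguous K L id id" using KL by (auto simp: contiguous_def)
  show ?thesis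
  proof (rule continuous_map_eq[OF continuous_map_join_map_const[OF K L id, of 0]])
    fix c assume "c \<in> topspace (realization (list_sset K))"
    then obtain ps where "c = bary K ps" "ps \<in> weighted_lists K"
      by (auto simp: topspace_realization)
    then show "join_map L id id 0 c = realization_incl (list_sset L) c"
      by (simp add: join_map_bary_0[OF K L id] realization_incl_bary[OF K L KL] apfst_id[unfolded id_def])
  qed simp
qed

text \<open>A cube in K is pushed to L by a, contracted in L', and the contraction is brought back
  to K' by b. The straight-line homotopy joins the original cube to the transported one, and it is
  constant on the boundary because b (a v) = v.\<close>

lemma homotopy_incl_trivial_transfer:
  assumes K: "downset K" and L: "downset L" and L': "downset L'" and K': "downset K'"
    and a: "contiguous K L a a" and LL': "L \<subseteq> L'" and b: "contiguous L' K' b b"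
    and ba: "contiguous K K' (\<lambda>x. x) (\<lambda>x. b (a x))" and v: "{v} \<in> K" and bav: "b (a v) = v"
    and triv: "homotopy_incl_trivial k (list_sset L) (list_sset L') [a v]"
  shows "homotopy_incl_trivial k (list_sset K) (list_sset K') [v]"
proof -
  have KK': "K \<subseteq> K'"
  proof
    fix A assume "A \<in> K"
    then have "A \<union> (\<lambda>x. b (a x)) ` A \<in> K'" using ba by (simp add: contiguous_def)
    then show "A \<in> K'" by (rule downsetD[OF K']) simp
  qed
  have vK: "[(v, 1)] \<in> weighted_lists K" using v by (simp add: weighted_lists_def)
  have vL: "[(a v, 1)] \<in> weighted_lists L"
    using apfst_weighted_lists[OF a vK] by simp
  then have vL': "[(a v, 1)] \<in> weighted_lists L'" using LL' by (auto simp: weighted_lists_def)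
  have incl_v: "realization_incl (list_sset L') (bary L [(a v, 1)]) = bary L' [(a v, 1)]"
    using vL by (rule realization_incl_bary[OF L L' LL'])
  let ?P = "\<lambda>X x h. \<forall>t\<in>cube_boundary k. h t = bary X [(x, 1)]"
  \<comment> \<open>Time 0 of the straight-line homotopy from a vertex map to itself serves as the
    induced map, so its continuity is already available.\<close>
  let ?a = "join_map L a a 0" and ?b = "join_map K' b b 0"
  have cont_a: "continuous_map (realization (list_sset K)) (realization (list_sset L)) ?a"
    using K L a by (rule continuous_map_join_map_const) simp
  have cont_b: "continuous_map (realization (list_sset L')) (realization (list_sset K')) ?b"
    using L' K' b by (rule continuous_map_join_map_const) simp
  have a_v: "?a (bary K [(v, 1)]) = bary L [(a v, 1)]"
    using join_map_bary_0[OF K L a vK] by simp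
  have b_v: "?b (bary L' [(a v, 1)]) = bary K' [(v, 1)]"
    using join_map_bary_0[OF L' K' b vL'] by (simp add: bav)
  show ?thesis
  proof (subst homotopy_incl_trivial_iff)
    show "continuous_map (realization (list_sset K)) (realization (list_sset K')) (realization_incl (list_sset K'))"
      using K K' KK' by (rule continuous_map_realization_incl)
    show "realization_vertex (list_sset K) [v] \<in> topspace (realization (list_sset K))"
      using vK by (auto simp: realization_vertex_list_sset topspace_realization)
    show "realization_incl (list_sset K') (realization_vertex (list_sset K) [v]) =
        realization_vertex (list_sset K') [v]"
      using realization_incl_bary[OF K K' KK' vK] by (simp add: realization_vertex_list_sset)
    show "\<forall>f. continuous_map (cube k) (realization (list_sset K)) f \<longrightarrow>
       (\<forall>t\<in>cube_boundary k. f t = realization_vertex (list_sset K) [v]) \<longrightarrow>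
       homotopic_with (\<lambda>h. \<forall>t\<in>cube_boundary k. h t = realization_vertex (list_sset K') [v]) (cube k)
         (realization (list_sset K')) (realization_incl (list_sset K') \<circ> f)
         (\<lambda>_. realization_vertex (list_sset K') [v])"
      unfolding realization_vertex_list_sset
    proof (intro allI impI)
      fix f assume f: "continuous_map (cube k) (realization (list_sset K)) f"
        and f_v: "?P K v f"
      have f_top: "f t \<in> bary K ` weighted_lists K" if "t \<in> topspace (cube k)" for t
        using continuous_map_image_subset_topspace[OF f] that by (auto simp: topspace_realization)
      have "continuous_map (cube k) (realization (list_sset L)) (?a \<circ> f)"
        using f cont_a by (rule continuous_map_compose)
      moreover have "?P L (a v) (?a \<circ> f)"
        using f_v a_v by simp
      moreover have "homotopy_incl_trivial k (list_sset L) (list_sset L') [a v] \<longleftrightarrow>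
        (\<forall>f. continuous_map (cube k) (realization (list_sset L)) f \<longrightarrow> ?P L (a v) f \<longrightarrow>
         homotopic_with (?P L' (a v)) (cube k) (realization (list_sset L'))
         (realization_incl (list_sset L') \<circ> f) (\<lambda>_. bary L' [(a v, 1)]))"
        unfolding realization_vertex_list_sset[symmetric]
      proof (rule homotopy_incl_trivial_iff)
        show "continuous_map (realization (list_sset L)) (realization (list_sset L')) (realization_incl (list_sset L'))"
          using L L' LL' by (rule continuous_map_realization_incl)
        show "realization_vertex (list_sset L) [a v] \<in> topspace (realization (list_sset L))"
          using vL by (auto simp: realization_vertex_list_sset topspace_realization)
        show "realization_incl (list_sset L') (realization_vertex (list_sset L) [a v]) =
          realization_vertex (list_sset L') [a v]"
          using incl_v by (simp add: realization_vertex_list_sset)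
      qed
      ultimately have "homotopic_with (?P L' (a v)) (cube k) (realization (list_sset L'))
         (realization_incl (list_sset L') \<circ> (?a \<circ> f)) (\<lambda>_. bary L' [(a v, 1)])"
        using triv by simp
      then have 1: "homotopic_with (?P K' v) (cube k) (realization (list_sset K'))
         (?b \<circ> (realization_incl (list_sset L') \<circ> (?a \<circ> f))) (?b \<circ> (\<lambda>_. bary L' [(a v, 1)]))"
        using cont_b by (rule homotopic_with_compose_continuous_map_left) (simp add: b_v)
      let ?h = "\<lambda>(u, t). join_map K' (\<lambda>x. x) (\<lambda>x. b (a x)) u (f t)"
      have h_v: "join_map K' (\<lambda>x. x) (\<lambda>x. b (a x)) u (bary K [(v, 1)]) = bary K' [(v, 1)]"
        if "u \<in> {0..1}" for u
      proof -
        \<comment> \<open>At the base point both halves consist of the same vertex v; the weights 1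
          - u and u merge to 1, so the point does not move.\<close>
        have "join_list (\<lambda>x. x) (\<lambda>x. b (a x)) u [(v, 1)] = [] @ (v, 1 - u) # (v, u) # []"
          by (simp add: join_list_def bav)
        with join_list_weighted_lists[OF ba _ _ vK, of u] join_map_bary[OF K K' ba _ _ vK, of u] that
        show ?thesis using bary_merge[of "[]" v "1 - u" u "[]" K'] by simp
      qed
      have 2: "homotopic_with (?P K' v) (cube k) (realization (list_sset K'))
         (\<lambda>t. ?h (0, t)) (\<lambda>t. ?h (1, t))"
        unfolding homotopic_with_def
      proof (intro exI[of _ ?h] conjI ballI allI)
        have "continuous_map (prod_topology (top_of_set {0..1}) (cube k))
          (prod_topology (top_of_set {0..1}) (realization (list_sset K))) (\<lambda>(u, t). (id u, f t))"
          using f by (intro iffD2[OF continuous_map_prod_top] disjI2 conjI) auto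
        from continuous_map_compose[OF this continuous_map_join_map[OF K K' ba]]
        show "continuous_map (prod_topology (top_of_set {0..1}) (cube k)) (realization (list_sset K')) ?h"
          by (simp add: o_def case_prod_beta')
      qed (use f_v h_v in auto)
      have zero: "?h (0, t) = realization_incl (list_sset K') (f t)"
        and one: "?h (1, t) = ?b (realization_incl (list_sset L') (?a (f t)))"
        if t: "t \<in> topspace (cube k)" for t
      proof -
        obtain ps where ft: "f t = bary K ps" and ps: "ps \<in> weighted_lists K"
          using f_top[OF t] by blast
        have aps: "map (apfst a) ps \<in> weighted_lists L"
          using a ps by (rule apfst_weighted_lists)
        then have aps': "map (apfst a) ps \<in> weighted_lists L'"
          using LL' by (auto simp: weighted_lists_def)
        show "?h (0, t) = realization_incl (list_sset K') (f t)"
          using join_map_bary_0[OF K K' ba ps] realization_incl_bary[OF K K' KK' ps]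
          by (simp add: ft apfst_id[unfolded id_def])
        show "?h (1, t) = ?b (realization_incl (list_sset L') (?a (f t)))"
          using join_map_bary_1[OF K K' ba ps] join_map_bary_0[OF K L a ps]
            realization_incl_bary[OF L L' LL' aps] join_map_bary_0[OF L' K' b aps']
          by (simp add: ft o_def apfst_compose)
      qed
      show "homotopic_with (?P K' v) (cube k) (realization (list_sset K'))
          (realization_incl (list_sset K') \<circ> f) (\<lambda>_. bary K' [(v, 1)])"
      proof (rule homotopic_with_trans)
        show "homotopic_with (?P K' v) (cube k) (realization (list_sset K'))
          (realization_incl (list_sset K') \<circ> f) (\<lambda>t. ?h (1, t))"
        proof (rule homotopic_with_trans[OF homotopic_with_equal 2])
          show "continuous_map (cube k) (realization (list_sset K')) (realization_incl (list_sset K') \<circ> f)"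
            using f continuous_map_realization_incl[OF K K' KK'] by (rule continuous_map_compose)
          show "?P K' v (realization_incl (list_sset K') \<circ> f)"
            using f_v realization_incl_bary[OF K K' KK' vK] by simp
          show "?P K' v (\<lambda>t. ?h (0, t))" using f_v h_v[of 0] by simp
        qed (use zero in simp)
        show "homotopic_with (?P K' v) (cube k) (realization (list_sset K'))
          (\<lambda>t. ?h (1, t)) (\<lambda>_. bary K' [(v, 1)])"
        proof (rule homotopic_with_trans[OF homotopic_with_equal])
          show "homotopic_with (?P K' v) (cube k) (realization (list_sset K'))
            (?b \<circ> (realization_incl (list_sset L') \<circ> (?a \<circ> f))) (\<lambda>_. bary K' [(v, 1)])"
            using 1 by (simp add: o_def b_v)
          show "?P K' v (\<lambda>t. ?h (1, t))" using f_v h_v[of 1] by simp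
          show "continuous_map (cube k) (realization (list_sset K')) (\<lambda>t. ?h (1, t))"
            using homotopic_with_imp_continuous_maps[OF 2] by simp
          show "?P K' v (?b \<circ> (realization_incl (list_sset L') \<circ> (?a \<circ> f)))"
            using homotopic_with_imp_property[OF 1] by simp
        qed (use one in simp)
      qed
    qed
  qed
qed

section \<open>Triviality on homology\<close>

definition frag_map :: "('x \<Rightarrow> 'y) \<Rightarrow> ('x \<Rightarrow>\<^sub>0 int) \<Rightarrow> ('y \<Rightarrow>\<^sub>0 int)" where
  "frag_map f = frag_extend (frag_of \<circ> f)"

text \<open>The boundary of the augmented complex: the empty list is the only simplex of dimension \<open>-1\<close>.\<close>

definition list_bdry :: "'x list \<Rightarrow> ('x list \<Rightarrow>\<^sub>0 int)" where
  "list_bdry xs = (\<Sum>i<length xs. frag_cmul ((-1) ^ i) (frag_of (take i xs @ drop (Suc i) xs)))"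

text \<open>A contiguity between the identity and \<open>c\<close> induces a chain homotopy, recursively defined by
  coning off the vertices.\<close>

primrec prism :: "('x \<Rightarrow> 'x) \<Rightarrow> 'x list \<Rightarrow> ('x list \<Rightarrow>\<^sub>0 int)" where
  "prism c [] = 0"
| "prism c (x # xs) = frag_of (x # c x # map c xs) - frag_map (Cons x) (prism c xs)"

lemma frag_map_simps [simp]:
  "frag_map f 0 = 0" "frag_map f (frag_of x) = frag_of (f x)"
  "frag_map f (v - w) = frag_map f v - frag_map f w" "frag_map f (v + w) = frag_map f v + frag_map f w"
  by (simp_all add: frag_map_def frag_extend_diff frag_extend_add)

lemma list_bdry_Nil [simp]: "list_bdry [] = 0"
  by (simp add: list_bdry_def)

text \<open>Face 0 deletes the head; every other face keeps it and has its index raised by one,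
  which accounts for the sign.\<close>

lemma list_bdry_Cons [simp]: "list_bdry (x # xs) = frag_of xs - frag_map (Cons x) (list_bdry xs)"
proof -
  have "frag_map (Cons x) (list_bdry xs) =
      (\<Sum>i<length xs. frag_cmul ((-1) ^ i) (frag_of (x # take i xs @ drop (Suc i) xs)))"
    by (simp add: list_bdry_def frag_map_def frag_extend_sum frag_extend_cmul o_def)
  then show ?thesis
    by (simp add: list_bdry_def sum.lessThan_Suc_shift sum_negf del: sum.lessThan_Suc minus_frag_cmul flip: minus_frag_cmul)
qed

lemma frag_linear_eqI:
  assumes "\<And>v w. f (v - w) = f v - f w" "\<And>v w. g (v - w) = g v - g w"
    and "f 0 = (0 :: 'b \<Rightarrow>\<^sub>0 int)" "g 0 = (0 :: 'b \<Rightarrow>\<^sub>0 int)" and "\<And>x. f (frag_of x) = g (frag_of x)"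
  shows "f w = g w"
  using subset_UNIV by (induction w rule: frag_induction) (simp_all add: assms)

text \<open>Coning off x is a contracting homotopy of the augmented complex; on the empty list this
  says that a vertex has the empty list as its boundary.\<close>

lemma list_bdry_frag_map_Cons:
  "frag_extend list_bdry (frag_map (Cons x) w) = w - frag_map (Cons x) (frag_extend list_bdry w)"
  by (rule frag_linear_eqI) (simp_all add: frag_extend_diff)

lemma prism_frag_map_Cons:
  "frag_extend (prism c) (frag_map (Cons x) w) =
    frag_map (Cons x) (frag_map (Cons (c x)) (frag_map (map c) w)) - frag_map (Cons x) (frag_extend (prism c) w)"
  by (rule frag_linear_eqI) (simp_all add: frag_extend_diff)

lemma frag_map_frag_map: "frag_map f (frag_map g w) = frag_map (f \<circ> g) w"
  by (rule frag_linear_eqI) simp_all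

lemma list_bdry_map: "list_bdry (map f xs) = frag_map (map f) (list_bdry xs)"
  by (induction xs) (simp_all add: frag_map_frag_map o_def)

text \<open>Expanding with the cone formulas, the terms \<open>prism c xs\<close> and the double
  cones over the c-image of \<open>list_bdry xs\<close> cancel, which leaves a cone over the
  induction hypothesis. The empty list needs no correction, as it is its own image.\<close>

lemma prism_homotopy:
  "frag_extend list_bdry (prism c xs) + frag_extend (prism c) (list_bdry xs) = frag_of (map c xs) - frag_of xs"
proof (induction xs)
  case (Cons x xs)
  have "frag_extend list_bdry (prism c (x # xs)) + frag_extend (prism c) (list_bdry (x # xs)) =
     frag_of (c x # map c xs) - frag_map (Cons x) (frag_of (map c xs)) +
     frag_map (Cons x) (frag_extend list_bdry (prism c xs) + frag_extend (prism c) (list_bdry xs))"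
    by (simp add: frag_extend_diff list_bdry_frag_map_Cons prism_frag_map_Cons list_bdry_map)
  also have "\<dots> = frag_of (map c (x # xs)) - frag_of (x # xs)"
    by (simp add: Cons.IH)
  finally show ?case .
qed simp

lemma keys_frag_map: "Poly_Mapping.keys (frag_map f w) \<subseteq> f ` Poly_Mapping.keys w"
  using keys_frag_extend[of "frag_of \<circ> f" w] by (auto simp: frag_map_def keys_frag_of)

text \<open>Contiguity of the identity and c puts the union of the vertices and their images into
  the target family; the prism uses no other vertices and raises the dimension by one.\<close>

lemma keys_prism:
  "ys \<in> Poly_Mapping.keys (prism c xs) \<Longrightarrow>
    length ys = Suc (length xs) \<and> set ys \<subseteq> set xs \<union> c ` set xs"
proof (induction xs arbitrary: ys)
  case (Cons x xs)
  have "ys \<in> Poly_Mapping.keys (frag_of (x # c x # map c xs)) \<union>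
      Poly_Mapping.keys (frag_map (Cons x) (prism c xs))"
    using Cons.prems keys_diff by (metis prism.simps(2) subsetD)
  then consider "ys = x # c x # map c xs" | "ys \<in> Cons x ` Poly_Mapping.keys (prism c xs)"
    using keys_frag_map by (force simp: keys_frag_of)
  then show ?case
  proof cases
    case 2
    then obtain zs where "ys = x # zs" "zs \<in> Poly_Mapping.keys (prism c xs)" by blast
    then show ?thesis using Cons.IH[of zs] by auto
  qed auto
qed simp

subsection \<open>Chains with coefficients\<close>

text \<open>Chains of arbitrary, possibly mixed, degree: operators such as \<open>list_bdry\<close>
  act on all lists at once, and degrees are recovered by
  \<open>chain_extend_carrier\<close>.\<close>

definition finite_chains :: "('r, 'm) ring_scheme \<Rightarrow> ('x \<Rightarrow> 'r) set" where
  "finite_chains R = {c. (\<forall>y. c y \<in> carrier R) \<and> finite {y. c y \<noteq> \<zero>\<^bsub>R\<^esub>}}"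

text \<open>The R-linear extension of an operator with integral coefficients, integers acting on R
  by multiples. Through it, identities for \<open>frag_extend\<close> proved once over the integers
  become available for coefficients in R.\<close>

definition chain_extend :: "('r, 'm) ring_scheme \<Rightarrow> ('x \<Rightarrow> ('y \<Rightarrow>\<^sub>0 int)) \<Rightarrow> ('x \<Rightarrow> 'r) \<Rightarrow> 'y \<Rightarrow> 'r" where
  "chain_extend R T c z = (\<Oplus>\<^bsub>R\<^esub>y\<in>{y. c y \<noteq> \<zero>\<^bsub>R\<^esub>}. [(poly_mapping.lookup (T y) z)] \<cdot>\<^bsub>R\<^esub> c y)"

context cring
begin

lemma add_pow_zero_int [simp]: "[(n::int)] \<cdot> \<zero> = \<zero>"
  by (rule add.int_pow_one)

lemma add_pow_closed_int [simp]: "x \<in> carrier R \<Longrightarrow> [(n::int)] \<cdot> x \<in> carrier R"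
  by (rule add.int_pow_closed)

lemma zero_add_pow_int [simp]: "[(0::int)] \<cdot> x = \<zero>"
  by (simp add: add_pow_def)

lemma finsum_add_pow_int:
  assumes x: "x \<in> carrier R" and "finite F"
  shows "(\<Oplus>i\<in>F. [(f i :: int)] \<cdot> x) = [(\<Sum>i\<in>F. f i)] \<cdot> x"
  using assms(2)
proof (induction F)
  case (insert i F)
  then show ?case
    using x by (simp add: finsum_insert Pi_def add.int_pow_mult)
qed (simp add: finsum_empty)

lemma finite_chainsD:
  assumes "c \<in> finite_chains R"
  shows "c y \<in> carrier R" "finite {y. c y \<noteq> \<zero>}"
  using assms by (auto simp: finite_chains_def)

lemma chain_extend_eq_finsum:
  assumes "\<And>y. c y \<in> carrier R" "finite F" "\<And>y. y \<notin> F \<Longrightarrow> c y = \<zero>"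
  shows "chain_extend R T c z = (\<Oplus>y\<in>F. [(poly_mapping.lookup (T y) z)] \<cdot> c y)"
  unfolding chain_extend_def
  by (rule add.finprod_mono_neutral_cong_left) (use assms in auto)

lemma chain_extend_support:
  assumes c: "c \<in> finite_chains R" and z: "chain_extend R T c z \<noteq> \<zero>"
  obtains y where "c y \<noteq> \<zero>" "z \<in> Poly_Mapping.keys (T y)"
proof -
  have "\<exists>y\<in>{y. c y \<noteq> \<zero>}. [(poly_mapping.lookup (T y) z)] \<cdot> c y \<noteq> \<zero>"
    using z unfolding chain_extend_def by (metis (no_types, lifting) add.finprod_one_eqI)
  then obtain y where y: "c y \<noteq> \<zero>" "[(poly_mapping.lookup (T y) z)] \<cdot> c y \<noteq> \<zero>" by blast
  then have "poly_mapping.lookup (T y) z \<noteq> 0" by auto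
  then show ?thesis using y that by (simp add: in_keys_iff)
qed

lemma chain_extend_finite_chains:
  assumes c: "c \<in> finite_chains R"
  shows "chain_extend R T c \<in> finite_chains R"
proof -
  have "{z. chain_extend R T c z \<noteq> \<zero>} \<subseteq> (\<Union>y\<in>{y. c y \<noteq> \<zero>}. Poly_Mapping.keys (T y))"
  proof
    fix z assume "z \<in> {z. chain_extend R T c z \<noteq> \<zero>}"
    then have "chain_extend R T c z \<noteq> \<zero>" by simp
    with c obtain y where "c y \<noteq> \<zero>" "z \<in> Poly_Mapping.keys (T y)"
      by (rule chain_extend_support)
    then show "z \<in> (\<Union>y\<in>{y. c y \<noteq> \<zero>}. Poly_Mapping.keys (T y))"
      by (intro UN_I[of y]) simp_all
  qed
  then have "finite {z. chain_extend R T c z \<noteq> \<zero>}"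
    by (rule finite_subset) (use finite_chainsD(2)[OF c] in simp)
  moreover have "chain_extend R T c z \<in> carrier R" for z
    unfolding chain_extend_def using finite_chainsD[OF c] by (intro finsum_closed) auto
  ultimately show ?thesis by (simp add: finite_chains_def)
qed

lemma finite_chains_add:
  assumes "c \<in> finite_chains R" "d \<in> finite_chains R"
  shows "(\<lambda>y. c y \<oplus> d y) \<in> finite_chains R"
proof -
  have "{y. c y \<oplus> d y \<noteq> \<zero>} \<subseteq> {y. c y \<noteq> \<zero>} \<union> {y. d y \<noteq> \<zero>}"
    by auto
  then have "finite {y. c y \<oplus> d y \<noteq> \<zero>}"
    by (rule finite_subset) (simp add: finite_chainsD(2) assms)
  then show ?thesis
    using assms by (simp add: finite_chains_def)
qed

lemma finite_chains_minus:
  assumes "c \<in> finite_chains R"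
  shows "(\<lambda>y. \<ominus> c y) \<in> finite_chains R"
proof -
  have "{y. \<ominus> c y \<noteq> \<zero>} \<subseteq> {y. c y \<noteq> \<zero>}"
    by auto
  then have "finite {y. \<ominus> c y \<noteq> \<zero>}"
    by (rule finite_subset) (simp add: finite_chainsD(2) assms)
  then show ?thesis
    using assms by (simp add: finite_chains_def)
qed

lemma chain_extend_add:
  assumes c: "c \<in> finite_chains R" and d: "d \<in> finite_chains R"
  shows "chain_extend R T (\<lambda>y. c y \<oplus> d y) z = chain_extend R T c z \<oplus> chain_extend R T d z"
proof -
  define F where "F = {y. c y \<noteq> \<zero>} \<union> {y. d y \<noteq> \<zero>}"
  have F: "finite F" and cF: "y \<notin> F \<Longrightarrow> c y = \<zero>" and dF: "y \<notin> F \<Longrightarrow> d y = \<zero>" for y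
    using finite_chainsD[OF c] finite_chainsD[OF d] by (auto simp: F_def)
  note [simp] = finite_chainsD(1)[OF c] finite_chainsD(1)[OF d]
  have "chain_extend R T (\<lambda>y. c y \<oplus> d y) z = (\<Oplus>y\<in>F. [(poly_mapping.lookup (T y) z)] \<cdot> (c y \<oplus> d y))"
    by (rule chain_extend_eq_finsum) (simp_all add: F cF dF)
  also have "\<dots> = (\<Oplus>y\<in>F. [(poly_mapping.lookup (T y) z)] \<cdot> c y \<oplus> [(poly_mapping.lookup (T y) z)] \<cdot> d y)"
    by (intro finsum_cong') (simp_all add: add.int_pow_mult_distrib[OF a_comm] Pi_def)
  also have "\<dots> = (\<Oplus>y\<in>F. [(poly_mapping.lookup (T y) z)] \<cdot> c y) \<oplus> (\<Oplus>y\<in>F. [(poly_mapping.lookup (T y) z)] \<cdot> d y)"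
    by (rule finsum_addf) (simp_all add: Pi_def)
  also have "\<dots> = chain_extend R T c z \<oplus> chain_extend R T d z"
    using chain_extend_eq_finsum[of c F T z] chain_extend_eq_finsum[of d F T z] by (simp add: F cF dF)
  finally show ?thesis .
qed

lemma chain_extend_zero: "chain_extend R T (\<lambda>_. \<zero>) = (\<lambda>_. \<zero>)"
  by (simp add: chain_extend_def finsum_empty fun_eq_iff)

lemma chain_extend_minus:
  assumes c: "c \<in> finite_chains R"
  shows "chain_extend R T (\<lambda>y. \<ominus> c y) z = \<ominus> chain_extend R T c z"
proof -
  have "chain_extend R T (\<lambda>y. \<ominus> c y \<oplus> c y) z = \<zero>"
    using finite_chainsD(1)[OF c] by (simp add: l_neg chain_extend_zero)
  then have "chain_extend R T (\<lambda>y. \<ominus> c y) z \<oplus> chain_extend R T c z = \<zero>"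
    using chain_extend_add[OF finite_chains_minus[OF c] c, of T z] by simp
  then show ?thesis
    using finite_chainsD(1)[OF chain_extend_finite_chains[OF c]]
      finite_chainsD(1)[OF chain_extend_finite_chains[OF finite_chains_minus[OF c]]]
    by (metis minus_equality)
qed

lemma chain_extend_diff_op:
  assumes c: "c \<in> finite_chains R"
  shows "chain_extend R (\<lambda>y. T y - U y) c z = chain_extend R T c z \<ominus> chain_extend R U c z"
proof -
  let ?F = "{y. c y \<noteq> \<zero>}"
  have F: "finite ?F" and [simp]: "c y \<in> carrier R" for y using finite_chainsD[OF c] by auto
  have "chain_extend R (\<lambda>y. T y - U y) c z \<oplus> chain_extend R U c z =
      (\<Oplus>y\<in>?F. [(poly_mapping.lookup (T y - U y) z)] \<cdot> c y \<oplus> [(poly_mapping.lookup (U y) z)] \<cdot> c y)"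
    unfolding chain_extend_def by (rule finsum_addf[symmetric]) (simp_all add: Pi_def)
  also have "\<dots> = chain_extend R T c z"
    unfolding chain_extend_def
    by (intro finsum_cong') (simp_all add: Pi_def lookup_minus flip: add.int_pow_mult)
  finally have eq: "chain_extend R (\<lambda>y. T y - U y) c z \<oplus> chain_extend R U c z = chain_extend R T c z" .
  note [simp] = finite_chainsD(1)[OF chain_extend_finite_chains[OF c]]
  show ?thesis
    unfolding eq[symmetric] by (simp add: minus_eq a_assoc r_neg)
qed

text \<open>The composition rule for a single simplex with coefficient r, whose image under the
  inner operator is t.\<close>

lemma chain_extend_scaled:
  assumes r: "r \<in> carrier R"
  shows "chain_extend R T (\<lambda>w. [(poly_mapping.lookup t w)] \<cdot> r) z = [(poly_mapping.lookup (frag_extend T t) z)] \<cdot> r"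
proof -
  let ?F = "Poly_Mapping.keys t"
  have "chain_extend R T (\<lambda>w. [(poly_mapping.lookup t w)] \<cdot> r) z =
      (\<Oplus>w\<in>?F. [(poly_mapping.lookup (T w) z)] \<cdot> ([(poly_mapping.lookup t w)] \<cdot> r))"
    by (rule chain_extend_eq_finsum) (use r in \<open>auto simp: in_keys_iff\<close>)
  also have "\<dots> = (\<Oplus>w\<in>?F. [(poly_mapping.lookup t w * poly_mapping.lookup (T w) z)] \<cdot> r)"
    using r by (intro finsum_cong') (simp_all add: add.int_pow_pow Pi_def)
  also have "\<dots> = [(\<Sum>w\<in>?F. poly_mapping.lookup t w * poly_mapping.lookup (T w) z)] \<cdot> r"
    using r by (rule finsum_add_pow_int) simp
  finally show ?thesis
    by (simp add: frag_extend_def lookup_sum)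
qed

lemma chain_extend_comp:
  assumes c: "c \<in> finite_chains R"
  shows "chain_extend R T (chain_extend R U c) = chain_extend R (\<lambda>y. frag_extend T (U y)) c"
proof
  fix z
  note [simp] = finite_chainsD(1)[OF c]
  \<comment> \<open>The support is built up one simplex at a time. Membership in
    \<open>finite_chains\<close> is carried along because additivity of \<open>chain_extend\<close>
    requires it.\<close>
  have "(\<lambda>w. \<Oplus>y\<in>F. [(poly_mapping.lookup (U y) w)] \<cdot> c y) \<in> finite_chains R \<and>
      chain_extend R T (\<lambda>w. \<Oplus>y\<in>F. [(poly_mapping.lookup (U y) w)] \<cdot> c y) z =
      (\<Oplus>y\<in>F. [(poly_mapping.lookup (frag_extend T (U y)) z)] \<cdot> c y)" if "finite F" for F
    using that
  proof (induction F)
    case empty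
    then show ?case by (simp add: finsum_empty chain_extend_zero finite_chains_def)
  next
    case (insert y F)
    have "{w. [(poly_mapping.lookup (U y) w)] \<cdot> c y \<noteq> \<zero>} \<subseteq> Poly_Mapping.keys (U y)"
      by (auto simp: in_keys_iff)
    then have single: "(\<lambda>w. [(poly_mapping.lookup (U y) w)] \<cdot> c y) \<in> finite_chains R"
      using finite_subset[OF _ finite_keys] by (auto simp: finite_chains_def)
    have eq: "(\<lambda>w. \<Oplus>y\<in>insert y F. [(poly_mapping.lookup (U y) w)] \<cdot> c y) =
        (\<lambda>w. [(poly_mapping.lookup (U y) w)] \<cdot> c y \<oplus> (\<Oplus>y\<in>F. [(poly_mapping.lookup (U y) w)] \<cdot> c y))"
      using insert by (simp add: finsum_insert Pi_def)
    show ?case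
      using finite_chains_add[OF single conjunct1[OF insert.IH]]
        chain_extend_add[OF single conjunct1[OF insert.IH], of T z] conjunct2[OF insert.IH] insert.hyps
      by (simp add: eq chain_extend_scaled finsum_insert Pi_def)
  qed
  moreover have "chain_extend R U c = (\<lambda>w. \<Oplus>y\<in>{y. c y \<noteq> \<zero>}. [(poly_mapping.lookup (U y) w)] \<cdot> c y)"
    by (rule ext) (simp add: chain_extend_def)
  moreover note finite_chainsD(2)[OF c]
  ultimately
  show "chain_extend R T (chain_extend R U c) z = chain_extend R (\<lambda>y. frag_extend T (U y)) c z"
    by (simp add: chain_extend_def[of R "\<lambda>y. frag_extend T (U y)"])
qed

lemma chain_extend_frag_of:
  assumes c: "c \<in> finite_chains R"
  shows "chain_extend R frag_of c = c"
proof
  fix z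
  note [simp] = finite_chainsD(1)[OF c]
  have "chain_extend R frag_of c z = (\<Oplus>y\<in>insert z {y. c y \<noteq> \<zero>}. [(poly_mapping.lookup (frag_of y) z)] \<cdot> c y)"
    by (rule chain_extend_eq_finsum) (use finite_chainsD[OF c] in auto)
  also have "\<dots> = (\<Oplus>y\<in>insert z {y. c y \<noteq> \<zero>}. if z = y then c y else \<zero>)"
    by (intro finsum_cong') (auto simp: add.int_pow_1)
  also have "\<dots> = c z"
    by (rule finsum_singleton) (use finite_chainsD[OF c] in auto)
  finally show "chain_extend R frag_of c z = c z" .
qed

end

subsection \<open>Transfer of triviality\<close>

lemma carrier_chain_mon:
  "c \<in> carrier (chain_mon R Y k) \<longleftrightarrow> c \<in> finite_chains R \<and> (\<forall>y. c y \<noteq> \<zero>\<^bsub>R\<^esub> \<longrightarrow> y \<in> simplices Y k)"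
  by (auto simp: chain_mon_def finite_chains_def)

context cring
begin

lemma add_pow_minus_one_power:
  assumes r: "r \<in> carrier R"
  shows "[((-1) ^ i :: int)] \<cdot> r = (\<ominus> \<one>) [^] i \<otimes> r"
proof (induction i)
  case 0
  then show ?case using r by (simp add: add.int_pow_1)
next
  case (Suc i)
  have "[((-1) ^ Suc i :: int)] \<cdot> r = \<ominus> ([((-1) ^ i :: int)] \<cdot> r)"
    using r by (simp add: add.int_pow_neg)
  also have "\<dots> = \<ominus> ((\<ominus> \<one>) [^] i \<otimes> r)" by (simp only: Suc.IH)
  also have "\<dots> = (\<ominus> \<one>) [^] Suc i \<otimes> r"
    using r by (simp add: l_minus r_minus)
  finally show ?case .
qed

text \<open>Several faces of a simplex may coincide; the integral coefficient in
  \<open>list_bdry\<close> collects their signs just as the inner sum of \<open>bdry\<close>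
  does.\<close>

lemma bdry_list_sset:
  assumes c: "c \<in> carrier (chain_mon R (list_sset K) k)"
  shows "bdry R (list_sset K) k c = chain_extend R list_bdry c"
proof
  fix z
  have len: "length y = Suc k" if "c y \<noteq> \<zero>" for y
    using c that by (auto simp: carrier_chain_mon)
  have cR [simp]: "c y \<in> carrier R" for y
    using c by (auto simp: carrier_chain_mon finite_chainsD)
  have "(\<Oplus>i\<in>{..k}. if face_map (list_sset K) k i y = z then (\<ominus> \<one>) [^] i \<otimes> c y else \<zero>) =
      [(poly_mapping.lookup (list_bdry y) z)] \<cdot> c y" if y: "c y \<noteq> \<zero>" for y
  proof -
    have "(\<Oplus>i\<in>{..k}. if face_map (list_sset K) k i y = z then (\<ominus> \<one>) [^] i \<otimes> c y else \<zero>) =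
       (\<Oplus>i\<in>{..k}. [((-1) ^ i * (if take i y @ drop (Suc i) y = z then 1 else 0) :: int)] \<cdot> c y)"
      by (intro finsum_cong') (auto simp: add_pow_minus_one_power)
    also have "\<dots> = [(\<Sum>i\<le>k. (-1) ^ i * (if take i y @ drop (Suc i) y = z then 1 else 0) :: int)] \<cdot> c y"
      by (rule finsum_add_pow_int) simp_all
    also have "(\<Sum>i\<le>k. (-1) ^ i * (if take i y @ drop (Suc i) y = z then 1 else 0) :: int) =
        poly_mapping.lookup (list_bdry y) z"
      unfolding list_bdry_def lookup_sum len[OF y] lessThan_Suc_atMost
      by (intro sum.cong) auto
    finally show ?thesis .
  qed
  then show "bdry R (list_sset K) k c z = chain_extend R list_bdry c z"
    unfolding bdry_def chain_extend_def by (intro finsum_cong') auto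
qed

lemma chain_extend_cong:
  assumes "c \<in> finite_chains R" and "\<And>y. c y \<noteq> \<zero> \<Longrightarrow> T y = U y"
  shows "chain_extend R T c = chain_extend R U c"
  unfolding chain_extend_def
  using assms finite_chainsD(1)[OF assms(1)] by (intro ext finsum_cong') auto

text \<open>In degree 0 the only face is the empty list, so the whole boundary is concentrated
  there, with the sum of all values as coefficient.\<close>

lemma augmentation_list_sset:
  assumes c: "c \<in> carrier (chain_mon R (list_sset K) 0)"
  shows "chain_extend R list_bdry c = (\<lambda>z. if z = [] then augmentation R c else \<zero>)"
proof
  fix z
  have fin: "c \<in> finite_chains R" using c by (simp add: carrier_chain_mon)
  have "list_bdry y = frag_of []" if "c y \<noteq> \<zero>" for y
    using c that by (auto simp: carrier_chain_mon length_Suc_conv)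
  then have "chain_extend R list_bdry c z = chain_extend R (\<lambda>_. frag_of []) c z"
    using chain_extend_cong[OF fin] by metis
  also have "\<dots> = (\<Oplus>y\<in>{y. c y \<noteq> \<zero>}. if z = [] then c y else \<zero>)"
    unfolding chain_extend_def using finite_chainsD(1)[OF fin]
    by (intro finsum_cong') (auto simp: add.int_pow_1)
  also have "\<dots> = (if z = [] then augmentation R c else \<zero>)"
    by (simp add: augmentation_def finsum_zero)
  finally show "chain_extend R list_bdry c z = (if z = [] then augmentation R c else \<zero>)" .
qed

text \<open>Admitting the empty list in dimension -1 turns the augmentation condition of degree 0
  into the boundary condition of the other degrees.\<close>

lemma reduced_cycles_list_sset:
  "c \<in> reduced_cycles R (list_sset K) k \<longleftrightarrow>
     c \<in> carrier (chain_mon R (list_sset K) k) \<and> chain_extend R list_bdry c = (\<lambda>_. \<zero>)"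
proof (cases "c \<in> carrier (chain_mon R (list_sset K) k)")
  case c: True
  show ?thesis
  proof (cases "k = 0")
    case True
    have "c \<in> reduced_cycles R (list_sset K) k \<longleftrightarrow> augmentation R c = \<zero>"
      using c True by (simp add: reduced_cycles_def)
    also have "\<dots> \<longleftrightarrow> chain_extend R list_bdry c = (\<lambda>_. \<zero>)"
      using augmentation_list_sset[of c K] c True by (auto simp: fun_eq_iff)
    finally show ?thesis using c by simp
  next
    case False
    then show ?thesis
      using c by (simp add: reduced_cycles_def bdry_list_sset)
  qed
qed (simp add: reduced_cycles_def)

lemma boundaries_list_sset:
  "boundaries R (list_sset K) k =
     chain_extend R list_bdry ` carrier (chain_mon R (list_sset K) (Suc k))"
  unfolding boundaries_def by (rule image_cong) (simp_all add: bdry_list_sset)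

lemma boundaries_finite_chains:
  "b \<in> boundaries R (list_sset K) k \<Longrightarrow> b \<in> finite_chains R"
  by (auto simp: boundaries_list_sset carrier_chain_mon intro: chain_extend_finite_chains)

lemma zero_in_boundaries: "(\<lambda>_. \<zero>) \<in> boundaries R (list_sset K) k"
  unfolding boundaries_list_sset
  by (rule image_eqI[of _ _ "\<lambda>_. \<zero>"])
    (simp_all add: chain_extend_zero carrier_chain_mon finite_chains_def)

lemma carrier_chain_mon_add:
  assumes c: "c \<in> carrier (chain_mon R Y k)" and d: "d \<in> carrier (chain_mon R Y k)"
  shows "(\<lambda>y. c y \<oplus> d y) \<in> carrier (chain_mon R Y k)"
proof -
  have "c y \<noteq> \<zero> \<or> d y \<noteq> \<zero>" if "c y \<oplus> d y \<noteq> \<zero>" for y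
    using that by auto
  then show ?thesis using c d finite_chains_add[of c d] unfolding carrier_chain_mon by blast
qed

lemma carrier_chain_mon_minus:
  assumes c: "c \<in> carrier (chain_mon R Y k)"
  shows "(\<lambda>y. \<ominus> c y) \<in> carrier (chain_mon R Y k)"
proof -
  have "c y \<noteq> \<zero>" if "\<ominus> c y \<noteq> \<zero>" for y
    using that by auto
  then show ?thesis using c finite_chains_minus[of c] unfolding carrier_chain_mon by blast
qed

lemma boundaries_add:
  assumes "b \<in> boundaries R (list_sset K) k" "d \<in> boundaries R (list_sset K) k"
  shows "(\<lambda>y. b y \<oplus> d y) \<in> boundaries R (list_sset K) k"
proof -
  from assms obtain u v where u: "u \<in> carrier (chain_mon R (list_sset K) (Suc k))"
    and v: "v \<in> carrier (chain_mon R (list_sset K) (Suc k))"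
    and eq: "b = chain_extend R list_bdry u" "d = chain_extend R list_bdry v"
    by (auto simp: boundaries_list_sset)
  have "(\<lambda>y. b y \<oplus> d y) = chain_extend R list_bdry (\<lambda>y. u y \<oplus> v y)"
    using u v by (intro ext) (simp add: eq chain_extend_add carrier_chain_mon)
  with carrier_chain_mon_add[OF u v] show ?thesis
    unfolding boundaries_list_sset by blast
qed

lemma boundaries_minus:
  assumes "b \<in> boundaries R (list_sset K) k"
  shows "(\<lambda>y. \<ominus> b y) \<in> boundaries R (list_sset K) k"
proof -
  from assms obtain u where u: "u \<in> carrier (chain_mon R (list_sset K) (Suc k))"
    and eq: "b = chain_extend R list_bdry u"
    by (auto simp: boundaries_list_sset)
  have "(\<lambda>y. \<ominus> b y) = chain_extend R list_bdry (\<lambda>y. \<ominus> u y)"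
    using u by (intro ext) (simp add: eq chain_extend_minus carrier_chain_mon)
  with carrier_chain_mon_minus[OF u] show ?thesis
    unfolding boundaries_list_sset by blast
qed

lemma carrier_chain_mon_mono:
  assumes "K \<subseteq> L" "c \<in> carrier (chain_mon R (list_sset K) k)"
  shows "c \<in> carrier (chain_mon R (list_sset L) k)"
  using assms by (auto simp: carrier_chain_mon)

lemma boundaries_mono:
  assumes "K \<subseteq> L"
  shows "boundaries R (list_sset K) k \<subseteq> boundaries R (list_sset L) k"
  unfolding boundaries_list_sset using carrier_chain_mon_mono[OF assms] by (intro image_mono) blast

text \<open>Classes are cosets, and a cycle is killed exactly when its coset is absorbed by the
  boundaries of L. The reverse direction has to supply more than vanishing, since
  \<open>trivial_homomorphism\<close> also asks for a homomorphism.\<close>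

lemma homology_incl_trivial_iff:
  assumes KL: "K \<subseteq> L"
  shows "homology_incl_trivial R k (list_sset K) (list_sset L) \<longleftrightarrow>
    reduced_cycles R (list_sset K) k \<subseteq> boundaries R (list_sset L) k"
proof -
  let ?ZK = "reduced_cycles R (list_sset K) k" and ?BK = "boundaries R (list_sset K) k"
  let ?BL = "boundaries R (list_sset L) k"
  define Q where "Q z = (\<Union>b\<in>?BK. {\<lambda>y. b y \<oplus> z y})" for z
  have carrier: "carrier (reduced_homology R k (list_sset K)) = Q ` ?ZK"
    by (simp add: reduced_homology_def carrier_FactGroup r_coset_def Q_def chain_mon_def)
  have one: "\<one>\<^bsub>reduced_homology R k (list_sset L)\<^esub> = ?BL"
    by (simp add: reduced_homology_def)
  have incl: "homology_incl R k (list_sset L) c = (\<Union>b\<in>?BL. \<Union>d\<in>c. {\<lambda>y. b y \<oplus> d y})" for c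
    by (simp add: homology_incl_def set_mult_def chain_mon_def)
  have memQ: "d \<in> Q z \<longleftrightarrow> (\<exists>b\<in>?BK. d = (\<lambda>y. b y \<oplus> z y))" for d z
    by (auto simp: Q_def)
  have R: "b y \<in> carrier R" if "b \<in> ?BL" for b y
    using finite_chainsD(1)[OF boundaries_finite_chains[OF that]] .
  \<comment> \<open>Boundaries form a subgroup, and adding to it any nonempty subset of it gives it
    back. This serves for single cosets, for products of cosets and for the square of the neutral
    element.\<close>
  have absorb: "(\<Union>b\<in>?BL. \<Union>d\<in>D. {\<lambda>y. b y \<oplus> d y}) = ?BL"
    if D: "D \<subseteq> ?BL" and d: "d \<in> D" for D d
  proof
    show "(\<Union>b\<in>?BL. \<Union>d\<in>D. {\<lambda>y. b y \<oplus> d y}) \<subseteq> ?BL"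
    proof (intro UN_least)
      fix b d assume "b \<in> ?BL" "d \<in> D"
      then have "b \<in> ?BL" "d \<in> ?BL" using D by auto
      from boundaries_add[OF this] show "{\<lambda>y. b y \<oplus> d y} \<subseteq> ?BL" by simp
    qed
    show "?BL \<subseteq> (\<Union>b\<in>?BL. \<Union>d\<in>D. {\<lambda>y. b y \<oplus> d y})"
    proof
      fix b assume b: "b \<in> ?BL"
      have dB: "d \<in> ?BL" using D d by blast
      have "(\<lambda>y. b y \<oplus> \<ominus> d y) \<in> ?BL"
        using boundaries_add[OF b boundaries_minus[OF dB]] .
      moreover have "b = (\<lambda>y. (b y \<oplus> \<ominus> d y) \<oplus> d y)"
        using R[OF b] R[OF dB] by (intro ext) (simp add: a_assoc l_neg)
      ultimately show "b \<in> (\<Union>b\<in>?BL. \<Union>d\<in>D. {\<lambda>y. b y \<oplus> d y})"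
        using d by (intro UN_I[of "\<lambda>y. b y \<oplus> \<ominus> d y"] UN_I[of d]) simp_all
    qed
  qed
  show ?thesis
  proof
    assume triv: "homology_incl_trivial R k (list_sset K) (list_sset L)"
    show "?ZK \<subseteq> ?BL"
    proof
      fix z assume z: "z \<in> ?ZK"
      then have zR: "z y \<in> carrier R" for y
        by (auto simp: reduced_cycles_list_sset carrier_chain_mon finite_chainsD)
      have "homology_incl R k (list_sset L) (Q z) = ?BL"
        using triv z carrier one
        by (simp add: homology_incl_trivial_def trivial_homomorphism_def)
      moreover have "(\<lambda>y. \<zero> \<oplus> (\<zero> \<oplus> z y)) \<in> homology_incl R k (list_sset L) (Q z)"
        unfolding incl
      proof (intro UN_I)
        show "(\<lambda>_. \<zero>) \<in> ?BL" by (rule zero_in_boundaries)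
        show "(\<lambda>y. \<zero> \<oplus> z y) \<in> Q z"
          unfolding memQ by (rule bexI[OF _ zero_in_boundaries]) simp
      qed simp
      ultimately show "z \<in> ?BL" using zR by simp
    qed
  next
    assume ZB: "?ZK \<subseteq> ?BL"
    have "homology_incl R k (list_sset L) (Q z) = ?BL" if "z \<in> ?ZK" for z
      unfolding incl
    proof (rule absorb)
      have "z \<in> ?BL" using ZB that by blast
      then show "Q z \<subseteq> ?BL"
        using boundaries_mono[OF KL] boundaries_add unfolding Q_def by blast
      show "(\<lambda>y. \<zero> \<oplus> z y) \<in> Q z"
        unfolding memQ by (rule bexI[OF _ zero_in_boundaries]) simp
    qed
    then have triv: "\<forall>x\<in>carrier (reduced_homology R k (list_sset K)).
        homology_incl R k (list_sset L) x = \<one>\<^bsub>reduced_homology R k (list_sset L)\<^esub>"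
      by (simp add: carrier one)
    have zero_cycle: "(\<lambda>_. \<zero>) \<in> reduced_cycles R (list_sset L) k"
      by (simp add: reduced_cycles_list_sset carrier_chain_mon finite_chains_def chain_extend_zero)
    have "?BL = (\<Union>b\<in>?BL. {\<lambda>y. b y \<oplus> \<zero>})"
      using R by auto
    then have BL: "?BL \<in> carrier (reduced_homology R k (list_sset L))"
      using zero_cycle by (auto simp: reduced_homology_def carrier_FactGroup r_coset_def chain_mon_def)
    have QB: "Q z \<subseteq> ?BL" if "z \<in> ?ZK" for z
    proof
      fix d assume "d \<in> Q z"
      then obtain b where b: "b \<in> ?BK" and d: "d = (\<lambda>y. b y \<oplus> z y)" unfolding memQ by (elim bexE)
      have "b \<in> ?BL" using b boundaries_mono[OF KL] by (rule subsetD[rotated])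
      then show "d \<in> ?BL" unfolding d using subsetD[OF ZB that] by (rule boundaries_add)
    qed
    have Q0: "(\<lambda>y. \<zero> \<oplus> z y) \<in> Q z" for z
      unfolding memQ by (rule bexI[OF _ zero_in_boundaries]) simp
    have mult_K: "x \<otimes>\<^bsub>reduced_homology R k (list_sset K)\<^esub> y = (\<Union>b\<in>x. \<Union>d\<in>y. {\<lambda>w. b w \<oplus> d w})"
      and mult_L: "x \<otimes>\<^bsub>reduced_homology R k (list_sset L)\<^esub> y = (\<Union>b\<in>x. \<Union>d\<in>y. {\<lambda>w. b w \<oplus> d w})"
      for x y
      by (simp_all add: reduced_homology_def set_mult_def chain_mon_def)
    have "homology_incl R k (list_sset L) (Q z \<otimes>\<^bsub>reduced_homology R k (list_sset K)\<^esub> Q z') = ?BL"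
      if "z \<in> ?ZK" "z' \<in> ?ZK" for z z'
      unfolding incl
    proof (rule absorb)
      show "(\<lambda>w. (\<zero> \<oplus> z w) \<oplus> (\<zero> \<oplus> z' w)) \<in> Q z \<otimes>\<^bsub>reduced_homology R k (list_sset K)\<^esub> Q z'"
        unfolding mult_K by (rule UN_I[OF Q0], rule UN_I[OF Q0]) simp
      show "Q z \<otimes>\<^bsub>reduced_homology R k (list_sset K)\<^esub> Q z' \<subseteq> ?BL"
        unfolding mult_K
      proof (intro UN_least)
        fix b d assume "b \<in> Q z" "d \<in> Q z'"
        then have "b \<in> ?BL" "d \<in> ?BL" using QB that by auto
        then show "{\<lambda>w. b w \<oplus> d w} \<subseteq> ?BL" using boundaries_add by simp
      qed
    qed
    moreover have "?BL \<otimes>\<^bsub>reduced_homology R k (list_sset L)\<^esub> ?BL = ?BL"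
      unfolding mult_L using order.refl zero_in_boundaries by (rule absorb)
    ultimately have "homology_incl R k (list_sset L) \<in>
        hom (reduced_homology R k (list_sset K)) (reduced_homology R k (list_sset L))"
      using triv BL unfolding hom_def by (auto simp: carrier one)
    with triv show "homology_incl_trivial R k (list_sset K) (list_sset L)"
      by (simp add: homology_incl_trivial_def trivial_homomorphism_def)
  qed
qed

lemma chain_extend_carrier:
  assumes c: "c \<in> carrier (chain_mon R (list_sset K) k)"
    and T: "\<And>xs ys. set xs \<in> K \<Longrightarrow> length xs = Suc k \<Longrightarrow> ys \<in> Poly_Mapping.keys (T xs) \<Longrightarrow>
      set ys \<in> L \<and> length ys = Suc l"
  shows "chain_extend R T c \<in> carrier (chain_mon R (list_sset L) l)"
  unfolding carrier_chain_mon
proof (intro conjI allI impI)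
  have fin: "c \<in> finite_chains R" using c by (simp add: carrier_chain_mon)
  then show "chain_extend R T c \<in> finite_chains R" by (rule chain_extend_finite_chains)
  fix ys assume "chain_extend R T c ys \<noteq> \<zero>"
  with fin obtain xs where xs: "c xs \<noteq> \<zero>" "ys \<in> Poly_Mapping.keys (T xs)"
    by (rule chain_extend_support)
  with c have "set xs \<in> K" "length xs = Suc k" by (auto simp: carrier_chain_mon)
  from T[OF this xs(2)] show "ys \<in> simplices (list_sset L) l" by simp
qed

text \<open>Let z be a cycle over K, let w bound its image under a, and let P be the prism operator.
  As z has no boundary, the boundary of P z is the image of z under b after a, minus z; hence b w -
  P z bounds z.\<close>

lemma homology_incl_trivial_transfer:
  assumes K': "downset K'"
    and a: "contiguous K L a a" and LL': "L \<subseteq> L'" and b: "contiguous L' K' b b"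
    and ba: "contiguous K K' (\<lambda>x. x) (\<lambda>x. b (a x))"
    and triv: "homology_incl_trivial R k (list_sset L) (list_sset L')"
  shows "homology_incl_trivial R k (list_sset K) (list_sset K')"
proof -
  have KK': "K \<subseteq> K'"
  proof
    fix A assume "A \<in> K"
    then have "A \<union> (\<lambda>x. b (a x)) ` A \<in> K'" using ba by (simp add: contiguous_def)
    then show "A \<in> K'" by (rule downsetD[OF K']) simp
  qed
  let ?c = "\<lambda>x. b (a x)"
  let ?d = "chain_extend R list_bdry"
  have comm: "?d (chain_extend R (frag_of \<circ> map f) u) = chain_extend R (frag_of \<circ> map f) (?d u)"
    if "u \<in> finite_chains R" for u :: "'y list \<Rightarrow> 'a" and f :: "'y \<Rightarrow> 'z"
    using that by (simp add: chain_extend_comp list_bdry_map frag_map_def)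
  have map_carrier: "chain_extend R (frag_of \<circ> map f) u \<in> carrier (chain_mon R (list_sset N) l)"
    if "u \<in> carrier (chain_mon R (list_sset M) l)" and f: "contiguous M N f f"
    for u :: "'y list \<Rightarrow> 'a" and f :: "'y \<Rightarrow> 'z" and M N l
    using that(1) by (rule chain_extend_carrier) (use f in \<open>auto simp: contiguous_def keys_frag_of\<close>)
  have "reduced_cycles R (list_sset K) k \<subseteq> boundaries R (list_sset K') k"
  proof
    fix z assume z: "z \<in> reduced_cycles R (list_sset K) k"
    then have zc: "z \<in> carrier (chain_mon R (list_sset K) k)" and dz: "?d z = (\<lambda>_. \<zero>)"
      by (simp_all add: reduced_cycles_list_sset)
    then have fin: "z \<in> finite_chains R" by (simp add: carrier_chain_mon)
    let ?az = "chain_extend R (frag_of \<circ> map a) z"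
    have "?d ?az = (\<lambda>_. \<zero>)"
      using comm[OF fin, of a] by (simp add: dz chain_extend_zero)
    then have "?az \<in> reduced_cycles R (list_sset L) k"
      using map_carrier[OF zc a] by (simp add: reduced_cycles_list_sset)
    then have "?az \<in> boundaries R (list_sset L') k"
      using triv homology_incl_trivial_iff[OF LL'] by blast
    then obtain w where w: "w \<in> carrier (chain_mon R (list_sset L') (Suc k))" and az: "?az = ?d w"
      by (auto simp: boundaries_list_sset)
    have finw: "w \<in> finite_chains R" using w by (simp add: carrier_chain_mon)
    let ?bw = "chain_extend R (frag_of \<circ> map b) w" and ?hz = "chain_extend R (prism ?c) z"
    have bw: "?bw \<in> carrier (chain_mon R (list_sset K') (Suc k))"
      using w b by (rule map_carrier)
    have hz: "?hz \<in> carrier (chain_mon R (list_sset K') (Suc k))"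
      using zc
    proof (rule chain_extend_carrier)
      fix xs ys assume xs: "set xs \<in> K" "length xs = Suc k" and ys: "ys \<in> Poly_Mapping.keys (prism ?c xs)"
      from keys_prism[OF ys] have len: "length ys = Suc (Suc k)" and sub: "set ys \<subseteq> set xs \<union> ?c ` set xs"
        using xs by auto
      have "set xs \<union> ?c ` set xs \<in> K'" using ba xs(1) by (simp add: contiguous_def)
      from downsetD[OF K' this sub] len show "set ys \<in> K' \<and> length ys = Suc (Suc k)" by simp
    qed
    have dbw: "?d ?bw = chain_extend R (frag_of \<circ> map ?c) z"
      using comm[OF finw, of b] fin
      by (simp add: az[symmetric] chain_extend_comp o_def)
    have hz_eq: "?d ?hz = chain_extend R (\<lambda>xs. (frag_of (map ?c xs) - frag_of xs) - frag_extend (prism ?c) (list_bdry xs)) z"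
      unfolding chain_extend_comp[OF fin] prism_homotopy[symmetric] by simp
    have "?d ?hz y = (chain_extend R (frag_of \<circ> map ?c) z y \<ominus> z y) \<ominus> chain_extend R (prism ?c) (?d z) y" for y
      unfolding hz_eq using fin
      by (simp add: chain_extend_diff_op chain_extend_comp chain_extend_frag_of o_def)
    then have dhz: "?d ?hz y = (?d ?bw y \<ominus> z y) \<ominus> \<zero>" for y
      by (simp add: dz chain_extend_zero dbw)
    have R: "z y \<in> carrier R" "?d ?bw y \<in> carrier R" for y
      using finite_chainsD(1)[OF fin] finite_chainsD(1)[OF chain_extend_finite_chains, of ?bw] bw
      by (simp_all add: carrier_chain_mon)
    have "z = ?d (\<lambda>y. ?bw y \<oplus> \<ominus> ?hz y)"
    proof
      fix y
      have "?d (\<lambda>y. ?bw y \<oplus> \<ominus> ?hz y) y = ?d ?bw y \<oplus> \<ominus> ?d ?hz y"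
        using bw hz
        by (simp add: chain_extend_add chain_extend_minus finite_chains_minus carrier_chain_mon)
      also have "\<dots> = z y"
        using R[of y] unfolding dhz by (simp add: minus_eq minus_add r_neg2)
      finally show "z y = ?d (\<lambda>y. ?bw y \<oplus> \<ominus> ?hz y) y" by simp
    qed
    then show "z \<in> boundaries R (list_sset K') k"
      unfolding boundaries_list_sset using carrier_chain_mon_add[OF bw carrier_chain_mon_minus[OF hz]]
      by (rule image_eqI)
  qed
  then show ?thesis
    using homology_incl_trivial_iff[OF KK'] by simp
qed

end

text \<open>The composite \<open>K \<rightarrow> L \<subseteq> L' \<rightarrow> K'\<close> is contiguous to the inclusion, so triviality of \<open>L \<subseteq> L'\<close> on a
  homotopy or homology group implies that of \<open>K \<subseteq> K'\<close>.\<close>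

definition transfer_maps ::
    "'x set set \<Rightarrow> 'y set set \<Rightarrow> 'y set set \<Rightarrow> 'x set set \<Rightarrow> ('x \<Rightarrow> 'y) \<Rightarrow> ('y \<Rightarrow> 'x) \<Rightarrow> bool" where
  "transfer_maps K L L' K' a b \<longleftrightarrow> downset K \<and> downset L \<and> downset L' \<and> downset K' \<and>
     contiguous K L a a \<and> L \<subseteq> L' \<and> contiguous L' K' b b \<and>
     contiguous K K' (\<lambda>x. x) (\<lambda>x. b (a x))"

lemma homotopy_incl_trivial_transfer_maps:
  assumes "transfer_maps K L L' K' a b" "{v} \<in> K" "b (a v) = v"
    and "homotopy_incl_trivial k (list_sset L) (list_sset L') [a v]"
  shows "homotopy_incl_trivial k (list_sset K) (list_sset K') [v]"
  using assms unfolding transfer_maps_def by (elim conjE) (rule homotopy_incl_trivial_transfer)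

lemma homology_incl_trivial_transfer_maps:
  assumes "cring R" "transfer_maps K L L' K' a b"
    and "homology_incl_trivial R k (list_sset L) (list_sset L')"
  shows "homology_incl_trivial R k (list_sset K) (list_sset K')"
  using assms unfolding transfer_maps_def by (elim conjE) (rule cring.homology_incl_trivial_transfer)

section \<open>Quotient homomorphisms with compact kernel\<close>

text \<open>A tuple lies in the filtration member for C precisely if its entries form such a set,
  which is why the members have the form \<open>list_sset\<close>.\<close>

definition translates :: "'a top_group \<Rightarrow> ('a \<Rightarrow> real) \<Rightarrow> 'a set \<Rightarrow> 'a set set" where
  "translates G \<xi> C = {A. \<exists>g\<in>carrier G. 0 \<le> \<xi> g \<and> A \<subseteq> (\<lambda>x. g \<otimes>\<^bsub>G\<^esub> x) ` C}"

lemma downset_translates: "downset (translates G \<xi> C)"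
  unfolding downset_def translates_def by blast

lemma char_filtration_eq:
  "char_filtration G \<xi> C k = {xs. length xs = Suc k \<and> set xs \<in> translates G \<xi> C}"
proof -
  have "map f ` simplices (E_sset C) k = {xs. length xs = Suc k \<and> set xs \<subseteq> f ` C}" for f :: "'a \<Rightarrow> 'a"
  proof -
    have "{xs. set xs \<subseteq> f ` C} = map f ` {xs. set xs \<subseteq> C}"
      using lists_image[of f C] by (simp add: lists_eq_set)
    then have "set xs \<subseteq> f ` C \<longleftrightarrow> xs \<in> map f ` {xs. set xs \<subseteq> C}" for xs by blast
    then show ?thesis by (auto simp: E_sset_def)
  qed
  then show ?thesis by (auto simp: char_filtration_def translates_def)
qed

text \<open>The structure maps of \<open>E_sset\<close> do not depend on the underlying set, so this
  is an equality and not merely an isomorphism.\<close>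

lemma restrict_char_filtration:
  "restrict_sset (E_sset X) (char_filtration G \<xi> C) = list_sset (translates G \<xi> C)"
  by (simp add: list_sset_def E_sset_def char_filtration_eq fun_eq_iff)

text \<open>What the comparison of the two groups uses about \<open>completion_map\<close>. A
  compact kernel is the singleton case of \<open>compact_preimage\<close>; the general form makes
  preimages of compact sets available as indices of the filtration of G.\<close>

locale proper_epimorphism =
  fixes G :: "'a top_group" and S :: "'b top_group" and f :: "'a \<Rightarrow> 'b"
  assumes group_G: "group G" and group_S: "group S" and hom: "f \<in> hom G S"
    and topspace_G: "topspace (opens G) = carrier G"
    and topspace_S: "topspace (opens S) = carrier S"
    and quotient: "quotient_map (opens G) (opens S) f"
    and compact_preimage: "compactin (opens S) D \<Longrightarrow> compactin (opens G) {g \<in> carrier G. f g \<in> D}"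
begin

interpretation G: group G by (rule group_G)
interpretation S: group S by (rule group_S)
interpretation f: group_hom G S f
  using hom by unfold_locales

lemma image_eq: "f ` carrier G = carrier S"
  using quotient by (simp add: quotient_map_def topspace_G topspace_S)

lemma continuous: "continuous_map (opens G) (opens S) f"
  using quotient by (rule quotient_imp_continuous_map)

definition is_section :: "('b \<Rightarrow> 'a) \<Rightarrow> bool" where
  "is_section s \<longleftrightarrow> (\<forall>x\<in>carrier S. s x \<in> carrier G \<and> f (s x) = x)"

lemma is_sectionD: "is_section s \<Longrightarrow> x \<in> carrier S \<Longrightarrow> s x \<in> carrier G"
  "is_section s \<Longrightarrow> x \<in> carrier S \<Longrightarrow> f (s x) = x"
  by (auto simp: is_section_def)

text \<open>The value at f g is prescribed so that s after f fixes the base vertex g; elsewhere any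
  preimage will do.\<close>

lemma section_exists:
  assumes g: "g \<in> carrier G"
  obtains s where "is_section s" "s (f g) = g"
proof
  let ?s = "\<lambda>x. if x = f g then g else inv_into (carrier G) f x"
  show "is_section ?s"
    unfolding is_section_def using g image_eq
    by (auto simp: inv_into_into f_inv_into_f)
qed simp

section \<open>Contiguity of the vertex maps between families of translates\<close>

definition is_pullback :: "('a \<Rightarrow> real) \<Rightarrow> ('b \<Rightarrow> real) \<Rightarrow> bool" where
  "is_pullback \<xi> \<psi> \<longleftrightarrow> (\<forall>g\<in>carrier G. \<xi> g = \<psi> (f g))"

lemma is_pullbackD: "is_pullback \<xi> \<psi> \<Longrightarrow> g \<in> carrier G \<Longrightarrow> \<xi> g = \<psi> (f g)"
  by (simp add: is_pullback_def)

lemma contiguous_epi: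
  assumes \<xi>: "is_pullback \<xi> \<psi>" and C: "C \<subseteq> carrier G" and "f ` C \<subseteq> D"
  shows "contiguous (translates G \<xi> C) (translates S \<psi> D) f f"
  unfolding contiguous_def
proof
  fix A assume "A \<in> translates G \<xi> C"
  then obtain g where g: "g \<in> carrier G" "0 \<le> \<xi> g" and A: "A \<subseteq> (\<lambda>x. g \<otimes>\<^bsub>G\<^esub> x) ` C"
    by (auto simp: translates_def)
  have "f ` A \<subseteq> (\<lambda>x. f g \<otimes>\<^bsub>S\<^esub> x) ` D"
  proof
    fix y assume "y \<in> f ` A"
    then obtain c where c: "c \<in> C" "y = f (g \<otimes>\<^bsub>G\<^esub> c)" using A by auto
    moreover have "c \<in> carrier G" using c C by blast
    ultimately have "y = f g \<otimes>\<^bsub>S\<^esub> f c" using g by simp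
    moreover have "f c \<in> D" using c assms by blast
    ultimately show "y \<in> (\<lambda>x. f g \<otimes>\<^bsub>S\<^esub> x) ` D" by (rule image_eqI)
  qed
  moreover have "f g \<in> carrier S" "0 \<le> \<psi> (f g)" using g is_pullbackD[OF \<xi>] by auto
  ultimately show "f ` A \<union> f ` A \<in> translates S \<psi> D"
    by (auto simp: translates_def)
qed

text \<open>The product of the inverse of g with x maps to d and hence lies in the preimage of D.
  Only the image of x under f matters, and this is what replaces multiplicativity of a
  section.\<close>

lemma translate_mem:
  assumes g: "g \<in> carrier G" and d: "d \<in> D" "d \<in> carrier S"
    and C: "{g \<in> carrier G. f g \<in> D} \<subseteq> C" and x: "x \<in> carrier G" "f x = f g \<otimes>\<^bsub>S\<^esub> d"
  shows "x \<in> (\<lambda>x. g \<otimes>\<^bsub>G\<^esub> x) ` C"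
proof (rule image_eqI)
  show "x = g \<otimes>\<^bsub>G\<^esub> (inv\<^bsub>G\<^esub> g \<otimes>\<^bsub>G\<^esub> x)"
    using g x by (simp add: G.m_assoc[symmetric])
  have "f (inv\<^bsub>G\<^esub> g \<otimes>\<^bsub>G\<^esub> x) = d"
    using g x d by (simp add: S.m_assoc[symmetric])
  then show "inv\<^bsub>G\<^esub> g \<otimes>\<^bsub>G\<^esub> x \<in> C"
    using C d g x by (intro subsetD[OF C]) simp
qed

text \<open>The element x = s (h d) satisfies f x = f (s h) d, so \<open>translate_mem\<close>
  applies with s h in place of g; h and s h have the same character value.\<close>

lemma contiguous_section:
  assumes s: "is_section s" and \<xi>: "is_pullback \<xi> \<psi>" and D: "D \<subseteq> carrier S"
    and C: "{g \<in> carrier G. f g \<in> D} \<subseteq> C"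
  shows "contiguous (translates S \<psi> D) (translates G \<xi> C) s s"
  unfolding contiguous_def
proof
  fix A assume "A \<in> translates S \<psi> D"
  then obtain h where h: "h \<in> carrier S" "0 \<le> \<psi> h" and A: "A \<subseteq> (\<lambda>x. h \<otimes>\<^bsub>S\<^esub> x) ` D"
    by (auto simp: translates_def)
  note sh = is_sectionD[OF s h(1)]
  have "s ` A \<subseteq> (\<lambda>x. s h \<otimes>\<^bsub>G\<^esub> x) ` C"
  proof
    fix y assume "y \<in> s ` A"
    then obtain d where d: "d \<in> D" "y = s (h \<otimes>\<^bsub>S\<^esub> d)" using A by auto
    then have d': "d \<in> carrier S" using D by blast
    show "y \<in> (\<lambda>x. s h \<otimes>\<^bsub>G\<^esub> x) ` C"
      using sh(1) d(1) d' C
      by (rule translate_mem) (use d d' h sh is_sectionD[OF s, of "h \<otimes>\<^bsub>S\<^esub> d"] in simp_all)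
  qed
  moreover have "0 \<le> \<xi> (s h)" using h sh is_pullbackD[OF \<xi>] by simp
  ultimately show "s ` A \<union> s ` A \<in> translates G \<xi> C"
    using sh by (auto simp: translates_def)
qed

text \<open>For x = g c both x and s (f x) have image f g times f c, so \<open>translate_mem\<close>
  puts both into the same translate of C'.\<close>

lemma contiguous_section_epi:
  assumes s: "is_section s" and \<xi>: "is_pullback \<xi> \<psi>"
    and C: "C \<subseteq> carrier G" "f ` C \<subseteq> D" and D: "D \<subseteq> carrier S" and C': "{g \<in> carrier G. f g \<in> D} \<subseteq> C'"
  shows "contiguous (translates G \<xi> C) (translates G \<xi> C') (\<lambda>x. x) (\<lambda>x. s (f x))"
  unfolding contiguous_def
proof
  fix A assume "A \<in> translates G \<xi> C"
  then obtain g where g: "g \<in> carrier G" "0 \<le> \<xi> g" and A: "A \<subseteq> (\<lambda>x. g \<otimes>\<^bsub>G\<^esub> x) ` C"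
    by (auto simp: translates_def)
  have "x \<in> (\<lambda>x. g \<otimes>\<^bsub>G\<^esub> x) ` C' \<and> s (f x) \<in> (\<lambda>x. g \<otimes>\<^bsub>G\<^esub> x) ` C'" if x: "x \<in> A" for x
  proof -
    obtain c where c: "c \<in> C" "x = g \<otimes>\<^bsub>G\<^esub> c" using subsetD[OF A x] by (elim imageE)
    then have cG: "c \<in> carrier G" "f c \<in> D" using C by blast+
    have fx: "f x = f g \<otimes>\<^bsub>S\<^esub> f c" using c cG g by simp
    have "x \<in> (\<lambda>x. g \<otimes>\<^bsub>G\<^esub> x) ` C'"
      using g(1) cG(2) _ C' _ fx by (rule translate_mem) (use c cG g in simp_all)
    moreover have "s (f x) \<in> (\<lambda>x. g \<otimes>\<^bsub>G\<^esub> x) ` C'"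
      using g(1) cG(2) _ C'
      by (rule translate_mem) (use c cG g fx is_sectionD[OF s, of "f x"] in simp_all)
    ultimately show ?thesis by blast
  qed
  then have "A \<union> (\<lambda>x. s (f x)) ` A \<subseteq> (\<lambda>x. g \<otimes>\<^bsub>G\<^esub> x) ` C'" by blast
  then show "(\<lambda>x. x) ` A \<union> (\<lambda>x. s (f x)) ` A \<in> translates G \<xi> C'"
    using g unfolding translates_def by auto
qed

text \<open>On subsets of the carrier f after s is the identity, so only the enlargement of D to D'
  is at stake.\<close>

lemma contiguous_epi_section:
  assumes s: "is_section s" and DD': "D \<subseteq> D'" and D: "D \<subseteq> carrier S"
  shows "contiguous (translates S \<psi> D) (translates S \<psi> D') (\<lambda>x. x) (\<lambda>x. f (s x))"
  unfolding contiguous_def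
proof
  fix A assume "A \<in> translates S \<psi> D"
  then obtain h where h: "h \<in> carrier S" "0 \<le> \<psi> h" and A: "A \<subseteq> (\<lambda>x. h \<otimes>\<^bsub>S\<^esub> x) ` D"
    by (auto simp: translates_def)
  then have "A \<subseteq> carrier S" using D by auto
  then have "(\<lambda>x. f (s x)) ` A = A" using is_sectionD(2)[OF s] by (force simp: subset_iff image_iff)
  moreover have "A \<subseteq> (\<lambda>x. h \<otimes>\<^bsub>S\<^esub> x) ` D'" using A DD' by blast
  ultimately show "(\<lambda>x. x) ` A \<union> (\<lambda>x. f (s x)) ` A \<in> translates S \<psi> D'"
    using h unfolding translates_def by auto
qed

section \<open>Compact indices on both sides and transfer of essential connectivity\<close>

lemma translates_mono: "C \<subseteq> D \<Longrightarrow> translates H \<xi> C \<subseteq> translates H \<xi> D"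
  unfolding translates_def by blast

lemma compact_image: "C \<in> compact_subsets (opens G) \<Longrightarrow> f ` C \<in> compact_subsets (opens S)"
  by (simp add: compact_subsets_def image_compactin[OF _ continuous])

lemma compact_subset_carrier:
  "C \<in> compact_subsets (opens G) \<Longrightarrow> C \<subseteq> carrier G"
  "D \<in> compact_subsets (opens S) \<Longrightarrow> D \<subseteq> carrier S"
  using compactin_subset_topspace topspace_G topspace_S unfolding compact_subsets_def by blast+

lemma compact_preimage': "D \<in> compact_subsets (opens S) \<Longrightarrow> {g \<in> carrier G. f g \<in> D} \<in> compact_subsets (opens G)"
  by (simp add: compact_subsets_def compact_preimage)

text \<open>D plays the part of the larger index that the hypothesis on S supplies for the image of
  C; its preimage is the larger index sought for C.\<close>

lemma transfer_maps_G:
  assumes \<xi>: "is_pullback \<xi> \<psi>" and s: "is_section s"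
    and C: "C \<in> compact_subsets (opens G)" and D: "D \<in> compact_subsets (opens S)" "f ` C \<subseteq> D"
  shows "transfer_maps (translates G \<xi> C) (translates S \<psi> (f ` C)) (translates S \<psi> D)
    (translates G \<xi> {g \<in> carrier G. f g \<in> D}) f s"
proof -
  note CG = compact_subset_carrier(1)[OF C] and DS = compact_subset_carrier(2)[OF D(1)]
  show ?thesis
    unfolding transfer_maps_def
    by (intro conjI downset_translates translates_mono D(2)
        contiguous_epi[OF \<xi> CG order.refl] contiguous_section[OF s \<xi> DS order.refl]
        contiguous_section_epi[OF s \<xi> CG D(2) DS order.refl])
qed

text \<open>The counterpart of \<open>transfer_maps_G\<close>, entering G through the preimage of D.
  Surjectivity of f makes the image of C contain D, so that it may serve as the larger
  index.\<close>

lemma transfer_maps_S: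
  assumes \<xi>: "is_pullback \<xi> \<psi>" and s: "is_section s"
    and D: "D \<in> compact_subsets (opens S)" and C: "C \<in> compact_subsets (opens G)" "{g \<in> carrier G. f g \<in> D} \<subseteq> C"
  shows "D \<subseteq> f ` C \<and> transfer_maps (translates S \<psi> D) (translates G \<xi> {g \<in> carrier G. f g \<in> D}) (translates G \<xi> C)
    (translates S \<psi> (f ` C)) s f"
proof
  note CG = compact_subset_carrier(1)[OF C(1)] and DS = compact_subset_carrier(2)[OF D]
  show DC: "D \<subseteq> f ` C"
  proof
    fix d assume d: "d \<in> D"
    then have "d \<in> f ` carrier G" using DS image_eq by blast
    then obtain g where "g \<in> carrier G" "d = f g" by (elim imageE)
    with d C(2) show "d \<in> f ` C" by auto
  qed
  show "transfer_maps (translates S \<psi> D) (translates G \<xi> {g \<in> carrier G. f g \<in> D}) (translates G \<xi> C)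
    (translates S \<psi> (f ` C)) s f"
    unfolding transfer_maps_def
    by (intro conjI downset_translates translates_mono C(2)
        contiguous_epi[OF \<xi> CG order.refl] contiguous_section[OF s \<xi> DS order.refl]
        contiguous_epi_section[OF s DC DS])
qed

text \<open>The base vertex in \<open>essentially_connected\<close> is existential, so it may be
  lifted along f in one direction and pushed forward in the other, with a section adapted to
  it.\<close>

lemma essentially_connected_iff:
  assumes \<xi>: "is_pullback \<xi> \<psi>"
  shows "essentially_connected m (E_sset (carrier G)) (compact_subsets (opens G)) (char_filtration G \<xi>) \<longleftrightarrow>
    essentially_connected m (E_sset (carrier S)) (compact_subsets (opens S)) (char_filtration S \<psi>)"
proof
  assume "essentially_connected m (E_sset (carrier S)) (compact_subsets (opens S)) (char_filtration S \<psi>)"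
  then obtain y where y: "y \<in> simplices (E_sset (carrier S)) 0"
    and triv: "\<forall>k. int k \<le> m \<longrightarrow> (\<forall>D\<in>compact_subsets (opens S). y \<in> char_filtration S \<psi> D 0 \<longrightarrow>
      (\<exists>D'\<in>compact_subsets (opens S). D \<subseteq> D' \<and>
        homotopy_incl_trivial k (list_sset (translates S \<psi> D)) (list_sset (translates S \<psi> D')) y))"
    unfolding essentially_connected_def restrict_char_filtration by (elim bexE)
  from y obtain v where v: "y = [v]" "v \<in> carrier S" by (auto simp: E_sset_def length_Suc_conv)
  then have "v \<in> f ` carrier G" using image_eq by simp
  then obtain g where g: "g \<in> carrier G" "f g = v" by auto
  obtain s where s: "is_section s" "s (f g) = g" using section_exists[OF g(1)] .
  show "essentially_connected m (E_sset (carrier G)) (compact_subsets (opens G)) (char_filtration G \<xi>)"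
    unfolding essentially_connected_def restrict_char_filtration
  proof (rule bexI[of _ "[g]"], intro allI impI ballI)
    show "[g] \<in> simplices (E_sset (carrier G)) 0" using g by (simp add: E_sset_def)
    fix k C assume k: "int k \<le> m" and C: "C \<in> compact_subsets (opens G)"
      and "[g] \<in> char_filtration G \<xi> C 0"
    then have gC: "{g} \<in> translates G \<xi> C" by (simp add: char_filtration_eq)
    \<comment> \<open>The hypothesis speaks only of indices whose member contains the base vertex;
      since f is simplicial, this passes from C to its image.\<close>
    have "contiguous (translates G \<xi> C) (translates S \<psi> (f ` C)) f f"
      using \<xi> compact_subset_carrier(1)[OF C] order.refl by (rule contiguous_epi)
    then have mem: "y \<in> char_filtration S \<psi> (f ` C) 0"
      using gC g v by (auto simp: char_filtration_eq contiguous_def)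
    from triv[rule_format, OF k compact_image[OF C] mem] obtain D where D: "D \<in> compact_subsets (opens S)" "f ` C \<subseteq> D"
      and "homotopy_incl_trivial k (list_sset (translates S \<psi> (f ` C))) (list_sset (translates S \<psi> D)) y"
      by (elim bexE conjE)
    then have "homotopy_incl_trivial k (list_sset (translates G \<xi> C))
        (list_sset (translates G \<xi> {g \<in> carrier G. f g \<in> D})) [g]"
      using homotopy_incl_trivial_transfer_maps[OF transfer_maps_G[OF \<xi> s(1) C D] gC s(2)] v g by simp
    moreover have "C \<subseteq> {g \<in> carrier G. f g \<in> D}"
      using compact_subset_carrier(1)[OF C] D(2) by auto
    ultimately show "\<exists>C'\<in>compact_subsets (opens G). C \<subseteq> C' \<and>
        homotopy_incl_trivial k (list_sset (translates G \<xi> C)) (list_sset (translates G \<xi> C')) [g]"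
      using compact_preimage'[OF D(1)] by (intro bexI conjI)
  qed
next
  assume "essentially_connected m (E_sset (carrier G)) (compact_subsets (opens G)) (char_filtration G \<xi>)"
  then obtain y where y: "y \<in> simplices (E_sset (carrier G)) 0"
    and triv: "\<forall>k. int k \<le> m \<longrightarrow> (\<forall>C\<in>compact_subsets (opens G). y \<in> char_filtration G \<xi> C 0 \<longrightarrow>
      (\<exists>C'\<in>compact_subsets (opens G). C \<subseteq> C' \<and>
        homotopy_incl_trivial k (list_sset (translates G \<xi> C)) (list_sset (translates G \<xi> C')) y))"
    unfolding essentially_connected_def restrict_char_filtration by (elim bexE)
  from y obtain g where g: "y = [g]" "g \<in> carrier G" by (auto simp: E_sset_def length_Suc_conv)
  obtain s where s: "is_section s" "s (f g) = g" using section_exists[OF g(2)] .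
  show "essentially_connected m (E_sset (carrier S)) (compact_subsets (opens S)) (char_filtration S \<psi>)"
    unfolding essentially_connected_def restrict_char_filtration
  proof (rule bexI[of _ "[f g]"], intro allI impI ballI)
    show "[f g] \<in> simplices (E_sset (carrier S)) 0" using g by (simp add: E_sset_def)
    fix k D assume k: "int k \<le> m" and D: "D \<in> compact_subsets (opens S)"
      and "[f g] \<in> char_filtration S \<psi> D 0"
    then have vD: "{f g} \<in> translates S \<psi> D" by (simp add: char_filtration_eq)
    let ?C = "{g \<in> carrier G. f g \<in> D}"
    have "contiguous (translates S \<psi> D) (translates G \<xi> ?C) s s"
      using s(1) \<xi> compact_subset_carrier(2)[OF D] order.refl by (rule contiguous_section)
    then have mem: "y \<in> char_filtration G \<xi> ?C 0"
      using vD g s by (auto simp: char_filtration_eq contiguous_def)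
    from triv[rule_format, OF k compact_preimage'[OF D] mem] obtain C where C: "C \<in> compact_subsets (opens G)" "?C \<subseteq> C"
      and "homotopy_incl_trivial k (list_sset (translates G \<xi> ?C)) (list_sset (translates G \<xi> C)) y"
      by (elim bexE conjE)
    then have "homotopy_incl_trivial k (list_sset (translates S \<psi> D))
        (list_sset (translates S \<psi> (f ` C))) [f g]"
      using homotopy_incl_trivial_transfer_maps[OF conjunct2[OF transfer_maps_S[OF \<xi> s(1) D C]] vD] g s by simp
    then show "\<exists>D'\<in>compact_subsets (opens S). D \<subseteq> D' \<and>
        homotopy_incl_trivial k (list_sset (translates S \<psi> D)) (list_sset (translates S \<psi> D')) [f g]"
      using compact_image[OF C(1)] conjunct1[OF transfer_maps_S[OF \<xi> s(1) D C]] by (intro bexI conjI)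
  qed
qed

text \<open>Reduced homology carries no base point, so one arbitrary section serves all degrees and
  indices.\<close>

lemma essentially_acyclic_iff:
  assumes R: "cring R" and \<xi>: "is_pullback \<xi> \<psi>"
  shows "essentially_acyclic R m (E_sset (carrier G)) (compact_subsets (opens G)) (char_filtration G \<xi>) \<longleftrightarrow>
    essentially_acyclic R m (E_sset (carrier S)) (compact_subsets (opens S)) (char_filtration S \<psi>)"
proof -
  obtain s where s: "is_section s" using section_exists[OF G.one_closed] .
  show ?thesis
    unfolding essentially_acyclic_def restrict_char_filtration
  proof (intro iffI allI impI ballI)
    fix k C assume triv: "\<forall>k. int k \<le> m \<longrightarrow> (\<forall>D\<in>compact_subsets (opens S). \<exists>D'\<in>compact_subsets (opens S). D \<subseteq> D' \<and>
        homology_incl_trivial R k (list_sset (translates S \<psi> D)) (list_sset (translates S \<psi> D')))"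
      and k: "int k \<le> m" and C: "C \<in> compact_subsets (opens G)"
    from triv[rule_format, OF k compact_image[OF C]] obtain D where D: "D \<in> compact_subsets (opens S)" "f ` C \<subseteq> D"
      and "homology_incl_trivial R k (list_sset (translates S \<psi> (f ` C))) (list_sset (translates S \<psi> D))"
      by (elim bexE conjE)
    then have "homology_incl_trivial R k (list_sset (translates G \<xi> C))
        (list_sset (translates G \<xi> {g \<in> carrier G. f g \<in> D}))"
      using homology_incl_trivial_transfer_maps[OF R transfer_maps_G[OF \<xi> s C D]] by simp
    moreover have "C \<subseteq> {g \<in> carrier G. f g \<in> D}"
      using compact_subset_carrier(1)[OF C] D(2) by auto
    ultimately show "\<exists>C'\<in>compact_subsets (opens G). C \<subseteq> C' \<and>
        homology_incl_trivial R k (list_sset (translates G \<xi> C)) (list_sset (translates G \<xi> C'))"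
      using compact_preimage'[OF D(1)] by (intro bexI conjI)
  next
    fix k D assume triv: "\<forall>k. int k \<le> m \<longrightarrow> (\<forall>C\<in>compact_subsets (opens G). \<exists>C'\<in>compact_subsets (opens G). C \<subseteq> C' \<and>
        homology_incl_trivial R k (list_sset (translates G \<xi> C)) (list_sset (translates G \<xi> C')))"
      and k: "int k \<le> m" and D: "D \<in> compact_subsets (opens S)"
    let ?C = "{g \<in> carrier G. f g \<in> D}"
    from triv[rule_format, OF k compact_preimage'[OF D]] obtain C where C: "C \<in> compact_subsets (opens G)" "?C \<subseteq> C"
      and "homology_incl_trivial R k (list_sset (translates G \<xi> ?C)) (list_sset (translates G \<xi> C))"
      by (elim bexE conjE)
    then have "homology_incl_trivial R k (list_sset (translates S \<psi> D)) (list_sset (translates S \<psi> (f ` C)))"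
      using homology_incl_trivial_transfer_maps[OF R conjunct2[OF transfer_maps_S[OF \<xi> s D C]]] by simp
    then show "\<exists>D'\<in>compact_subsets (opens S). D \<subseteq> D' \<and>
        homology_incl_trivial R k (list_sset (translates S \<psi> D)) (list_sset (translates S \<psi> D'))"
      using compact_image[OF C(1)] conjunct1[OF transfer_maps_S[OF \<xi> s D C]] by (intro bexI conjI)
  qed
qed

end

subsection \<open>Characters\<close>

context proper_epimorphism
begin

interpretation G: group G by (rule group_G)
interpretation S: group S by (rule group_S)
interpretation f: group_hom G S f
  using hom by unfold_locales

lemma is_pullback_char_pullback: "is_pullback (char_pullback G f \<psi>) \<psi>"
  by (simp add: is_pullback_def char_pullback_def compose_eq)

lemma char_pullback_characters:
  assumes \<psi>: "\<psi> \<in> characters S"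
  shows "char_pullback G f \<psi> \<in> characters G"
proof -
  note pb = is_pullbackD[OF is_pullback_char_pullback, of _ \<psi>]
  have "continuous_map (opens G) euclideanreal (\<psi> \<circ> f)"
    using continuous \<psi> by (intro continuous_map_compose[of _ "opens S"]) (auto simp: characters_def)
  then have "continuous_map (opens G) euclideanreal (char_pullback G f \<psi>)"
    by (rule continuous_map_eq) (simp add: pb topspace_G)
  moreover have "char_pullback G f \<psi> \<in> extensional (carrier G)"
    by (simp add: char_pullback_def)
  moreover have "char_pullback G f \<psi> (x \<otimes>\<^bsub>G\<^esub> y) = char_pullback G f \<psi> x + char_pullback G f \<psi> y"
    if "x \<in> carrier G" "y \<in> carrier G" for x y
    using that \<psi> by (simp add: pb characters_def)
  ultimately show ?thesis by (simp add: characters_def)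
qed

lemma character_hom:
  assumes \<xi>: "\<xi> \<in> characters G" and x: "x \<in> carrier G"
  shows "\<xi> \<one>\<^bsub>G\<^esub> = 0" "\<xi> (inv\<^bsub>G\<^esub> x) = - \<xi> x" "\<xi> (x [^]\<^bsub>G\<^esub> (n::nat)) = real n * \<xi> x"
proof -
  have add: "\<xi> (y \<otimes>\<^bsub>G\<^esub> z) = \<xi> y + \<xi> z" if "y \<in> carrier G" "z \<in> carrier G" for y z
    using \<xi> that by (simp add: characters_def)
  show one: "\<xi> \<one>\<^bsub>G\<^esub> = 0" using add[of "\<one>\<^bsub>G\<^esub>" "\<one>\<^bsub>G\<^esub>"] by simp
  show "\<xi> (inv\<^bsub>G\<^esub> x) = - \<xi> x" using add[of "inv\<^bsub>G\<^esub> x" x] one x by simp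
  show "\<xi> (x [^]\<^bsub>G\<^esub> (n::nat)) = real n * \<xi> x"
    using x by (induction n) (simp_all add: one add algebra_simps)
qed

text \<open>The image of the kernel under a character is a compact, hence bounded, subgroup of the reals.\<close>

lemma character_kernel:
  assumes \<xi>: "\<xi> \<in> characters G" and g: "g \<in> carrier G" "f g = \<one>\<^bsub>S\<^esub>"
  shows "\<xi> g = 0"
proof (rule ccontr)
  assume nz: "\<xi> g \<noteq> 0"
  let ?N = "{g \<in> carrier G. f g \<in> {\<one>\<^bsub>S\<^esub>}}"
  have "compactin (opens G) ?N"
    by (rule compact_preimage) (simp add: topspace_S)
  moreover have "continuous_map (opens G) euclideanreal \<xi>"
    using \<xi> by (simp add: characters_def)
  ultimately have "compactin euclideanreal (\<xi> ` ?N)"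
    by (rule image_compactin)
  then have "bounded (\<xi> ` ?N)" by (simp add: compact_imp_bounded)
  then obtain B where B: "\<And>x. x \<in> \<xi> ` ?N \<Longrightarrow> \<bar>x\<bar> \<le> B"
    by (auto simp: bounded_iff)
  obtain n :: nat where n: "B / \<bar>\<xi> g\<bar> < real n" using reals_Archimedean2 by blast
  have "\<xi> (g [^]\<^bsub>G\<^esub> n) \<in> \<xi> ` ?N"
    using g by (intro imageI) (simp add: f.hom_nat_pow)
  from B[OF this] have "real n * \<bar>\<xi> g\<bar> \<le> B"
    using character_hom(3)[OF \<xi> g(1)] by (simp add: abs_mult)
  with n nz show False by (simp add: divide_less_eq mult.commute)
qed

text \<open>Injectivity comes from surjectivity of f. Conversely, a character of G kills the kernel,
  so composing it with a section gives a function that pulls back to it; this function is continuous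
  because f is a quotient map.\<close>

lemma bij_betw_char_pullback: "bij_betw (char_pullback G f) (characters S) (characters G)"
  unfolding bij_betw_def
proof
  show "inj_on (char_pullback G f) (characters S)"
  proof (rule inj_onI)
    fix \<psi> \<psi>' assume \<psi>: "\<psi> \<in> characters S" "\<psi>' \<in> characters S"
      and eq: "char_pullback G f \<psi> = char_pullback G f \<psi>'"
    show "\<psi> = \<psi>'"
    proof (rule extensionalityI)
      show "\<psi> \<in> extensional (carrier S)" "\<psi>' \<in> extensional (carrier S)"
        using \<psi> by (simp_all add: characters_def)
      fix x assume "x \<in> carrier S"
      then have "x \<in> f ` carrier G" by (simp add: image_eq)
      then obtain g where g: "g \<in> carrier G" "x = f g" by auto
      show "\<psi> x = \<psi>' x"
        using is_pullbackD[OF is_pullback_char_pullback g(1)] by (metis eq g(2))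
    qed
  qed
  show "char_pullback G f ` characters S = characters G"
  proof
    show "char_pullback G f ` characters S \<subseteq> characters G"
      using char_pullback_characters by blast
    show "characters G \<subseteq> char_pullback G f ` characters S"
    proof
      fix \<xi> assume \<xi>: "\<xi> \<in> characters G"
      obtain s where s: "is_section s" using section_exists[OF G.one_closed] .
      define \<psi> where "\<psi> = restrict (\<lambda>x. \<xi> (s x)) (carrier S)"
      have add: "\<xi> (y \<otimes>\<^bsub>G\<^esub> z) = \<xi> y + \<xi> z" if "y \<in> carrier G" "z \<in> carrier G" for y z
        using \<xi> that by (simp add: characters_def)
      have eq: "\<xi> g = \<xi> h" if "g \<in> carrier G" "h \<in> carrier G" "f g = f h" for g h
      proof -
        have "\<xi> (g \<otimes>\<^bsub>G\<^esub> inv\<^bsub>G\<^esub> h) = 0"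
          using that by (intro character_kernel[OF \<xi>]) simp_all
        then show ?thesis using that add[of g "inv\<^bsub>G\<^esub> h"] character_hom(2)[OF \<xi>, of h] by simp
      qed
      have \<psi>f: "\<psi> (f g) = \<xi> g" if g: "g \<in> carrier G" for g
        using g is_sectionD[OF s, of "f g"] eq[of "s (f g)" g] by (simp add: \<psi>_def)
      have "\<psi> \<in> characters S"
        unfolding characters_def
      proof (intro CollectI conjI ballI)
        show "\<psi> \<in> extensional (carrier S)" by (simp add: \<psi>_def)
        show "continuous_map (opens S) euclideanreal \<psi>"
          using quotient
        proof (rule continuous_compose_quotient_map)
          have "continuous_map (opens G) euclideanreal \<xi>" using \<xi> by (simp add: characters_def)
          then show "continuous_map (opens G) euclideanreal (\<psi> \<circ> f)"
            by (rule continuous_map_eq) (simp add: \<psi>f topspace_G)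
        qed
        fix x y assume x: "x \<in> carrier S" and y: "y \<in> carrier S"
        \<comment> \<open>Additivity is checked upstairs: the product of s x and s y is a preimage
          of the product of x and y, though not necessarily the one chosen by s.\<close>
        have "\<psi> (f (s x \<otimes>\<^bsub>G\<^esub> s y)) = \<psi> (f (s x)) + \<psi> (f (s y))"
          using is_sectionD(1)[OF s x] is_sectionD(1)[OF s y] by (simp add: \<psi>f add del: f.hom_mult)
        then show "\<psi> (x \<otimes>\<^bsub>S\<^esub> y) = \<psi> x + \<psi> y"
          using is_sectionD[OF s x] is_sectionD[OF s y] by simp
      qed
      moreover have "\<xi> = char_pullback G f \<psi>"
      proof (rule extensionalityI)
        show "\<xi> \<in> extensional (carrier G)" using \<xi> by (simp add: characters_def)
        show "char_pullback G f \<psi> \<in> extensional (carrier G)" by (simp add: char_pullback_def)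
      qed (simp add: is_pullbackD[OF is_pullback_char_pullback] \<psi>f)
      ultimately show "\<xi> \<in> char_pullback G f ` characters S" by blast
    qed
  qed
qed

lemma char_space_iso_char_pullback: "char_space_iso S G (char_pullback G f)"
  unfolding char_space_iso_def
proof (intro conjI ballI allI)
  show "bij_betw (char_pullback G f) (characters S) (characters G)"
    by (rule bij_betw_char_pullback)
qed (auto simp: char_pullback_def char_add_def char_scale_def compose_def fun_eq_iff)

lemma bij_betw_char_pullback_subset:
  assumes "A \<subseteq> characters S" "B \<subseteq> characters G"
    and iff: "\<And>\<psi>. \<psi> \<in> characters S \<Longrightarrow> char_pullback G f \<psi> \<in> B \<longleftrightarrow> \<psi> \<in> A"
  shows "bij_betw (char_pullback G f) A B"
proof (rule bij_betw_subset[OF bij_betw_char_pullback assms(1)])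
  show "char_pullback G f ` A = B"
  proof
    show "char_pullback G f ` A \<subseteq> B" using assms(1) iff by blast
    show "B \<subseteq> char_pullback G f ` A"
    proof
      fix \<xi> assume "\<xi> \<in> B"
      moreover from this have "\<xi> \<in> char_pullback G f ` characters S"
        using assms(2) bij_betw_char_pullback unfolding bij_betw_def by blast
      ultimately show "\<xi> \<in> char_pullback G f ` A" using iff by auto
    qed
  qed
qed

lemma bij_betw_Sigma_top: "bij_betw (char_pullback G f) (Sigma_top n S) (Sigma_top n G)"
  by (rule bij_betw_char_pullback_subset)
    (auto simp: Sigma_top_def char_pullback_characters
      essentially_connected_iff[OF is_pullback_char_pullback])

lemma bij_betw_Sigma_top_hom:
  "cring R \<Longrightarrow> bij_betw (char_pullback G f) (Sigma_top_hom n S R) (Sigma_top_hom n G R)"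
  by (rule bij_betw_char_pullback_subset)
    (auto simp: Sigma_top_hom_def char_pullback_characters
      essentially_acyclic_iff[OF _ is_pullback_char_pullback])

end

section \<open>The map onto the Schlichting completion\<close>

locale dense_completion = \<Gamma>: group \<Gamma> + G: topological_group G
  for \<Gamma> :: "'a top_group" and G :: "'b top_group" +
  fixes \<Lambda> :: "'a set" and \<phi> :: "'a \<Rightarrow> 'b" and L :: "'b set"
  assumes subgroup_\<Lambda>: "subgroup \<Lambda> \<Gamma>" and Hausdorff_G: "Hausdorff_space (opens G)"
    and hom_\<phi>: "\<phi> \<in> hom \<Gamma> G"
    and dense: "Abstract_Topology.closure_of (opens G) (\<phi> ` carrier \<Gamma>) = topspace (opens G)"
    and subgroup_L: "subgroup L G" and compact_L: "compactin (opens G) L" and open_L: "openin (opens G) L"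
    and \<Lambda>_eq: "\<Lambda> = {\<gamma> \<in> carrier \<Gamma>. \<phi> \<gamma> \<in> L}"
begin

sublocale L: subgroup L G by (rule subgroup_L)
sublocale \<phi>: group_hom \<Gamma> G \<phi>
  using hom_\<phi> by unfold_locales

lemma L_carrier [simp]: "l \<in> L \<Longrightarrow> l \<in> carrier G"
  using L.subset by blast

lemma inv_mult_cancel:
  assumes "x \<in> carrier G" "y \<in> carrier G"
  shows "inv\<^bsub>G\<^esub> x \<otimes>\<^bsub>G\<^esub> (x \<otimes>\<^bsub>G\<^esub> y) = y" "x \<otimes>\<^bsub>G\<^esub> (inv\<^bsub>G\<^esub> x \<otimes>\<^bsub>G\<^esub> y) = y"
  using assms by (simp_all add: G.m_assoc[symmetric])

lemma continuous_map_mult: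
  assumes "continuous_map X (opens G) a" "continuous_map X (opens G) b"
  shows "continuous_map X (opens G) (\<lambda>x. a x \<otimes>\<^bsub>G\<^esub> b x)"
proof -
  have "continuous_map X (prod_topology (opens G) (opens G)) (\<lambda>x. (a x, b x))"
    using assms by (rule continuous_map_pairedI)
  from continuous_map_compose[OF this G.continuous_mult] show ?thesis by (simp add: o_def)
qed

lemma continuous_map_inv:
  assumes "continuous_map X (opens G) a"
  shows "continuous_map X (opens G) (\<lambda>x. inv\<^bsub>G\<^esub> (a x))"
  using continuous_map_compose[OF assms G.continuous_inv] by (simp add: o_def)

lemma continuous_map_const_G: "g \<in> carrier G \<Longrightarrow> continuous_map X (opens G) (\<lambda>_. g)"
  by (simp add: G.topspace_opens)

text \<open>\<open>\<gamma>\<Lambda> \<mapsto> \<phi>(\<gamma>)L\<close> identifies \<open>\<Gamma>/\<Lambda>\<close> with \<open>G/L\<close>, and \<open>act\<close> is the action of \<open>G\<close> by left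
  multiplication on the latter.\<close>

definition act :: "'b \<Rightarrow> 'a set \<Rightarrow> 'a set" where
  "act g C = {\<delta> \<in> carrier \<Gamma>. \<exists>\<gamma>\<in>C. \<exists>l\<in>L. \<phi> \<delta> = g \<otimes>\<^bsub>G\<^esub> \<phi> \<gamma> \<otimes>\<^bsub>G\<^esub> l}"

abbreviation "coset \<gamma> \<equiv> \<gamma> <#\<^bsub>\<Gamma>\<^esub> \<Lambda>"

text \<open>Since \<Lambda> is the preimage of L, its cosets are preimages of cosets of L;
  statements about cosets thus reduce to membership in L.\<close>

lemma coset_eq:
  assumes \<gamma>: "\<gamma> \<in> carrier \<Gamma>"
  shows "coset \<gamma> = {\<delta> \<in> carrier \<Gamma>. \<exists>l\<in>L. \<phi> \<delta> = \<phi> \<gamma> \<otimes>\<^bsub>G\<^esub> l}"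
proof
  show "coset \<gamma> \<subseteq> {\<delta> \<in> carrier \<Gamma>. \<exists>l\<in>L. \<phi> \<delta> = \<phi> \<gamma> \<otimes>\<^bsub>G\<^esub> l}"
    using \<gamma> by (auto simp: l_coset_def \<Lambda>_eq)
  show "{\<delta> \<in> carrier \<Gamma>. \<exists>l\<in>L. \<phi> \<delta> = \<phi> \<gamma> \<otimes>\<^bsub>G\<^esub> l} \<subseteq> coset \<gamma>"
  proof
    fix \<delta> assume "\<delta> \<in> {\<delta> \<in> carrier \<Gamma>. \<exists>l\<in>L. \<phi> \<delta> = \<phi> \<gamma> \<otimes>\<^bsub>G\<^esub> l}"
    then obtain l where \<delta>: "\<delta> \<in> carrier \<Gamma>" and l: "l \<in> L" "\<phi> \<delta> = \<phi> \<gamma> \<otimes>\<^bsub>G\<^esub> l" by auto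
    have "\<phi> (inv\<^bsub>\<Gamma>\<^esub> \<gamma> \<otimes>\<^bsub>\<Gamma>\<^esub> \<delta>) = l"
      using \<gamma> \<delta> l by (simp add: G.m_assoc[symmetric])
    then have "inv\<^bsub>\<Gamma>\<^esub> \<gamma> \<otimes>\<^bsub>\<Gamma>\<^esub> \<delta> \<in> \<Lambda>" using l \<gamma> \<delta> by (simp add: \<Lambda>_eq)
    moreover have "\<delta> = \<gamma> \<otimes>\<^bsub>\<Gamma>\<^esub> (inv\<^bsub>\<Gamma>\<^esub> \<gamma> \<otimes>\<^bsub>\<Gamma>\<^esub> \<delta>)"
      using \<gamma> \<delta> by (simp add: \<Gamma>.m_assoc[symmetric])
    ultimately show "\<delta> \<in> coset \<gamma>" unfolding l_coset_def by blast
  qed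
qed

lemma coset_self: "\<gamma> \<in> carrier \<Gamma> \<Longrightarrow> \<gamma> \<in> coset \<gamma>"
  using L.one_closed by (auto simp: coset_eq intro!: bexI[of _ "\<one>\<^bsub>G\<^esub>"])

lemma lcosetsE:
  assumes "C \<in> lcosets\<^bsub>\<Gamma>\<^esub> \<Lambda>"
  obtains \<gamma> where "\<gamma> \<in> carrier \<Gamma>" "C = coset \<gamma>"
  using assms by (auto simp: LCOSETS_def)

lemma lcosetsI: "\<gamma> \<in> carrier \<Gamma> \<Longrightarrow> coset \<gamma> \<in> lcosets\<^bsub>\<Gamma>\<^esub> \<Lambda>"
  by (auto simp: LCOSETS_def)

lemma act_coset:
  assumes g: "g \<in> carrier G" and \<gamma>: "\<gamma> \<in> carrier \<Gamma>"
  shows "act g (coset \<gamma>) = {\<delta> \<in> carrier \<Gamma>. \<exists>l\<in>L. \<phi> \<delta> = g \<otimes>\<^bsub>G\<^esub> \<phi> \<gamma> \<otimes>\<^bsub>G\<^esub> l}"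
proof -
  have "(\<exists>\<gamma>'\<in>coset \<gamma>. \<exists>l\<in>L. \<phi> \<delta> = g \<otimes>\<^bsub>G\<^esub> \<phi> \<gamma>' \<otimes>\<^bsub>G\<^esub> l) \<longleftrightarrow> (\<exists>l\<in>L. \<phi> \<delta> = g \<otimes>\<^bsub>G\<^esub> \<phi> \<gamma> \<otimes>\<^bsub>G\<^esub> l)" for \<delta>
  proof
    assume "\<exists>\<gamma>'\<in>coset \<gamma>. \<exists>l\<in>L. \<phi> \<delta> = g \<otimes>\<^bsub>G\<^esub> \<phi> \<gamma>' \<otimes>\<^bsub>G\<^esub> l"
    then obtain \<gamma>' l l' where "l \<in> L" "l' \<in> L" "\<phi> \<gamma>' = \<phi> \<gamma> \<otimes>\<^bsub>G\<^esub> l'" "\<phi> \<delta> = g \<otimes>\<^bsub>G\<^esub> \<phi> \<gamma>' \<otimes>\<^bsub>G\<^esub> l"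
      using \<gamma> by (auto simp: coset_eq)
    then have "\<phi> \<delta> = g \<otimes>\<^bsub>G\<^esub> \<phi> \<gamma> \<otimes>\<^bsub>G\<^esub> (l' \<otimes>\<^bsub>G\<^esub> l)" "l' \<otimes>\<^bsub>G\<^esub> l \<in> L"
      using g \<gamma> by (simp_all add: G.m_assoc)
    then show "\<exists>l\<in>L. \<phi> \<delta> = g \<otimes>\<^bsub>G\<^esub> \<phi> \<gamma> \<otimes>\<^bsub>G\<^esub> l" by blast
  next
    assume "\<exists>l\<in>L. \<phi> \<delta> = g \<otimes>\<^bsub>G\<^esub> \<phi> \<gamma> \<otimes>\<^bsub>G\<^esub> l"
    then show "\<exists>\<gamma>'\<in>coset \<gamma>. \<exists>l\<in>L. \<phi> \<delta> = g \<otimes>\<^bsub>G\<^esub> \<phi> \<gamma>' \<otimes>\<^bsub>G\<^esub> l"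
      using coset_self[OF \<gamma>] by (intro bexI[of _ \<gamma>])
  qed
  then show ?thesis by (simp add: act_def)
qed

lemma act_coset_eq_iff:
  assumes g: "g \<in> carrier G" and \<gamma>: "\<gamma> \<in> carrier \<Gamma>" and \<gamma>': "\<gamma>' \<in> carrier \<Gamma>"
  shows "act g (coset \<gamma>) = coset \<gamma>' \<longleftrightarrow> (\<exists>l\<in>L. \<phi> \<gamma>' = g \<otimes>\<^bsub>G\<^esub> \<phi> \<gamma> \<otimes>\<^bsub>G\<^esub> l)"
proof
  assume "act g (coset \<gamma>) = coset \<gamma>'"
  then have "\<gamma>' \<in> act g (coset \<gamma>)" using coset_self[OF \<gamma>'] by simp
  then show "\<exists>l\<in>L. \<phi> \<gamma>' = g \<otimes>\<^bsub>G\<^esub> \<phi> \<gamma> \<otimes>\<^bsub>G\<^esub> l" by (simp add: act_coset[OF g \<gamma>])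
next
  assume "\<exists>l\<in>L. \<phi> \<gamma>' = g \<otimes>\<^bsub>G\<^esub> \<phi> \<gamma> \<otimes>\<^bsub>G\<^esub> l"
  then obtain l where l: "l \<in> L" "\<phi> \<gamma>' = g \<otimes>\<^bsub>G\<^esub> \<phi> \<gamma> \<otimes>\<^bsub>G\<^esub> l" by blast
  have "(\<exists>k\<in>L. y = g \<otimes>\<^bsub>G\<^esub> \<phi> \<gamma> \<otimes>\<^bsub>G\<^esub> k) \<longleftrightarrow> (\<exists>k\<in>L. y = \<phi> \<gamma>' \<otimes>\<^bsub>G\<^esub> k)" for y
  proof
    assume "\<exists>k\<in>L. y = g \<otimes>\<^bsub>G\<^esub> \<phi> \<gamma> \<otimes>\<^bsub>G\<^esub> k"
    then obtain k where k: "k \<in> L" "y = g \<otimes>\<^bsub>G\<^esub> \<phi> \<gamma> \<otimes>\<^bsub>G\<^esub> k" by blast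
    have "l \<otimes>\<^bsub>G\<^esub> (inv\<^bsub>G\<^esub> l \<otimes>\<^bsub>G\<^esub> k) = k"
      using l k by (simp add: G.m_assoc[symmetric])
    then have "y = \<phi> \<gamma>' \<otimes>\<^bsub>G\<^esub> (inv\<^bsub>G\<^esub> l \<otimes>\<^bsub>G\<^esub> k)"
      using l k g \<gamma> by (simp add: G.m_assoc)
    then show "\<exists>k\<in>L. y = \<phi> \<gamma>' \<otimes>\<^bsub>G\<^esub> k"
      using l k by (intro bexI[of _ "inv\<^bsub>G\<^esub> l \<otimes>\<^bsub>G\<^esub> k"]) simp_all
  next
    assume "\<exists>k\<in>L. y = \<phi> \<gamma>' \<otimes>\<^bsub>G\<^esub> k"
    then obtain k where k: "k \<in> L" "y = \<phi> \<gamma>' \<otimes>\<^bsub>G\<^esub> k" by blast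
    then show "\<exists>k\<in>L. y = g \<otimes>\<^bsub>G\<^esub> \<phi> \<gamma> \<otimes>\<^bsub>G\<^esub> k"
      using l g \<gamma> by (intro bexI[of _ "l \<otimes>\<^bsub>G\<^esub> k"]) (simp_all add: G.m_assoc)
  qed
  then show "act g (coset \<gamma>) = coset \<gamma>'"
    unfolding act_coset[OF g \<gamma>] coset_eq[OF \<gamma>'] by simp
qed

text \<open>The coset of L through g is open and nonempty, so it meets the dense image of \<phi>.
  This is surjectivity of \<Gamma>/\<Lambda> \<rightarrow> G/L, without which \<open>act\<close>
  would not send cosets to cosets.\<close>

lemma dense_translate:
  assumes g: "g \<in> carrier G"
  obtains \<gamma> l where "\<gamma> \<in> carrier \<Gamma>" "l \<in> L" "\<phi> \<gamma> = g \<otimes>\<^bsub>G\<^esub> l"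
proof -
  let ?U = "{x \<in> topspace (opens G). inv\<^bsub>G\<^esub> g \<otimes>\<^bsub>G\<^esub> x \<in> L}"
  have "continuous_map (opens G) (opens G) (\<lambda>x. inv\<^bsub>G\<^esub> g \<otimes>\<^bsub>G\<^esub> x)"
    using g by (intro continuous_map_mult continuous_map_const_G) simp_all
  then have U: "openin (opens G) ?U"
    using open_L by (rule openin_continuous_map_preimage)
  have "g \<in> Abstract_Topology.closure_of (opens G) (\<phi> ` carrier \<Gamma>)"
    using g dense by (simp add: G.topspace_opens)
  moreover have "g \<in> ?U" using g by (simp add: G.topspace_opens)
  ultimately obtain y where "y \<in> \<phi> ` carrier \<Gamma>" "y \<in> ?U"
    using U unfolding in_closure_of by (elim conjE allE[of _ ?U] impE) auto
  then obtain \<gamma> where \<gamma>: "\<gamma> \<in> carrier \<Gamma>" "inv\<^bsub>G\<^esub> g \<otimes>\<^bsub>G\<^esub> \<phi> \<gamma> \<in> L" by auto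
  then have "\<phi> \<gamma> = g \<otimes>\<^bsub>G\<^esub> (inv\<^bsub>G\<^esub> g \<otimes>\<^bsub>G\<^esub> \<phi> \<gamma>)"
    using g by (simp add: G.m_assoc[symmetric])
  with \<gamma> show ?thesis using that by blast
qed

lemma act_representative:
  assumes g: "g \<in> carrier G" and \<gamma>: "\<gamma> \<in> carrier \<Gamma>"
  obtains \<gamma>' l where "\<gamma>' \<in> carrier \<Gamma>" "l \<in> L" "\<phi> \<gamma>' = g \<otimes>\<^bsub>G\<^esub> \<phi> \<gamma> \<otimes>\<^bsub>G\<^esub> l" "act g (coset \<gamma>) = coset \<gamma>'"
proof -
  have "g \<otimes>\<^bsub>G\<^esub> \<phi> \<gamma> \<in> carrier G" using g \<gamma> by simp
  then obtain \<gamma>' l where *: "\<gamma>' \<in> carrier \<Gamma>" "l \<in> L" "\<phi> \<gamma>' = g \<otimes>\<^bsub>G\<^esub> \<phi> \<gamma> \<otimes>\<^bsub>G\<^esub> l"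
    by (rule dense_translate)
  then have "act g (coset \<gamma>) = coset \<gamma>'"
    using act_coset_eq_iff[OF g \<gamma> *(1)] by blast
  with * show ?thesis by (rule that)
qed

lemma act_closed: "g \<in> carrier G \<Longrightarrow> C \<in> lcosets\<^bsub>\<Gamma>\<^esub> \<Lambda> \<Longrightarrow> act g C \<in> lcosets\<^bsub>\<Gamma>\<^esub> \<Lambda>"
  by (metis act_representative lcosetsE lcosetsI)

lemma act_mult:
  assumes g: "g \<in> carrier G" and h: "h \<in> carrier G" and C: "C \<in> lcosets\<^bsub>\<Gamma>\<^esub> \<Lambda>"
  shows "act (g \<otimes>\<^bsub>G\<^esub> h) C = act g (act h C)"
proof -
  obtain \<gamma> where \<gamma>: "\<gamma> \<in> carrier \<Gamma>" "C = coset \<gamma>" using C by (rule lcosetsE)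
  obtain \<gamma>' l where \<gamma>': "\<gamma>' \<in> carrier \<Gamma>" "l \<in> L" "\<phi> \<gamma>' = h \<otimes>\<^bsub>G\<^esub> \<phi> \<gamma> \<otimes>\<^bsub>G\<^esub> l" "act h (coset \<gamma>) = coset \<gamma>'"
    using h \<gamma>(1) by (rule act_representative)
  obtain \<gamma>'' l' where \<gamma>'': "\<gamma>'' \<in> carrier \<Gamma>" "l' \<in> L" "\<phi> \<gamma>'' = g \<otimes>\<^bsub>G\<^esub> \<phi> \<gamma>' \<otimes>\<^bsub>G\<^esub> l'" "act g (coset \<gamma>') = coset \<gamma>''"
    using g \<gamma>'(1) by (rule act_representative)
  have "\<phi> \<gamma>'' = (g \<otimes>\<^bsub>G\<^esub> h) \<otimes>\<^bsub>G\<^esub> \<phi> \<gamma> \<otimes>\<^bsub>G\<^esub> (l \<otimes>\<^bsub>G\<^esub> l')" "l \<otimes>\<^bsub>G\<^esub> l' \<in> L"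
    using \<gamma>' \<gamma>'' \<gamma> g h by (simp_all add: G.m_assoc)
  then have "act (g \<otimes>\<^bsub>G\<^esub> h) (coset \<gamma>) = coset \<gamma>''"
    using act_coset_eq_iff[of "g \<otimes>\<^bsub>G\<^esub> h" \<gamma> \<gamma>''] g h \<gamma> \<gamma>'' by blast
  then show ?thesis by (simp add: \<gamma> \<gamma>' \<gamma>'')
qed

lemma act_one:
  assumes "C \<in> lcosets\<^bsub>\<Gamma>\<^esub> \<Lambda>"
  shows "act \<one>\<^bsub>G\<^esub> C = C"
proof -
  obtain \<gamma> where \<gamma>: "\<gamma> \<in> carrier \<Gamma>" "C = coset \<gamma>" using assms by (rule lcosetsE)
  show ?thesis
    unfolding \<gamma>(2) act_coset[OF G.one_closed \<gamma>(1)] unfolding coset_eq[OF \<gamma>(1)] using \<gamma>(1) by simp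
qed

lemma act_\<phi>:
  assumes \<gamma>: "\<gamma> \<in> carrier \<Gamma>" and C: "C \<in> lcosets\<^bsub>\<Gamma>\<^esub> \<Lambda>"
  shows "act (\<phi> \<gamma>) C = \<gamma> <#\<^bsub>\<Gamma>\<^esub> C"
proof -
  obtain \<delta> where \<delta>: "\<delta> \<in> carrier \<Gamma>" "C = coset \<delta>" using C by (rule lcosetsE)
  have "act (\<phi> \<gamma>) (coset \<delta>) = coset (\<gamma> \<otimes>\<^bsub>\<Gamma>\<^esub> \<delta>)"
    unfolding act_coset[OF \<phi>.hom_closed[OF \<gamma>] \<delta>(1)] coset_eq[OF \<Gamma>.m_closed[OF \<gamma> \<delta>(1)]]
    using \<gamma> \<delta> by simp
  also have "\<dots> = \<gamma> <#\<^bsub>\<Gamma>\<^esub> coset \<delta>"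
    using \<Gamma>.lcos_m_assoc[OF subgroup.subset[OF subgroup_\<Lambda>] \<gamma> \<delta>(1)] by simp
  finally show ?thesis by (simp add: \<delta>)
qed

text \<open>Between the cosets of \<gamma> and \<gamma>' this is the two-sided translate of L by
  \<phi> \<gamma>' on the left and the inverse of \<phi> \<gamma> on the right, hence both open and
  compact.\<close>

definition transporter :: "'a set \<Rightarrow> 'a set \<Rightarrow> 'b set" where
  "transporter C C' = {g \<in> carrier G. act g C = C'}"

text \<open>Solving for the element of L expresses the condition as membership of a continuous
  function of g in the open set L.\<close>

lemma transporter_coset:
  assumes \<gamma>: "\<gamma> \<in> carrier \<Gamma>" and \<gamma>': "\<gamma>' \<in> carrier \<Gamma>"
  shows "g \<in> transporter (coset \<gamma>) (coset \<gamma>') \<longleftrightarrow>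
      g \<in> carrier G \<and> inv\<^bsub>G\<^esub> \<phi> \<gamma> \<otimes>\<^bsub>G\<^esub> inv\<^bsub>G\<^esub> g \<otimes>\<^bsub>G\<^esub> \<phi> \<gamma>' \<in> L"
proof -
  have "(\<exists>l\<in>L. \<phi> \<gamma>' = g \<otimes>\<^bsub>G\<^esub> \<phi> \<gamma> \<otimes>\<^bsub>G\<^esub> l) \<longleftrightarrow> inv\<^bsub>G\<^esub> \<phi> \<gamma> \<otimes>\<^bsub>G\<^esub> inv\<^bsub>G\<^esub> g \<otimes>\<^bsub>G\<^esub> \<phi> \<gamma>' \<in> L"
    if g: "g \<in> carrier G"
  proof -
    have "\<phi> \<gamma>' = g \<otimes>\<^bsub>G\<^esub> \<phi> \<gamma> \<otimes>\<^bsub>G\<^esub> l \<longleftrightarrow> inv\<^bsub>G\<^esub> \<phi> \<gamma> \<otimes>\<^bsub>G\<^esub> inv\<^bsub>G\<^esub> g \<otimes>\<^bsub>G\<^esub> \<phi> \<gamma>' = l"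
      if "l \<in> L" for l
    proof
      assume "\<phi> \<gamma>' = g \<otimes>\<^bsub>G\<^esub> \<phi> \<gamma> \<otimes>\<^bsub>G\<^esub> l"
      then have "inv\<^bsub>G\<^esub> \<phi> \<gamma> \<otimes>\<^bsub>G\<^esub> inv\<^bsub>G\<^esub> g \<otimes>\<^bsub>G\<^esub> \<phi> \<gamma>' =
          inv\<^bsub>G\<^esub> (g \<otimes>\<^bsub>G\<^esub> \<phi> \<gamma>) \<otimes>\<^bsub>G\<^esub> (g \<otimes>\<^bsub>G\<^esub> \<phi> \<gamma> \<otimes>\<^bsub>G\<^esub> l)"
        using g \<gamma> that by (simp add: G.inv_mult_group)
      also have "\<dots> = l"
        using g \<gamma> that by (subst G.m_assoc[symmetric]) simp_all
      finally show "inv\<^bsub>G\<^esub> \<phi> \<gamma> \<otimes>\<^bsub>G\<^esub> inv\<^bsub>G\<^esub> g \<otimes>\<^bsub>G\<^esub> \<phi> \<gamma>' = l" .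
    next
      assume l: "inv\<^bsub>G\<^esub> \<phi> \<gamma> \<otimes>\<^bsub>G\<^esub> inv\<^bsub>G\<^esub> g \<otimes>\<^bsub>G\<^esub> \<phi> \<gamma>' = l"
      have "\<phi> \<gamma>' = (g \<otimes>\<^bsub>G\<^esub> \<phi> \<gamma>) \<otimes>\<^bsub>G\<^esub> (inv\<^bsub>G\<^esub> (g \<otimes>\<^bsub>G\<^esub> \<phi> \<gamma>) \<otimes>\<^bsub>G\<^esub> \<phi> \<gamma>')"
        using g \<gamma> \<gamma>' by (subst G.m_assoc[symmetric]) simp_all
      also have "\<dots> = g \<otimes>\<^bsub>G\<^esub> \<phi> \<gamma> \<otimes>\<^bsub>G\<^esub> l"
        using g \<gamma> by (simp add: l[symmetric] G.inv_mult_group)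
      finally show "\<phi> \<gamma>' = g \<otimes>\<^bsub>G\<^esub> \<phi> \<gamma> \<otimes>\<^bsub>G\<^esub> l" .
    qed
    then show ?thesis by auto
  qed
  then show ?thesis
    using act_coset_eq_iff[OF _ \<gamma> \<gamma>'] by (auto simp: transporter_def)
qed

lemma openin_transporter:
  assumes "C \<in> lcosets\<^bsub>\<Gamma>\<^esub> \<Lambda>" "C' \<in> lcosets\<^bsub>\<Gamma>\<^esub> \<Lambda>"
  shows "openin (opens G) (transporter C C')"
proof -
  obtain \<gamma> \<gamma>' where \<gamma>: "\<gamma> \<in> carrier \<Gamma>" "C = coset \<gamma>" and \<gamma>': "\<gamma>' \<in> carrier \<Gamma>" "C' = coset \<gamma>'"
    using assms by (metis lcosetsE)
  have "continuous_map (opens G) (opens G) (\<lambda>g. inv\<^bsub>G\<^esub> \<phi> \<gamma> \<otimes>\<^bsub>G\<^esub> inv\<^bsub>G\<^esub> g \<otimes>\<^bsub>G\<^esub> \<phi> \<gamma>')"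
    using \<gamma>(1) \<gamma>'(1)
    by (intro continuous_map_mult continuous_map_const_G continuous_map_inv) (simp_all add: continuous_map_id[unfolded id_def])
  note openin_continuous_map_preimage[OF this open_L]
  moreover have "transporter C C' =
      {g \<in> topspace (opens G). inv\<^bsub>G\<^esub> \<phi> \<gamma> \<otimes>\<^bsub>G\<^esub> inv\<^bsub>G\<^esub> g \<otimes>\<^bsub>G\<^esub> \<phi> \<gamma>' \<in> L}"
    unfolding \<gamma>(2) \<gamma>'(2) by (auto simp: transporter_coset[OF \<gamma>(1) \<gamma>'(1)] G.topspace_opens)
  ultimately show ?thesis by simp
qed

lemma compactin_transporter:
  assumes "C \<in> lcosets\<^bsub>\<Gamma>\<^esub> \<Lambda>" "C' \<in> lcosets\<^bsub>\<Gamma>\<^esub> \<Lambda>"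
  shows "compactin (opens G) (transporter C C')"
proof -
  obtain \<gamma> \<gamma>' where \<gamma>: "\<gamma> \<in> carrier \<Gamma>" "C = coset \<gamma>" and \<gamma>': "\<gamma>' \<in> carrier \<Gamma>" "C' = coset \<gamma>'"
    using assms by (metis lcosetsE)
  \<comment> \<open>The result of solving \<phi> \<gamma>' = g \<phi> \<gamma> l for g, whence the
    inverse of l.\<close>
  let ?m = "\<lambda>l. \<phi> \<gamma>' \<otimes>\<^bsub>G\<^esub> inv\<^bsub>G\<^esub> l \<otimes>\<^bsub>G\<^esub> inv\<^bsub>G\<^esub> \<phi> \<gamma>"
  have "continuous_map (opens G) (opens G) ?m"
    using \<gamma>(1) \<gamma>'(1)
    by (intro continuous_map_mult continuous_map_const_G continuous_map_inv) (simp_all add: continuous_map_id[unfolded id_def])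
  with compact_L have "compactin (opens G) (?m ` L)" by (rule image_compactin)
  moreover have "?m ` L = transporter C C'"
  proof
    show "?m ` L \<subseteq> transporter C C'"
      unfolding \<gamma>(2) \<gamma>'(2)
    proof
      fix g assume "g \<in> ?m ` L"
      then obtain l where l: "l \<in> L" "g = ?m l" by blast
      have "inv\<^bsub>G\<^esub> \<phi> \<gamma> \<otimes>\<^bsub>G\<^esub> inv\<^bsub>G\<^esub> g \<otimes>\<^bsub>G\<^esub> \<phi> \<gamma>' = l"
        using \<gamma>(1) \<gamma>'(1) l(1)
        by (simp add: l(2) G.inv_mult_group G.m_assoc inv_mult_cancel)
      then show "g \<in> transporter (coset \<gamma>) (coset \<gamma>')"
        unfolding transporter_coset[OF \<gamma>(1) \<gamma>'(1)] using \<gamma>(1) \<gamma>'(1) l by simp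
    qed
    show "transporter C C' \<subseteq> ?m ` L"
      unfolding \<gamma>(2) \<gamma>'(2)
    proof
      fix g assume "g \<in> transporter (coset \<gamma>) (coset \<gamma>')"
      then have g: "g \<in> carrier G" and l: "inv\<^bsub>G\<^esub> \<phi> \<gamma> \<otimes>\<^bsub>G\<^esub> inv\<^bsub>G\<^esub> g \<otimes>\<^bsub>G\<^esub> \<phi> \<gamma>' \<in> L"
        unfolding transporter_coset[OF \<gamma>(1) \<gamma>'(1)] by auto
      have "g = ?m (inv\<^bsub>G\<^esub> \<phi> \<gamma> \<otimes>\<^bsub>G\<^esub> inv\<^bsub>G\<^esub> g \<otimes>\<^bsub>G\<^esub> \<phi> \<gamma>')"
        using \<gamma>(1) \<gamma>'(1) g by (simp add: G.inv_mult_group G.m_assoc inv_mult_cancel)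
      then show "g \<in> ?m ` L" using l by (rule image_eqI)
    qed
  qed
  ultimately show ?thesis by simp
qed

section \<open>The continuous homomorphism to permutations of the cosets\<close>

abbreviation "cosets \<equiv> lcosets\<^bsub>\<Gamma>\<^esub> \<Lambda>"

abbreviation "S \<equiv> schlichting \<Gamma> \<Lambda>"

definition to_schlichting :: "'b \<Rightarrow> 'a set \<Rightarrow> 'a set" where
  "to_schlichting = (\<lambda>g\<in>carrier G. \<lambda>C\<in>cosets. act g C)"

lemma to_schlichting_apply: "g \<in> carrier G \<Longrightarrow> C \<in> cosets \<Longrightarrow> to_schlichting g C = act g C"
  by (simp add: to_schlichting_def)

lemma to_schlichting_Bij:
  assumes g: "g \<in> carrier G"
  shows "to_schlichting g \<in> Bij cosets"
proof -
  have "bij_betw (to_schlichting g) cosets cosets"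
  proof (rule bij_betwI[where g = "act (inv\<^bsub>G\<^esub> g)"])
    show "to_schlichting g \<in> cosets \<rightarrow> cosets" "act (inv\<^bsub>G\<^esub> g) \<in> cosets \<rightarrow> cosets"
      using g by (auto simp: to_schlichting_apply act_closed)
    show "act (inv\<^bsub>G\<^esub> g) (to_schlichting g C) = C" "to_schlichting g (act (inv\<^bsub>G\<^esub> g) C) = C"
      if "C \<in> cosets" for C
      using g that by (simp_all add: to_schlichting_apply act_closed act_one flip: act_mult)
  qed
  then show ?thesis using g by (simp add: Bij_def to_schlichting_def)
qed

lemma to_schlichting_mult:
  assumes "g \<in> carrier G" "h \<in> carrier G"
  shows "to_schlichting (g \<otimes>\<^bsub>G\<^esub> h) = to_schlichting g \<otimes>\<^bsub>BijGroup cosets\<^esub> to_schlichting h"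
proof
  fix C
  show "to_schlichting (g \<otimes>\<^bsub>G\<^esub> h) C = (to_schlichting g \<otimes>\<^bsub>BijGroup cosets\<^esub> to_schlichting h) C"
  proof (cases "C \<in> cosets")
    case True
    then show ?thesis
      using assms by (simp add: BijGroup_def to_schlichting_Bij compose_eq to_schlichting_apply act_closed act_mult)
  next
    case False
    then show ?thesis
      using assms by (simp add: BijGroup_def to_schlichting_Bij compose_def) (simp add: to_schlichting_def)
  qed
qed

lemma to_schlichting_\<phi>: "\<gamma> \<in> carrier \<Gamma> \<Longrightarrow> to_schlichting (\<phi> \<gamma>) = schlichting_map \<Gamma> \<Lambda> \<gamma>"
  by (auto simp: to_schlichting_def schlichting_map_def act_\<phi> fun_eq_iff restrict_def)

text \<open>The preimage of a set of cosets under evaluation at C is a union of transporters, hence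
  open, and pointwise convergence asks for no more.\<close>

lemma continuous_map_sym: "continuous_map (opens G) (sym_topology cosets) to_schlichting"
  unfolding sym_topology_def continuous_map_in_subtopology continuous_map_componentwise
proof (intro conjI ballI)
  show "to_schlichting ` topspace (opens G) \<subseteq> extensional cosets"
    using to_schlichting_Bij by (auto simp: G.topspace_opens Bij_def)
  show "to_schlichting \<in> topspace (opens G) \<rightarrow> Bij cosets"
    using to_schlichting_Bij by (simp add: G.topspace_opens)
  fix C assume C: "C \<in> cosets"
  show "continuous_map (opens G) (discrete_topology cosets) (\<lambda>g. to_schlichting g C)"
    unfolding continuous_map_def
  proof (intro conjI allI impI)
    show "(\<lambda>g. to_schlichting g C) \<in> topspace (opens G) \<rightarrow> topspace (discrete_topology cosets)"
      using C by (auto simp: G.topspace_opens to_schlichting_apply act_closed)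
    fix U assume "openin (discrete_topology cosets) U"
    then have U: "U \<subseteq> cosets" by simp
    have "{g \<in> topspace (opens G). to_schlichting g C \<in> U} = (\<Union>C'\<in>U. transporter C C')"
      using C by (auto simp: G.topspace_opens to_schlichting_apply transporter_def)
    moreover have "openin (opens G) (\<Union>C'\<in>U. transporter C C')"
      using C U by (intro openin_Union) (auto intro: openin_transporter)
    ultimately show "openin (opens G) {g \<in> topspace (opens G). to_schlichting g C \<in> U}" by simp
  qed
qed

section \<open>Topology of the Schlichting completion and properness of the map onto it\<close>

lemma carrier_S: "carrier S = Abstract_Topology.closure_of (sym_topology cosets) (schlichting_map \<Gamma> \<Lambda> ` carrier \<Gamma>)"
  and opens_S: "opens S = subtopology (sym_topology cosets) (carrier S)"
  by (simp_all add: schlichting_def Let_def)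

lemma carrier_S_subset: "carrier S \<subseteq> topspace (sym_topology cosets)"
  unfolding carrier_S by (rule closure_of_subset_topspace)

lemma topspace_opens_S: "topspace (opens S) = carrier S"
  by (simp add: opens_S Int_absorb1[OF carrier_S_subset])

lemma Hausdorff_sym: "Hausdorff_space (sym_topology cosets)"
  unfolding sym_topology_def
  by (intro Hausdorff_space_subtopology) (simp add: Hausdorff_space_product_topology Hausdorff_space_discrete_topology)

lemma Hausdorff_S: "Hausdorff_space (opens S)"
  unfolding opens_S by (intro Hausdorff_space_subtopology Hausdorff_sym)

text \<open>By density G is the closure of the image of \<phi>, and continuity carries closures into
  closures.\<close>

lemma to_schlichting_closed: "to_schlichting ` carrier G \<subseteq> carrier S"
proof -
  have "to_schlichting ` carrier G = to_schlichting ` (Abstract_Topology.closure_of (opens G) (\<phi> ` carrier \<Gamma>))"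
    by (simp add: dense G.topspace_opens)
  also have "\<dots> \<subseteq> Abstract_Topology.closure_of (sym_topology cosets) (to_schlichting ` \<phi> ` carrier \<Gamma>)"
    by (rule continuous_map_image_closure_subset[OF continuous_map_sym])
  also have "to_schlichting ` \<phi> ` carrier \<Gamma> = schlichting_map \<Gamma> \<Lambda> ` carrier \<Gamma>"
    by (simp add: image_image to_schlichting_\<phi>)
  finally show ?thesis by (simp add: carrier_S)
qed

lemma continuous_map_to_schlichting: "continuous_map (opens G) (opens S) to_schlichting"
  unfolding opens_S continuous_map_in_subtopology
  using continuous_map_sym to_schlichting_closed by (auto simp: G.topspace_opens)

lemma base_coset: "\<Lambda> \<in> cosets"
proof -
  have "coset \<one>\<^bsub>\<Gamma>\<^esub> = \<Lambda>"
    using \<Gamma>.lcos_mult_one[OF subgroup.subset[OF subgroup_\<Lambda>]] .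
  then show ?thesis using lcosetsI[OF \<Gamma>.one_closed] by simp
qed

lemma openin_evaluation:
  assumes "C \<in> cosets"
  shows "openin (sym_topology cosets) {\<tau> \<in> topspace (sym_topology cosets). \<tau> C = C'}"
proof -
  have "continuous_map (sym_topology cosets) (discrete_topology cosets) (\<lambda>\<tau>. \<tau> C)"
    unfolding sym_topology_def using assms
    by (intro continuous_map_from_subtopology continuous_map_product_projection)
  \<comment> \<open>C' is arbitrary, while open sets of the discrete space consist of cosets; hence
    the intersection.\<close>
  from openin_continuous_map_preimage[OF this, of "{C'} \<inter> cosets"]
  have "openin (sym_topology cosets) {\<tau> \<in> topspace (sym_topology cosets). \<tau> C \<in> {C'} \<inter> cosets}" by simp
  moreover have "\<tau> C \<in> cosets" if "\<tau> \<in> topspace (sym_topology cosets)" for \<tau>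
    using that assms by (auto simp: sym_topology_def)
  then have "{\<tau> \<in> topspace (sym_topology cosets). \<tau> C \<in> {C'} \<inter> cosets} =
      {\<tau> \<in> topspace (sym_topology cosets). \<tau> C = C'}" by blast
  ultimately show ?thesis by simp
qed

lemma S_closed: "\<sigma> \<in> carrier S \<Longrightarrow> C \<in> cosets \<Longrightarrow> \<sigma> C \<in> cosets"
  using carrier_S_subset by (auto simp: sym_topology_def)

text \<open>Near \<open>\<sigma>\<close> the points of \<open>\<alpha>(\<Gamma>)\<close> lie in the image of the compact set of all \<open>g\<close> with
  \<open>g\<Lambda> = \<sigma>(\<Lambda>)\<close>, which is closed.\<close>

lemma image_to_schlichting: "to_schlichting ` carrier G = carrier S"
proof
  show "carrier S \<subseteq> to_schlichting ` carrier G"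
  proof
    fix \<sigma> assume \<sigma>: "\<sigma> \<in> carrier S"
    let ?U = "{\<tau> \<in> topspace (sym_topology cosets). \<tau> \<Lambda> = \<sigma> \<Lambda>}"
    let ?W = "transporter \<Lambda> (\<sigma> \<Lambda>)"
    have "compactin (sym_topology cosets) (to_schlichting ` ?W)"
      using compactin_transporter[OF base_coset S_closed[OF \<sigma> base_coset]] continuous_map_sym
      by (rule image_compactin)
    then have closed: "closedin (sym_topology cosets) (to_schlichting ` ?W)"
      by (rule compactin_imp_closedin[OF Hausdorff_sym])
    have "?U \<inter> schlichting_map \<Gamma> \<Lambda> ` carrier \<Gamma> \<subseteq> to_schlichting ` ?W"
    proof
      fix \<tau> assume "\<tau> \<in> ?U \<inter> schlichting_map \<Gamma> \<Lambda> ` carrier \<Gamma>"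
      then obtain \<gamma> where \<gamma>: "\<gamma> \<in> carrier \<Gamma>" "\<tau> = to_schlichting (\<phi> \<gamma>)" "\<tau> \<Lambda> = \<sigma> \<Lambda>"
        by (auto simp: to_schlichting_\<phi>)
      then have "\<phi> \<gamma> \<in> ?W" by (simp add: transporter_def to_schlichting_apply base_coset)
      with \<gamma> show "\<tau> \<in> to_schlichting ` ?W" by blast
    qed
    then have "Abstract_Topology.closure_of (sym_topology cosets) (?U \<inter> schlichting_map \<Gamma> \<Lambda> ` carrier \<Gamma>)
        \<subseteq> to_schlichting ` ?W"
      using closed by (rule closure_of_minimal)
    moreover have "\<sigma> \<in> ?U \<inter> Abstract_Topology.closure_of (sym_topology cosets) (schlichting_map \<Gamma> \<Lambda> ` carrier \<Gamma>)"
      using \<sigma> carrier_S carrier_S_subset by auto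
    ultimately have "\<sigma> \<in> to_schlichting ` ?W"
      using openin_Int_closure_of_subset[OF openin_evaluation[OF base_coset, of "\<sigma> \<Lambda>"],
          of "schlichting_map \<Gamma> \<Lambda> ` carrier \<Gamma>"] by blast
    then show "\<sigma> \<in> to_schlichting ` carrier G" by (auto simp: transporter_def)
  qed
qed (rule to_schlichting_closed)

text \<open>For C in \<open>cosets\<close> these are the cosets of the stabilizer of the base coset
  \<Lambda>; they partition the completion into compact open sets.\<close>

definition fibre :: "'a set \<Rightarrow> ('a set \<Rightarrow> 'a set) set" where
  "fibre C = {\<tau> \<in> carrier S. \<tau> \<Lambda> = C}"

lemma openin_fibre: "openin (opens S) (fibre C)"
proof -
  have "fibre C = carrier S \<inter> {\<tau> \<in> topspace (sym_topology cosets). \<tau> \<Lambda> = C}"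
    using carrier_S_subset by (auto simp: fibre_def)
  then show ?thesis
    unfolding opens_S using openin_evaluation[OF base_coset, of C]
    by (simp add: openin_subtopology_Int2)
qed

lemma fibre_eq: "C \<in> cosets \<Longrightarrow> fibre C = to_schlichting ` transporter \<Lambda> C"
  using image_to_schlichting
  by (auto simp: fibre_def transporter_def to_schlichting_apply base_coset simp flip: image_to_schlichting)

lemma compactin_fibre: "C \<in> cosets \<Longrightarrow> compactin (opens S) (fibre C)"
  unfolding fibre_eq
  by (rule image_compactin[OF compactin_transporter[OF base_coset] continuous_map_to_schlichting])

lemma locally_compact_S: "locally_compact_space (opens S)"
  unfolding locally_compact_space_def topspace_opens_S
proof
  fix \<sigma> assume \<sigma>: "\<sigma> \<in> carrier S"
  show "\<exists>U K. openin (opens S) U \<and> compactin (opens S) K \<and> \<sigma> \<in> U \<and> U \<subseteq> K"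
    using openin_fibre compactin_fibre[OF S_closed[OF \<sigma> base_coset]] \<sigma>
    by (intro exI[of _ "fibre (\<sigma> \<Lambda>)"] conjI) (auto simp: fibre_def)
qed

text \<open>Finitely many of the open fibres cover D, so its preimage lies in a finite union of
  compact transporters. The preimage is also closed, as a compact set in a Hausdorff space is
  closed.\<close>

lemma compact_preimage_to_schlichting:
  assumes D: "compactin (opens S) D"
  shows "compactin (opens G) {g \<in> carrier G. to_schlichting g \<in> D}"
proof -
  have DS: "D \<subseteq> carrier S" using compactin_subset_topspace[OF D] by (simp add: topspace_opens_S)
  have "D \<subseteq> \<Union> (fibre ` cosets)"
  proof
    fix \<sigma> assume "\<sigma> \<in> D"
    then have "\<sigma> \<in> carrier S" using DS by blast
    then have "\<sigma> \<in> fibre (\<sigma> \<Lambda>)" "\<sigma> \<Lambda> \<in> cosets" by (auto simp: fibre_def S_closed base_coset)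
    then show "\<sigma> \<in> \<Union> (fibre ` cosets)" by blast
  qed
  moreover have "\<forall>U\<in>fibre ` cosets. openin (opens S) U" using openin_fibre by blast
  ultimately obtain \<F> where \<F>: "finite \<F>" "\<F> \<subseteq> fibre ` cosets" "D \<subseteq> \<Union> \<F>"
    using D unfolding compactin_def by metis
  from finite_subset_image[OF \<F>(1,2)] obtain T where T: "T \<subseteq> cosets" "finite T" "\<F> = fibre ` T" by blast
  have "compactin (opens G) (\<Union> (transporter \<Lambda> ` T))"
    using T by (intro compactin_Union) (auto intro: compactin_transporter[OF base_coset])
  moreover have "{g \<in> carrier G. to_schlichting g \<in> D} \<subseteq> \<Union> (transporter \<Lambda> ` T)"
  proof
    fix g assume "g \<in> {g \<in> carrier G. to_schlichting g \<in> D}"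
    then have g: "g \<in> carrier G" "to_schlichting g \<in> D" by auto
    then obtain C where C: "C \<in> T" "to_schlichting g \<in> fibre C" using \<F>(3) T(3) by blast
    then have "g \<in> transporter \<Lambda> C"
      using g by (simp add: fibre_def transporter_def to_schlichting_apply base_coset)
    with C show "g \<in> \<Union> (transporter \<Lambda> ` T)" by blast
  qed
  moreover have "closedin (opens G) {g \<in> topspace (opens G). to_schlichting g \<in> D}"
    using continuous_map_to_schlichting compactin_imp_closedin[OF Hausdorff_S D]
    by (rule closedin_continuous_map_preimage)
  ultimately show ?thesis
    using closed_compactin by (simp add: G.topspace_opens)
qed

text \<open>Compact preimages make a continuous map into a locally compact Hausdorff space proper,
  hence closed, and a closed continuous surjection is a quotient map.\<close>

lemma quotient_map_to_schlichting: "quotient_map (opens G) (opens S) to_schlichting"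
proof (rule continuous_closed_imp_quotient_map)
  show "continuous_map (opens G) (opens S) to_schlichting" by (rule continuous_map_to_schlichting)
  have "proper_map (opens G) (opens S) to_schlichting"
  proof (rule compact_imp_proper_map)
    show "k_space (opens S)" using locally_compact_S by (rule locally_compact_imp_k_space)
    show "kc_space (opens S)" using Hausdorff_S by (rule Hausdorff_imp_kc_space)
  qed (use to_schlichting_closed continuous_map_to_schlichting compact_preimage_to_schlichting in
      \<open>auto simp: G.topspace_opens topspace_opens_S\<close>)
  then show "closed_map (opens G) (opens S) to_schlichting" by (rule proper_imp_closed_map)
  show "to_schlichting ` topspace (opens G) = topspace (opens S)"
    by (simp add: G.topspace_opens topspace_opens_S image_to_schlichting)
qed

lemma mult_S: "mult S = mult (BijGroup cosets)" and one_S: "one S = one (BijGroup cosets)"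
  by (simp_all add: schlichting_def Let_def)

text \<open>The laws are inherited from G through \<open>to_schlichting\<close>, whose image is the
  whole closure.\<close>

lemma group_S: "group S"
proof -
  have "to_schlichting \<in> hom G (BijGroup cosets)"
    by (rule homI) (simp_all add: to_schlichting_mult, simp add: BijGroup_def to_schlichting_Bij)
  then have one: "\<one>\<^bsub>S\<^esub> = to_schlichting \<one>\<^bsub>G\<^esub>"
    unfolding one_S using group_BijGroup by (intro hom_one[symmetric] G.is_group)
  have mult: "to_schlichting g \<otimes>\<^bsub>S\<^esub> to_schlichting h = to_schlichting (g \<otimes>\<^bsub>G\<^esub> h)"
    if "g \<in> carrier G" "h \<in> carrier G" for g h
    unfolding mult_S using that by (rule to_schlichting_mult[symmetric])
  show ?thesis
    by (rule groupI; unfold image_to_schlichting[symmetric])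
      (auto simp: one mult G.m_assoc intro!: bexI[of _ "inv\<^bsub>G\<^esub> _"])
qed

text \<open>Two continuous maps into a Hausdorff space that agree on the dense image of \<phi>
  coincide, and extensionality settles the values off the carrier; with
  \<open>to_schlichting\<close> as a solution, the definite description denotes it.\<close>

lemma completion_map_eq: "completion_map \<Gamma> \<Lambda> G \<phi> = to_schlichting"
  unfolding completion_map_def
proof (rule the_equality)
  show "to_schlichting \<in> extensional (carrier G) \<and> continuous_map (opens G) (opens S) to_schlichting \<and>
      (\<forall>\<gamma>\<in>carrier \<Gamma>. to_schlichting (\<phi> \<gamma>) = schlichting_map \<Gamma> \<Lambda> \<gamma>)"
    using continuous_map_to_schlichting to_schlichting_\<phi> by (simp add: to_schlichting_def)
  fix f assume f: "f \<in> extensional (carrier G) \<and> continuous_map (opens G) (opens S) f \<and>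
      (\<forall>\<gamma>\<in>carrier \<Gamma>. f (\<phi> \<gamma>) = schlichting_map \<Gamma> \<Lambda> \<gamma>)"
  show "f = to_schlichting"
  proof (rule extensionalityI)
    show "f \<in> extensional (carrier G)" using f by blast
    show "to_schlichting \<in> extensional (carrier G)" by (simp add: to_schlichting_def)
    fix g assume "g \<in> carrier G"
    then have "g \<in> Abstract_Topology.closure_of (opens G) (\<phi> ` carrier \<Gamma>)"
      by (simp add: dense G.topspace_opens)
    then show "f g = to_schlichting g"
      using Hausdorff_S conjunct1[OF conjunct2[OF f]] continuous_map_to_schlichting
      by (rule forall_in_closure_of_eq) (use f to_schlichting_\<phi> in auto)
  qed
qed

lemma proper_epimorphism_completion_map:
  "proper_epimorphism G S (completion_map \<Gamma> \<Lambda> G \<phi>)"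
  unfolding completion_map_eq
proof (rule proper_epimorphism.intro)
  show "group G" by (rule G.is_group)
  show "group S" by (rule group_S)
  show "to_schlichting \<in> hom G S"
    by (rule homI) (use to_schlichting_closed in \<open>auto simp: mult_S to_schlichting_mult\<close>)
  show "topspace (opens G) = carrier G" by (rule G.topspace_opens)
  show "topspace (opens S) = carrier S" by (rule topspace_opens_S)
  show "quotient_map (opens G) (opens S) to_schlichting" by (rule quotient_map_to_schlichting)
qed (rule compact_preimage_to_schlichting)

end

lemma tdlc_completion_proper_epimorphism:
  assumes "hecke_pair \<Gamma> \<Lambda>" and "tdlc_completion \<Gamma> \<Lambda> G \<phi>"
  shows "proper_epimorphism G (schlichting \<Gamma> \<Lambda>) (completion_map \<Gamma> \<Lambda> G \<phi>)"
proof -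
  interpret \<Gamma>: topological_group \<Gamma> using assms(1) by (simp add: hecke_pair_def)
  interpret G: tdlc_group G using assms(2) by (simp add: tdlc_completion_def)
  obtain L where L: "subgroup L G" "compactin (opens G) L" "openin (opens G) L"
      "\<Lambda> = {\<gamma> \<in> carrier \<Gamma>. \<phi> \<gamma> \<in> L}"
    using assms(2) unfolding tdlc_completion_def by (elim conjE exE)
  have \<phi>: "\<phi> \<in> hom \<Gamma> G" "Abstract_Topology.closure_of (opens G) (\<phi> ` carrier \<Gamma>) = topspace (opens G)"
    using assms(2) by (simp_all add: tdlc_completion_def)
  have \<Lambda>: "subgroup \<Lambda> \<Gamma>"
    using assms(1) by (simp add: hecke_pair_def commensurated_def)
  interpret dense_completion \<Gamma> G \<Lambda> \<phi> L
    by (intro dense_completion.intro dense_completion_axioms.intro)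
      (fact \<Gamma>.is_group G.topological_group_axioms \<Lambda> G.Hausdorff \<phi> L)+
  show ?thesis by (rule proper_epimorphism_completion_map)
qed

theorem proposition4p4:
  fixes \<Gamma> :: "'a top_group" and \<Lambda> :: "'a set"
    and G :: "'b top_group" and \<phi> :: "'a \<Rightarrow> 'b"
    and H :: "'c top_group" and \<theta> :: "'a \<Rightarrow> 'c"
    and R :: "'r ring" and n :: nat
  assumes "hecke_pair \<Gamma> \<Lambda>"
    and "tdlc_completion \<Gamma> \<Lambda> G \<phi>"
    and "cring R"
  defines "S \<equiv> schlichting \<Gamma> \<Lambda>"
    and "p \<equiv> char_pullback G (completion_map \<Gamma> \<Lambda> G \<phi>)"
    and "q \<equiv> char_pullback H (completion_map \<Gamma> \<Lambda> H \<theta>)"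
  shows "char_space_iso S G p \<and>
    bij_betw p (Sigma_top n S) (Sigma_top n G) \<and>
    bij_betw p (Sigma_top_hom n S R) (Sigma_top_hom n G R) \<and>
    (tdlc_completion \<Gamma> \<Lambda> H \<theta> \<longrightarrow>
       bij_betw (q \<circ> inv_into (characters S) p) (Sigma_top n G) (Sigma_top n H) \<and>
       bij_betw (q \<circ> inv_into (characters S) p) (Sigma_top_hom n G R) (Sigma_top_hom n H R))"
proof -
  interpret G: proper_epimorphism G S "completion_map \<Gamma> \<Lambda> G \<phi>"
    unfolding S_def using assms(1,2) by (rule tdlc_completion_proper_epimorphism)
  have top: "bij_betw p (Sigma_top n S) (Sigma_top n G)"
    unfolding p_def by (rule G.bij_betw_Sigma_top)
  have hom: "bij_betw p (Sigma_top_hom n S R) (Sigma_top_hom n G R)"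
    unfolding p_def using assms(3) by (rule G.bij_betw_Sigma_top_hom)
  have iso: "char_space_iso S G p"
    unfolding p_def by (rule G.char_space_iso_char_pullback)
  then have bij: "bij_betw p (characters S) (characters G)"
    by (simp add: char_space_iso_def)
  \<comment> \<open>Sigma-sets consist of characters, so the inverse of p on all characters
    restricts to an inverse between them.\<close>
  have inv: "bij_betw (inv_into (characters S) p) (Sigma_top n G) (Sigma_top n S)"
      "bij_betw (inv_into (characters S) p) (Sigma_top_hom n G R) (Sigma_top_hom n S R)"
    using top hom
    by (auto simp: bij_betw_def Sigma_top_def Sigma_top_hom_def intro!: bij_betw_inv_into_subset[OF bij, unfolded bij_betw_def])
  have "bij_betw (q \<circ> inv_into (characters S) p) (Sigma_top n G) (Sigma_top n H) \<and>
      bij_betw (q \<circ> inv_into (characters S) p) (Sigma_top_hom n G R) (Sigma_top_hom n H R)"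
    if "tdlc_completion \<Gamma> \<Lambda> H \<theta>"
  proof -
    interpret H: proper_epimorphism H S "completion_map \<Gamma> \<Lambda> H \<theta>"
      unfolding S_def using assms(1) that by (rule tdlc_completion_proper_epimorphism)
    show ?thesis
      unfolding q_def
      using bij_betw_trans[OF inv(1) H.bij_betw_Sigma_top]
        bij_betw_trans[OF inv(2) H.bij_betw_Sigma_top_hom[OF assms(3)]] by blast
  qed
  with iso top hom show ?thesis by blast
qed

end
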